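(* Let $K$ be an algebraically closed field of characteristic zero, let $n\ge 2$, and let $R=K[x_{i,j},y_{i,j},z_{i,j}\mid 1\le i\le 2,\ 1\le j\le n]$ be equipped with the graded reverse lexicographic ordering specified in the context. Let $\Gamma\subset R$ be the set of all the polynomials $a_{p,q},b_{p,q},c_{p,q}$ ($1\le p<q\le n$), $d_{p,q,r},e_{p,q,r}$ ($1\le p<q<r\le n$), $f_{l,p,q,r}$ ($1\le l\le p<q<r\le n$) and $g_{l,p,q,r}$ ($1\le l<p<q<r\le n$) defined in the context. Then $\Gamma$ is a Gröbner basis of the ideal $I^{2,n}_{2,2}$.
   Context: The ideal $I^{2,n}_{2,2}$: consider the $2\times n$ matrix $X(t)$ with entries $x_{i,j}+y_{i,j}t+z_{i,j}t^2$. Each $2\times 2$ minor of $X(t)$ is a polynomial $\sum_l f_l t^l$ in $t$ with $f_l\in R$; $I^{2,n}_{2,2}$ is the ideal of $R$ generated by $f_0,f_1,f_2$ for all $2\times 2$ minors. The polynomials: $$a_{p,q}=\det\begin{pmatrix} x_{1,p} & x_{1,q} \\ x_{2,p} & x_{2,q} \end{pmatrix},\qquad b_{p,q}=\det\begin{pmatrix} x_{1,p} & x_{1,q} \\ y_{2,p} & y_{2,q} \end{pmatrix}+\det\begin{pmatrix} y_{1,p} & y_{1,q} \\ x_{2,p} & x_{2,q} \end{pmatrix},$$ $$c_{p,q}=\det\begin{pmatrix} x_{1,p} & x_{1,q} \\ z_{2,p} & z_{2,q} \end{pmatrix}+\det\begin{pmatrix} z_{1,p} & z_{1,q} \\ x_{2,p}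 & x_{2,q} \end{pmatrix}+\det\begin{pmatrix} y_{1,p} & y_{1,q} \\ y_{2,p} & y_{2,q} \end{pmatrix},$$ $$d_{p,q,r}=\det\begin{pmatrix} x_{2,p} & x_{2,q} & x_{2,r} \\ y_{1,p} & y_{1,q} & y_{1,r} \\ z_{2,p} & z_{2,q} & z_{2,r} \end{pmatrix}+\det\begin{pmatrix} x_{2,p} & x_{2,q} & x_{2,r} \\ z_{1,p} & z_{1,q} & z_{1,r} \\ y_{2,p} & y_{2,q} & y_{2,r} \end{pmatrix},$$ $$e_{p,q,r}=\det\begin{pmatrix} x_{1,p} & x_{1,q} & x_{1,r} \\ y_{1,p} & y_{1,q} & y_{1,r} \\ z_{2,p} & z_{2,q} & z_{2,r} \end{pmatrix}+\det\begin{pmatrix} z_{1,p} & z_{1,q} & z_{1,r} \\ y_{1,p} & y_{1,q} & y_{1,r} \\ x_{2,p} & x_{2,q} & x_{2,r} \end{pmatrix},$$ $$f_{l,p,q,r}=\det\begin{pmatrix} 0 & x_{2,p} & x_{2,q} & x_{2,r} \\ x_{2,l} & y_{2,p} & y_{2,q} & y_{2,r} \\ y_{1,l} & z_{1,p} & z_{1,q} & z_{1,r} \\ y_{2,l} & z_{2,p} & z_{2,q} & z_{2,r} \end{pmatrix},\qquad g_{l,p,q,r}=\det\begin{pmatrix} x_{2,l} & x_{2,p} & x_{2,q} & x_{2,r} \\ y_{2,l} & y_{2,p} & y_{2,q} & y_{2,r} \\ z_{2,l} & z_{2,p} & z_{2,q} & z_{2,r} \\ z_{1,l} & z_{1,p}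 & z_{1,q} & z_{1,r} \end{pmatrix}.$$ Monomial ordering: the graded reverse lexicographic ordering on $R$ induced by $z_{1,1}>z_{1,2}>\cdots>z_{1,n}>z_{2,1}>\cdots>z_{2,n}>y_{1,1}>\cdots>y_{1,n}>y_{2,1}>\cdots>y_{2,n}>x_{1,1}>\cdots>x_{1,n}>x_{2,1}>\cdots>x_{2,n}$: for variables $w_1>\cdots>w_N$ and distinct monomials $t=\prod w_i^{e_i}$, $t'=\prod w_i^{e_i'}$, one has $t<t'$ iff $\deg t<\deg t'$, or $\deg t=\deg t'$ and $e_i>e_i'$ for the largest index $i$ with $e_i\ne e_i'$. A finite subset $G$ of an ideal $I$ is a Gröbner basis of $I$ if the ideal generated by the leading monomials of the nonzero elements of $G$ equals the ideal generated by the leading monomials of all nonzero elements of $I$. *)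

theory Defs
  imports
    "HOL-Library.Poly_Mapping"
    "HOL-Algebra.Ideal"
    "Jordan_Normal_Form.Determinant"
    "Jordan_Normal_Form.DL_Submatrix"
begin

datatype var = X nat nat | Y nat nat | Z nat nat

type_synonym mono = "var \<Rightarrow>\<^sub>0 nat"
type_synonym 'k mpoly = "mono \<Rightarrow>\<^sub>0 'k"

definition xv :: "nat \<Rightarrow> nat \<Rightarrow> 'k::comm_ring_1 mpoly" where
  "xv i j = Poly_Mapping.single (Poly_Mapping.single (X i j) 1) 1"

definition yv :: "nat \<Rightarrow> nat \<Rightarrow> 'k::comm_ring_1 mpoly" where
  "yv i j = Poly_Mapping.single (Poly_Mapping.single (Y i j) 1) 1"

definition zv :: "nat \<Rightarrow> nat \<Rightarrow> 'k::comm_ring_1 mpoly" where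
  "zv i j = Poly_Mapping.single (Poly_Mapping.single (Z i j) 1) 1"


section \<open>The polynomial ring $R$\<close>

text \<open>The type \<^typ>\<open>'k mpoly\<close> has infinitely many variables; $R$ is the subring of
  polynomials in the $6n$ variables with row index in $\{1,2\}$ and column index in
  $\{1,\dots,n\}$, and all ideals below are ideals of that subring.\<close>

definition vars :: "nat \<Rightarrow> var set" where
  "vars n = {v. \<exists>i\<in>{1,2}. \<exists>j\<in>{1..n}. v = X i j \<or> v = Y i j \<or> v = Z i j}"

definition poly_ring :: "nat \<Rightarrow> 'k::comm_ring_1 mpoly ring" where
  "poly_ring n =
    \<lparr>carrier = {p. \<forall>m\<in>Poly_Mapping.keys p. Poly_Mapping.keys m \<subseteq> vars n},
     monoid.mult = (*), one = 1, zero = 0, add = (+)\<rparr>"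

text \<open>\<^const>\<open>genideal\<close> is an intersection over all ideals, so it is only meaningful
  over an actual ring.\<close>

lemma carrier_poly_ring:
  "p \<in> carrier (poly_ring n) \<longleftrightarrow>
     (\<forall>m\<in>Poly_Mapping.keys p. Poly_Mapping.keys m \<subseteq> vars n)"
  by (simp add: poly_ring_def)

lemma poly_ring_simps:
  "\<one>\<^bsub>poly_ring n\<^esub> = 1" "\<zero>\<^bsub>poly_ring n\<^esub> = 0"
  "p \<otimes>\<^bsub>poly_ring n\<^esub> q = p * q" "p \<oplus>\<^bsub>poly_ring n\<^esub> q = p + q"
  by (simp_all add: poly_ring_def)

lemma plus_closed_poly_ring:
  assumes "p \<in> carrier (poly_ring n)" "q \<in> carrier (poly_ring n)"
  shows "p + q \<in> carrier (poly_ring n)"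
  unfolding carrier_poly_ring
proof
  fix m assume "m \<in> Poly_Mapping.keys (p + q)"
  then have "m \<in> Poly_Mapping.keys p \<or> m \<in> Poly_Mapping.keys q"
    using Poly_Mapping.keys_add[of p q] by auto
  then show "Poly_Mapping.keys m \<subseteq> vars n"
    using assms unfolding carrier_poly_ring by metis
qed

lemma times_closed_poly_ring:
  assumes "p \<in> carrier (poly_ring n)" "q \<in> carrier (poly_ring n)"
  shows "p * q \<in> carrier (poly_ring n)"
  unfolding carrier_poly_ring
proof
  fix m assume "m \<in> Poly_Mapping.keys (p * q)"
  then obtain a b where ab: "a \<in> Poly_Mapping.keys p" "b \<in> Poly_Mapping.keys q" "m = a + b"
    using keys_mult[of p q] by auto
  then have "Poly_Mapping.keys a \<subseteq> vars n" "Poly_Mapping.keys b \<subseteq> vars n"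
    using assms unfolding carrier_poly_ring by metis+
  then show "Poly_Mapping.keys m \<subseteq> vars n"
    using Poly_Mapping.keys_add[of a b] ab(3) by (metis Un_subset_iff subset_trans Un_least)
qed

lemma cring_poly_ring: "cring (poly_ring n :: 'k::comm_ring_1 mpoly ring)"
proof (rule cringI)
  show "abelian_group (poly_ring n :: 'k mpoly ring)"
  proof (rule abelian_groupI)
    fix p :: "'k mpoly" assume "p \<in> carrier (poly_ring n)"
    then have "- p \<in> carrier (poly_ring n)" by (simp add: carrier_poly_ring)
    then show "\<exists>q\<in>carrier (poly_ring n). q \<oplus>\<^bsub>poly_ring n\<^esub> p = \<zero>\<^bsub>poly_ring n\<^esub>"
      by (intro bexI[of _ "- p"]) (simp_all add: poly_ring_simps)
  qed (simp_all add: poly_ring_simps plus_closed_poly_ring carrier_poly_ring[of 0] add_ac)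
  show "comm_monoid (poly_ring n :: 'k mpoly ring)"
    by (rule comm_monoidI)
      (simp_all add: poly_ring_simps times_closed_poly_ring carrier_poly_ring[of 1] mult_ac)
qed (simp add: poly_ring_simps distrib_right)


section \<open>Monomial order and Groebner bases\<close>

text \<open>Smaller position means larger variable:
  $z_{1,1} > \dots > z_{2,n} > y_{1,1} > \dots > y_{2,n} > x_{1,1} > \dots > x_{2,n}$.\<close>

fun var_pos :: "var \<Rightarrow> nat \<times> nat \<times> nat" where
  "var_pos (Z i j) = (0, i, j)"
| "var_pos (Y i j) = (1, i, j)"
| "var_pos (X i j) = (2, i, j)"

definition var_less :: "var \<Rightarrow> var \<Rightarrow> bool" where
  "var_less v w \<longleftrightarrow> (var_pos w, var_pos v) \<in> less_than <*lex*> less_than <*lex*> less_than"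

definition mono_deg :: "mono \<Rightarrow> nat" where
  "mono_deg s = (\<Sum>v\<in>Poly_Mapping.keys s. Poly_Mapping.lookup s v)"

definition grevlex_less :: "mono \<Rightarrow> mono \<Rightarrow> bool" where
  "grevlex_less s t \<longleftrightarrow>
     mono_deg s < mono_deg t \<or>
     mono_deg s = mono_deg t \<and>
       (\<exists>v. Poly_Mapping.lookup s v > Poly_Mapping.lookup t v \<and>
            (\<forall>w. var_less w v \<longrightarrow> Poly_Mapping.lookup s w = Poly_Mapping.lookup t w))"

definition lead_mono :: "'k::zero mpoly \<Rightarrow> mono" where
  "lead_mono p =
     (THE m. m \<in> Poly_Mapping.keys p \<and>
             (\<forall>m'\<in>Poly_Mapping.keys p. m' \<noteq> m \<longrightarrow> grevlex_less m' m))"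

definition lead_monos :: "'k::comm_ring_1 mpoly set \<Rightarrow> 'k mpoly set" where
  "lead_monos S = {Poly_Mapping.single (lead_mono p) 1 |p. p \<in> S \<and> p \<noteq> 0}"

definition is_groebner_basis :: "nat \<Rightarrow> 'k::comm_ring_1 mpoly set \<Rightarrow> 'k mpoly set \<Rightarrow> bool" where
  "is_groebner_basis n G I \<longleftrightarrow>
     ideal I (poly_ring n) \<and> finite G \<and> G \<subseteq> I \<and>
     Idl\<^bsub>poly_ring n\<^esub> (lead_monos G) = Idl\<^bsub>poly_ring n\<^esub> (lead_monos I)"


section \<open>The ideal $I^{2,n}_{2,2}$\<close>

definition minors :: "nat \<Rightarrow> 'a::comm_ring_1 mat \<Rightarrow> 'a set" where
  "minors k A =
     {det (submatrix A I J) |I J.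
        I \<subseteq> {..<dim_row A} \<and> J \<subseteq> {..<dim_col A} \<and> card I = k \<and> card J = k}"

text \<open>Matrix indices start at 0, whereas the variables are indexed from 1.\<close>

definition Xt :: "nat \<Rightarrow> 'k::comm_ring_1 mpoly poly mat" where
  "Xt n = mat 2 n (\<lambda>(i, j). [:xv (i + 1) (j + 1), yv (i + 1) (j + 1), zv (i + 1) (j + 1):])"

definition jet_ideal :: "nat \<Rightarrow> 'k::comm_ring_1 mpoly set" where
  "jet_ideal n =
     Idl\<^bsub>poly_ring n\<^esub> {poly.coeff F l |F l. F \<in> minors 2 (Xt n) \<and> l \<in> {0, 1, 2}}"


section \<open>The set $\Gamma$\<close>

definition a_poly :: "nat \<Rightarrow> nat \<Rightarrow> 'k::comm_ring_1 mpoly" where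
  "a_poly p q = det (mat_of_rows_list 2 [[xv 1 p, xv 1 q], [xv 2 p, xv 2 q]])"

definition b_poly :: "nat \<Rightarrow> nat \<Rightarrow> 'k::comm_ring_1 mpoly" where
  "b_poly p q =
     det (mat_of_rows_list 2 [[xv 1 p, xv 1 q], [yv 2 p, yv 2 q]]) +
     det (mat_of_rows_list 2 [[yv 1 p, yv 1 q], [xv 2 p, xv 2 q]])"

definition c_poly :: "nat \<Rightarrow> nat \<Rightarrow> 'k::comm_ring_1 mpoly" where
  "c_poly p q =
     det (mat_of_rows_list 2 [[xv 1 p, xv 1 q], [zv 2 p, zv 2 q]]) +
     det (mat_of_rows_list 2 [[zv 1 p, zv 1 q], [xv 2 p, xv 2 q]]) +
     det (mat_of_rows_list 2 [[yv 1 p, yv 1 q], [yv 2 p, yv 2 q]])"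

definition d_poly :: "nat \<Rightarrow> nat \<Rightarrow> nat \<Rightarrow> 'k::comm_ring_1 mpoly" where
  "d_poly p q r =
     det (mat_of_rows_list 3
       [[xv 2 p, xv 2 q, xv 2 r],
        [yv 1 p, yv 1 q, yv 1 r],
        [zv 2 p, zv 2 q, zv 2 r]]) +
     det (mat_of_rows_list 3
       [[xv 2 p, xv 2 q, xv 2 r],
        [zv 1 p, zv 1 q, zv 1 r],
        [yv 2 p, yv 2 q, yv 2 r]])"

definition e_poly :: "nat \<Rightarrow> nat \<Rightarrow> nat \<Rightarrow> 'k::comm_ring_1 mpoly" where
  "e_poly p q r =
     det (mat_of_rows_list 3
       [[xv 1 p, xv 1 q, xv 1 r],
        [yv 1 p, yv 1 q, yv 1 r],
        [zv 2 p, zv 2 q, zv 2 r]]) +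
     det (mat_of_rows_list 3
       [[zv 1 p, zv 1 q, zv 1 r],
        [yv 1 p, yv 1 q, yv 1 r],
        [xv 2 p, xv 2 q, xv 2 r]])"

definition f_poly :: "nat \<Rightarrow> nat \<Rightarrow> nat \<Rightarrow> nat \<Rightarrow> 'k::comm_ring_1 mpoly" where
  "f_poly l p q r =
     det (mat_of_rows_list 4
       [[0,      xv 2 p, xv 2 q, xv 2 r],
        [xv 2 l, yv 2 p, yv 2 q, yv 2 r],
        [yv 1 l, zv 1 p, zv 1 q, zv 1 r],
        [yv 2 l, zv 2 p, zv 2 q, zv 2 r]])"

definition g_poly :: "nat \<Rightarrow> nat \<Rightarrow> nat \<Rightarrow> nat \<Rightarrow> 'k::comm_ring_1 mpoly" where
  "g_poly l p q r =
     det (mat_of_rows_list 4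
       [[xv 2 l, xv 2 p, xv 2 q, xv 2 r],
        [yv 2 l, yv 2 p, yv 2 q, yv 2 r],
        [zv 2 l, zv 2 p, zv 2 q, zv 2 r],
        [zv 1 l, zv 1 p, zv 1 q, zv 1 r]])"

definition Gamma_set :: "nat \<Rightarrow> 'k::comm_ring_1 mpoly set" where
  "Gamma_set n =
     {a_poly p q |p q. 1 \<le> p \<and> p < q \<and> q \<le> n} \<union>
     {b_poly p q |p q. 1 \<le> p \<and> p < q \<and> q \<le> n} \<union>
     {c_poly p q |p q. 1 \<le> p \<and> p < q \<and> q \<le> n} \<union>
     {d_poly p q r |p q r. 1 \<le> p \<and> p < q \<and> q < r \<and> r \<le> n} \<union>
     {e_poly p q r |p q r. 1 \<le> p \<and> p < q \<and> q < r \<and> r \<le> n} \<union>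
     {f_poly l p q r |l p q r. 1 \<le> l \<and> l \<le> p \<and> p < q \<and> q < r \<and> r \<le> n} \<union>
     {g_poly l p q r |l p q r. 1 \<le> l \<and> l < p \<and> p < q \<and> q < r \<and> r \<le> n}"

end

theory Submission
  imports Defs
begin

text \<open>
Write $A, B$ for the two rows of $x$-variables, $C, D$ for those of $y$ and $E, F$ for those of $z$.
The leading monomials of $\Gamma$ are
$B_p A_q$, $A_p D_q$, $D_p C_q$, $B_p C_q F_r$, $A_p C_q F_r$, $C_l B_p D_q F_r$, $B_l D_p F_q E_r$
with the indices of the respective polynomials (\<open>leads_a\<close> to \<open>leads_g\<close>), and $\Gamma$ is contained in
the ideal because its members are explicit combinations of the $a$, $b$, $c$
(\<open>Gamma_subset_jet_ideal\<close>). What has to be shown is that the leading monomial of every nonzero element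
of the ideal is divisible by one of these. No S-polynomial is ever reduced; instead, the argument only
uses that elements of the ideal vanish at certain points.

These points are the 2-jets of matrices whose first row is $\lambda(t)$ times the second row, with
$x_{2,n} \ne 0$. Let \<open>f\<close> be homogeneous and vanish at all of them. If the smallest
variable $x_{2,n}$ divides the leading monomial, then it divides \<open>f\<close>, by the defining property of the
reverse lexicographic order, and the quotient vanishes at the same points because $x_{2,n}$ is
nonzero there. So let $x_{2,n}$ not divide the leading monomial. Then \<open>f\<close> is restricted to limits of
the points as $x_{2,n}$ tends to 0. These limits form finitely many families of the same kind: each
is given by explicit parameters, has a variable that is nonzero while all smaller ones vanish, and
has limits of its own. By induction, the leading monomial of \<open>f\<close> violates the conditions that are
attached to each of these families; and the conditions are such that a monomial without $x_{2,n}$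
which meets those of the original family meets those of at least one of its limits.

The lemma \<open>excludes_step\<close> is this induction step in general. The families are the strata defined
below, with the inclusions into closures
\<^item> regular: regular (smaller), pole, twisted;
\<^item> pole: pole (smaller), split, cross;
\<^item> twisted: twisted (smaller), split, cross;
\<^item> split: split (smaller), top, a coordinate subspace;
\<^item> cross and top: the same with one column less, a coordinate subspace.

\<^noindent> The lemmas \<open>excludes_top\<close> to \<open>excludes_regular\<close> carry out the induction from the bottom up, and
\<open>lead_not_standard\<close> concludes that leading monomials of elements of the ideal are not standard.
\<close>

section \<open>The graded reverse lexicographic order\<close>

lemma var_less_simps [simp]:
  "var_less (X i j) (X k l) \<longleftrightarrow> k < i \<or> k = i \<and> l < j"
  "var_less (Y i j) (Y k l) \<longleftrightarrow> k < i \<or> k = i \<and> l < j"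
  "var_less (Z i j) (Z k l) \<longleftrightarrow> k < i \<or> k = i \<and> l < j"
  "var_less (X i j) (Y k l)" "var_less (X i j) (Z k l)" "var_less (Y i j) (Z k l)"
  "\<not> var_less (Y i j) (X k l)" "\<not> var_less (Z i j) (X k l)" "\<not> var_less (Z i j) (Y k l)"
  by (auto simp: var_less_def)

lemma vars_simps [simp]:
  "X i j \<in> vars n \<longleftrightarrow> i \<in> {1, 2} \<and> j \<in> {1..n}"
  "Y i j \<in> vars n \<longleftrightarrow> i \<in> {1, 2} \<and> j \<in> {1..n}"
  "Z i j \<in> vars n \<longleftrightarrow> i \<in> {1, 2} \<and> j \<in> {1..n}"
  by (simp_all add: vars_def) blast+

lemma finite_vars: "finite (vars n)"
proof -
  have "vars n \<subseteq> (\<lambda>(i, j). X i j) ` ({1, 2} \<times> {1..n}) \<union> (\<lambda>(i, j). Y i j) ` ({1, 2} \<times> {1..n})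
      \<union> (\<lambda>(i, j). Z i j) ` ({1, 2} \<times> {1..n})"
    by (auto simp: vars_def)
  then show ?thesis
    by (rule finite_subset) auto
qed

lemma var_less_linear: "v \<noteq> w \<Longrightarrow> var_less v w \<or> var_less w v"
  by (cases v; cases w) auto

lemma var_less_irrefl [simp]: "\<not> var_less v v"
  by (cases v) auto

lemma var_less_trans: "var_less u v \<Longrightarrow> var_less v w \<Longrightarrow> var_less u w"
  by (cases u; cases v; cases w) auto

lemma smallest_var:
  assumes "finite A" "A \<noteq> {}"
  shows "\<exists>v\<in>A. \<forall>w. var_less w v \<longrightarrow> w \<notin> A"
  using assms
proof (induction A rule: finite_ne_induct)
  case (singleton x)
  then show ?case by auto
next
  case (insert x F)
  then obtain v where v: "v \<in> F" "\<forall>w. var_less w v \<longrightarrow> w \<notin> F"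
    by blast
  show ?case
  proof (cases "var_less x v")
    case True
    then have "\<forall>w. var_less w x \<longrightarrow> w \<notin> insert x F"
      using v(2) var_less_trans[of _ x v] True by auto
    then show ?thesis by blast
  next
    case False
    then have "\<forall>w. var_less w v \<longrightarrow> w \<notin> insert x F"
      using v(2) by blast
    then show ?thesis using v(1) by blast
  qed
qed

lemma mono_deg_superset:
  assumes "finite W" "Poly_Mapping.keys s \<subseteq> W"
  shows "mono_deg s = (\<Sum>v\<in>W. Poly_Mapping.lookup s v)"
  unfolding mono_deg_def using assms
  by (intro sum.mono_neutral_left) (auto simp: in_keys_iff)

lemma mono_deg_add [simp]: "mono_deg (s + t) = mono_deg s + mono_deg t"
proof -
  let ?W = "Poly_Mapping.keys s \<union> Poly_Mapping.keys t"
  have "mono_deg (s + t) = (\<Sum>v\<in>?W. Poly_Mapping.lookup (s + t) v)"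
    by (rule mono_deg_superset) (auto simp: Poly_Mapping.keys_add)
  then show ?thesis
    by (simp add: mono_deg_superset[of ?W] lookup_add sum.distrib)
qed

lemma mono_deg_single [simp]: "mono_deg (Poly_Mapping.single v a) = a"
  by (simp add: mono_deg_def)

lemma grevlex_irrefl [simp]: "\<not> grevlex_less s s"
  by (simp add: grevlex_less_def)

lemma grevlex_add_cancel [simp]: "grevlex_less (s + u) (t + u) \<longleftrightarrow> grevlex_less s t"
  by (simp add: grevlex_less_def lookup_add)

lemma grevlex_trans:
  assumes "grevlex_less s t" "grevlex_less t u"
  shows "grevlex_less s u"
proof (cases "mono_deg s = mono_deg t \<and> mono_deg t = mono_deg u")
  case False
  then show ?thesis using assms by (auto simp: grevlex_less_def)
next
  case True
  then obtain v w where
    v: "Poly_Mapping.lookup s v > Poly_Mapping.lookup t v"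
      "\<And>x. var_less x v \<Longrightarrow> Poly_Mapping.lookup s x = Poly_Mapping.lookup t x" and
    w: "Poly_Mapping.lookup t w > Poly_Mapping.lookup u w"
      "\<And>x. var_less x w \<Longrightarrow> Poly_Mapping.lookup t x = Poly_Mapping.lookup u x"
    using assms by (auto simp: grevlex_less_def)
  consider "v = w" | "var_less v w" | "var_less w v"
    using var_less_linear by blast
  then have "\<exists>v. Poly_Mapping.lookup s v > Poly_Mapping.lookup u v \<and>
      (\<forall>x. var_less x v \<longrightarrow> Poly_Mapping.lookup s x = Poly_Mapping.lookup u x)"
  proof cases
    case 1
    then show ?thesis using v w by (intro exI[of _ v]) auto
  next
    case 2
    then show ?thesis using v w(2)[OF 2] w(2)[OF var_less_trans[OF _ 2]]
      by (intro exI[of _ v]) auto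
  next
    case 3
    then show ?thesis using w v(2)[OF 3] v(2)[OF var_less_trans[OF _ 3]]
      by (intro exI[of _ w]) auto
  qed
  then show ?thesis using True by (auto simp: grevlex_less_def)
qed

lemma grevlex_linear:
  assumes "s \<noteq> t"
  shows "grevlex_less s t \<or> grevlex_less t s"
proof -
  let ?D = "{v. Poly_Mapping.lookup s v \<noteq> Poly_Mapping.lookup t v}"
  have "?D \<subseteq> Poly_Mapping.keys s \<union> Poly_Mapping.keys t"
    by (auto simp: in_keys_iff)
  then have "finite ?D"
    by (rule finite_subset) auto
  moreover have "?D \<noteq> {}"
    using assms poly_mapping_eqI[of s t] by blast
  ultimately obtain v where v: "v \<in> ?D" "\<forall>w. var_less w v \<longrightarrow> w \<notin> ?D"
    using smallest_var by blast
  then consider "Poly_Mapping.lookup s v > Poly_Mapping.lookup t v"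
    | "Poly_Mapping.lookup s v < Poly_Mapping.lookup t v"
    by force
  then show ?thesis
  proof cases
    case 1
    then have "\<exists>v. Poly_Mapping.lookup s v > Poly_Mapping.lookup t v \<and>
        (\<forall>w. var_less w v \<longrightarrow> Poly_Mapping.lookup s w = Poly_Mapping.lookup t w)"
      using v(2) by blast
    then show ?thesis
      using linorder_less_linear[of "mono_deg s" "mono_deg t"] unfolding grevlex_less_def by blast
  next
    case 2
    then have "\<exists>v. Poly_Mapping.lookup t v > Poly_Mapping.lookup s v \<and>
        (\<forall>w. var_less w v \<longrightarrow> Poly_Mapping.lookup t w = Poly_Mapping.lookup s w)"
      using v(2) by fastforce
    then show ?thesis
      using linorder_less_linear[of "mono_deg t" "mono_deg s"] unfolding grevlex_less_def by blast
  qed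
qed

text \<open>Being the maximum of a finite set of monomials, rather than the leading monomial of a polynomial:
below, polynomials are handled as a finite set of monomials with a coefficient function.\<close>
definition leads :: "mono set \<Rightarrow> mono \<Rightarrow> bool" where
  "leads S m \<longleftrightarrow> m \<in> S \<and> (\<forall>k\<in>S. k \<noteq> m \<longrightarrow> grevlex_less k m)"

lemma leads_exists:
  assumes "finite S" "S \<noteq> {}"
  shows "\<exists>m. leads S m"
  using assms
proof (induction S rule: finite_ne_induct)
  case (singleton x)
  then show ?case by (auto simp: leads_def)
next
  case (insert x F)
  then obtain m where m: "leads F m" by blast
  show ?case
  proof (cases "grevlex_less x m")
    case True
    then show ?thesis using m by (intro exI[of _ m]) (auto simp: leads_def)
  next
    case False
    have "m \<noteq> x"
      using insert.hyps m by (auto simp: leads_def)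
    then have "grevlex_less m x"
      using grevlex_linear False by blast
    then show ?thesis using m
      by (intro exI[of _ x]) (auto simp: leads_def intro: grevlex_trans[of _ m x])
  qed
qed

lemma lead_mono_eqI:
  assumes "leads (Poly_Mapping.keys p) m"
  shows "lead_mono p = m"
  unfolding lead_mono_def
proof (rule the_equality)
  fix k assume "k \<in> Poly_Mapping.keys p \<and> (\<forall>m'\<in>Poly_Mapping.keys p. m' \<noteq> k \<longrightarrow> grevlex_less m' k)"
  then show "k = m"
    using assms grevlex_trans[of k m k] grevlex_irrefl[of k] unfolding leads_def by metis
qed (use assms in \<open>auto simp: leads_def\<close>)

lemma leads_lead_mono:
  assumes "p \<noteq> 0"
  shows "leads (Poly_Mapping.keys p) (lead_mono p)"
proof -
  obtain m where "leads (Poly_Mapping.keys p) m"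
    using leads_exists[of "Poly_Mapping.keys p"] assms by auto
  then show ?thesis
    by (simp only: lead_mono_eqI)
qed

section \<open>Evaluation of monomials\<close>

definition mono_eval :: "(var \<Rightarrow> 'k::comm_ring_1) \<Rightarrow> mono \<Rightarrow> 'k" where
  "mono_eval p m = (\<Prod>v\<in>Poly_Mapping.keys m. p v ^ Poly_Mapping.lookup m v)"

lemma mono_eval_superset:
  assumes "finite W" "Poly_Mapping.keys m \<subseteq> W"
  shows "mono_eval p m = (\<Prod>v\<in>W. p v ^ Poly_Mapping.lookup m v)"
  unfolding mono_eval_def using assms
  by (intro prod.mono_neutral_left) (auto simp: in_keys_iff)

lemma mono_eval_add: "mono_eval p (s + t) = mono_eval p s * mono_eval p t"
proof -
  let ?W = "Poly_Mapping.keys s \<union> Poly_Mapping.keys t"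
  have "mono_eval p (s + t) = (\<Prod>v\<in>?W. p v ^ Poly_Mapping.lookup (s + t) v)"
    by (rule mono_eval_superset) (auto simp: Poly_Mapping.keys_add)
  then show ?thesis
    by (simp add: mono_eval_superset[of ?W] lookup_add power_add prod.distrib)
qed

lemma mono_eval_single [simp]: "mono_eval p (Poly_Mapping.single v 1) = p v"
  by (simp add: mono_eval_def)

lemma mono_eval_zero [simp]: "mono_eval p 0 = 1"
  by (simp add: mono_eval_def)

lemma mono_eval_eq_0:
  assumes "v \<in> Poly_Mapping.keys m" "p v = 0"
  shows "mono_eval p m = 0"
proof -
  have "p v ^ Poly_Mapping.lookup m v = 0"
    using assms by (simp add: in_keys_iff zero_power)
  then show ?thesis
    unfolding mono_eval_def using assms(1) by (meson finite_keys prod_zero)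
qed

lemma mono_eval_scale: "mono_eval (\<lambda>v. t * p v) m = t ^ mono_deg m * mono_eval p m"
  by (simp add: mono_eval_def mono_deg_def power_mult_distrib prod.distrib power_sum)

section \<open>Limits along polynomial curves\<close>

text \<open>Polynomial dependence on the parameter of a curve. A curve is given by a function of the parameter
in each coordinate, so no polynomials over polynomials are needed.\<close>
definition poly_fun :: "('k::comm_ring_1 \<Rightarrow> 'k) \<Rightarrow> bool" where
  "poly_fun g \<longleftrightarrow> (\<exists>q. \<forall>x. g x = poly q x)"

lemma poly_fun_intros [intro, simp]:
  fixes g h :: "'k::comm_ring_1 \<Rightarrow> 'k"
  shows "poly_fun (\<lambda>x::'k. a)"
  "poly_fun (\<lambda>x::'k. x)"
  "poly_fun g \<Longrightarrow> poly_fun h \<Longrightarrow> poly_fun (\<lambda>x. g x + h x)"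
  "poly_fun g \<Longrightarrow> poly_fun h \<Longrightarrow> poly_fun (\<lambda>x. g x * h x)"
  "poly_fun g \<Longrightarrow> poly_fun h \<Longrightarrow> poly_fun (\<lambda>x. g x - h x)"
  "poly_fun g \<Longrightarrow> poly_fun (\<lambda>x. g x ^ k)"
  "(P \<Longrightarrow> poly_fun g) \<Longrightarrow> (\<not> P \<Longrightarrow> poly_fun h) \<Longrightarrow> poly_fun (\<lambda>x. if P then g x else h x)"
proof -
  show "poly_fun (\<lambda>x::'k. a)"
    unfolding poly_fun_def by (rule exI[of _ "[:a:]"]) simp
  show "poly_fun (\<lambda>x::'k. x)"
    unfolding poly_fun_def by (rule exI[of _ "[:0, 1:]"]) simp
  show "poly_fun (\<lambda>x. g x + h x)" if "poly_fun g" "poly_fun h"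
    using that unfolding poly_fun_def by (metis poly_add)
  show "poly_fun (\<lambda>x. g x * h x)" if "poly_fun g" "poly_fun h"
    using that unfolding poly_fun_def by (metis poly_mult)
  show "poly_fun (\<lambda>x. g x - h x)" if "poly_fun g" "poly_fun h"
    using that unfolding poly_fun_def by (metis poly_diff)
  show "poly_fun (\<lambda>x. g x ^ k)" if "poly_fun g"
    using that unfolding poly_fun_def by (metis poly_power)
  show "poly_fun (\<lambda>x. if P then g x else h x)" if "P \<Longrightarrow> poly_fun g" "\<not> P \<Longrightarrow> poly_fun h"
    using that by (cases P) auto
qed

lemma poly_fun_sum: "(\<And>i. i \<in> A \<Longrightarrow> poly_fun (g i)) \<Longrightarrow> poly_fun (\<lambda>x. \<Sum>i\<in>A. g i x)"
  by (induction A rule: infinite_finite_induct) auto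

lemma poly_fun_prod: "(\<And>i. i \<in> A \<Longrightarrow> poly_fun (g i)) \<Longrightarrow> poly_fun (\<lambda>x. \<Prod>i\<in>A. g i x)"
  by (induction A rule: infinite_finite_induct) auto

lemma poly_fun_zero:
  fixes g :: "'k::field \<Rightarrow> 'k"
  assumes "poly_fun g" "infinite {x. g x = 0}"
  shows "g x = 0"
proof -
  obtain q where q: "\<And>x. g x = poly q x"
    using assms(1) by (auto simp: poly_fun_def)
  have "q = 0"
    using assms(2) poly_roots_finite[of q] q by auto
  then show ?thesis by (simp add: q)
qed

text \<open>The point at parameter 0 of a polynomial curve that runs inside the set for infinitely many
parameters. A polynomial that vanishes on the set vanishes there, because its restriction to the
curve has infinitely many zeros. The finitely many excluded parameters leave room for the value 0
itself and for accidental zeros of a coordinate that has to stay nonzero.\<close>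
definition limit_point :: "(var \<Rightarrow> 'k::field) set \<Rightarrow> (var \<Rightarrow> 'k) \<Rightarrow> bool" where
  "limit_point V p \<longleftrightarrow> (\<exists>\<gamma>. (\<forall>v. poly_fun (\<lambda>\<epsilon>. \<gamma> \<epsilon> v)) \<and> \<gamma> 0 = p \<and> infinite {\<epsilon>. \<gamma> \<epsilon> \<in> V})"

definition adherent :: "(var \<Rightarrow> 'k::field) set \<Rightarrow> (var \<Rightarrow> 'k) set \<Rightarrow> bool" where
  "adherent V V' \<longleftrightarrow> (\<forall>p\<in>V'. limit_point V p)"

definition vanishes :: "mono set \<Rightarrow> (mono \<Rightarrow> 'k::field) \<Rightarrow> (var \<Rightarrow> 'k) set \<Rightarrow> bool" where
  "vanishes S c V \<longleftrightarrow> (\<forall>p\<in>V. (\<Sum>k\<in>S. c k * mono_eval p k) = 0)"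

lemma vanishes_adherent:
  assumes "vanishes S c V" "adherent V V'"
  shows "vanishes S c V'"
  unfolding vanishes_def
proof
  fix p assume "p \<in> V'"
  then obtain \<gamma> where \<gamma>: "\<And>v. poly_fun (\<lambda>\<epsilon>. \<gamma> \<epsilon> v)" "\<gamma> 0 = p" "infinite {\<epsilon>. \<gamma> \<epsilon> \<in> V}"
    using assms(2) unfolding adherent_def limit_point_def by blast
  let ?g = "\<lambda>\<epsilon>. \<Sum>k\<in>S. c k * mono_eval (\<gamma> \<epsilon>) k"
  have "poly_fun ?g"
    unfolding mono_eval_def by (intro poly_fun_sum poly_fun_intros poly_fun_prod \<gamma>(1))
  moreover have "{\<epsilon>. \<gamma> \<epsilon> \<in> V} \<subseteq> {\<epsilon>. ?g \<epsilon> = 0}"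
    using assms(1) by (auto simp: vanishes_def)
  then have "infinite {\<epsilon>. ?g \<epsilon> = 0}"
    using \<gamma>(3) infinite_super by blast
  ultimately have "?g 0 = 0"
    by (rule poly_fun_zero)
  then show "(\<Sum>k\<in>S. c k * mono_eval p k) = 0"
    by (simp add: \<gamma>(2))
qed

section \<open>Leading monomials of polynomials vanishing on a set\<close>

text \<open>A polynomial is presented by a finite set \<open>S\<close> of monomials of one degree and a coefficient
function \<open>c\<close>, so that division by a variable is a mere reindexing of \<open>S\<close>. All monomial ideals that
occur are squarefree; this is why \<open>G\<close> is a predicate on the support of a monomial.\<close>
definition excludes :: "nat \<Rightarrow> (var \<Rightarrow> 'k::field) set \<Rightarrow> (var set \<Rightarrow> bool) \<Rightarrow> bool" where
  "excludes n V G \<longleftrightarrow> (\<forall>S c d m. finite S \<longrightarrow>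
     (\<forall>k\<in>S. Poly_Mapping.keys k \<subseteq> vars n \<and> mono_deg k = d \<and> c k \<noteq> 0) \<longrightarrow>
     vanishes S c V \<longrightarrow> leads S m \<longrightarrow> \<not> G (Poly_Mapping.keys m))"

lemma excludesD:
  assumes "excludes n V G" "finite S" "\<And>k. k \<in> S \<Longrightarrow> Poly_Mapping.keys k \<subseteq> vars n"
    "\<And>k. k \<in> S \<Longrightarrow> mono_deg k = d" "\<And>k. k \<in> S \<Longrightarrow> c k \<noteq> 0" "vanishes S c V" "leads S m"
  shows "\<not> G (Poly_Mapping.keys m)"
proof -
  have "\<forall>k\<in>S. Poly_Mapping.keys k \<subseteq> vars n \<and> mono_deg k = d \<and> c k \<noteq> 0"
    using assms(3-5) by simp
  from assms(1)[unfolded excludes_def, THEN spec, THEN spec, THEN spec, THEN spec, THEN mp, OF assms(2),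
      THEN mp, OF this, THEN mp, OF assms(6), THEN mp, OF assms(7)]
  show ?thesis .
qed

text \<open>The property of the reverse lexicographic order on which everything rests: if a variable divides the
leading monomial of a homogeneous polynomial, it divides every monomial that is free of smaller
variables.\<close>
lemma grevlex_key:
  assumes "grevlex_less k m" "mono_deg k = mono_deg m" "w \<in> Poly_Mapping.keys m"
    "\<And>v. v \<in> Poly_Mapping.keys k \<Longrightarrow> \<not> var_less v w"
  shows "w \<in> Poly_Mapping.keys k"
proof -
  obtain v where v: "Poly_Mapping.lookup k v > Poly_Mapping.lookup m v"
    "\<And>u. var_less u v \<Longrightarrow> Poly_Mapping.lookup k u = Poly_Mapping.lookup m u"
    using assms(1,2) by (auto simp: grevlex_less_def)
  then have "v \<in> Poly_Mapping.keys k"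
    by (auto simp: in_keys_iff)
  then consider "v = w" | "var_less w v"
    using assms(4) var_less_linear by blast
  then show ?thesis
    using v assms(3) by cases (auto simp: in_keys_iff)
qed

lemma minus_single_add:
  fixes k :: mono
  assumes "w \<in> Poly_Mapping.keys k"
  shows "k - Poly_Mapping.single w 1 + Poly_Mapping.single w 1 = k"
proof (rule poly_mapping_eqI)
  fix v
  have "Poly_Mapping.lookup k w \<ge> 1"
    using assms by (auto simp: in_keys_iff)
  then show "Poly_Mapping.lookup (k - Poly_Mapping.single w 1 + Poly_Mapping.single w 1) v = Poly_Mapping.lookup k v"
    by (auto simp: lookup_add lookup_minus lookup_single when_def)
qed

text \<open>The induction step of the whole argument. Let \<open>w\<close> be a variable that is invertible on \<open>V\<close>, while the
smaller variables vanish there. If \<open>w\<close> divides the leading monomial, the part of the polynomial that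
matters is divisible by \<open>w\<close>, and the quotient vanishes on \<open>V\<close> and has smaller degree. If not, the
polynomial is restricted to the boundary of \<open>V\<close>, and it is enough that every good support without
\<open>w\<close> is good for one of the boundary pieces.\<close>
lemma excludes_step:
  assumes unit: "\<And>p. p \<in> V \<Longrightarrow> p w \<noteq> 0"
    and small: "\<And>p v. p \<in> V \<Longrightarrow> v \<in> vars n \<Longrightarrow> var_less v w \<Longrightarrow> p v = 0"
    and Gsmall: "\<And>U v. G U \<Longrightarrow> v \<in> U \<Longrightarrow> v \<in> vars n \<Longrightarrow> \<not> var_less v w"
    and Gmono: "\<And>U U'. G U \<Longrightarrow> U' \<subseteq> U \<Longrightarrow> G U'"
    and boundary: "\<And>U. U \<subseteq> vars n \<Longrightarrow> w \<notin> U \<Longrightarrow> G U \<Longrightarrow>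
        \<exists>V' G'. excludes n V' G' \<and> adherent V V' \<and> G' U"
  shows "excludes n V G"
  unfolding excludes_def
proof (intro allI impI)
  fix S :: "mono set" and c :: "mono \<Rightarrow> 'a" and d m
  assume "finite S" "\<forall>k\<in>S. Poly_Mapping.keys k \<subseteq> vars n \<and> mono_deg k = d \<and> c k \<noteq> 0"
    "vanishes S c V" "leads S m"
  then show "\<not> G (Poly_Mapping.keys m)"
  proof (induction d arbitrary: S c m rule: less_induct)
    case (less d S c m)
    have kn: "Poly_Mapping.keys k \<subseteq> vars n" and kd: "mono_deg k = d" and kc: "c k \<noteq> 0" if "k \<in> S" for k
      using less.prems(2) that by auto
    have mS: "m \<in> S" using less.prems(4) by (simp add: leads_def)
    show ?case
    proof
      assume good: "G (Poly_Mapping.keys m)"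
      then have msmall: "\<not> var_less v w" if "v \<in> Poly_Mapping.keys m" for v
        using Gsmall[OF good that] kn[OF mS] that by blast
      show False
      proof (cases "w \<in> Poly_Mapping.keys m")
        case False
        then obtain V' G' where bd: "excludes n V' G'" "adherent V V'" "G' (Poly_Mapping.keys m)"
          using boundary[OF kn[OF mS] _ good] by blast
        have van: "vanishes S c V'"
          using less.prems(3) bd(2) by (rule vanishes_adherent)
        have "\<not> G' (Poly_Mapping.keys m)"
          by (rule excludesD[OF bd(1) less.prems(1) _ _ _ van less.prems(4)]) (erule kn, erule kd, erule kc)
        then show False
          using bd(3) by simp
      next
        case True
        let ?w = "Poly_Mapping.single w (1::nat)"
        \<comment> \<open>the monomials free of the variables that vanish on \<open>V\<close>; each of them is divisible by \<open>w\<close>\<close>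
        define T where "T = {k\<in>S. \<forall>v\<in>Poly_Mapping.keys k. \<not> var_less v w}"
        have TS: "T \<subseteq> S" and finT: "finite T" and mT: "m \<in> T"
          using less.prems(1) mS msmall by (auto simp: T_def)
        have wT: "w \<in> Poly_Mapping.keys k" if "k \<in> T" for k
        proof (cases "k = m")
          case False
          then have "grevlex_less k m"
            using less.prems(4) TS that by (auto simp: leads_def)
          then show ?thesis
            using grevlex_key[of k m w] kd TS mS True that by (auto simp: T_def)
        qed (use True in simp)
        have restore: "k - ?w + ?w = k" if "k \<in> T" for k
          by (rule minus_single_add[OF wT[OF that]])
        define S' where "S' = (\<lambda>k. k - ?w) ` T"
        define c' where "c' = (\<lambda>k. c (k + ?w))"
        have inj: "inj_on (\<lambda>k. k - ?w) T"
          by (rule inj_on_inverseI[where g = "\<lambda>k. k + ?w"]) (rule restore)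
        have S'E: "\<exists>k0\<in>T. k = k0 - ?w \<and> k + ?w = k0" if "k \<in> S'" for k
          using that restore by (auto simp: S'_def)
        have deg: "mono_deg k = d - 1 \<and> d > 0" if "k \<in> S'" for k
        proof -
          from S'E[OF that] obtain k0 where "k0 \<in> T" "k + ?w = k0" by blast
          then have "mono_deg (k + ?w) = d" using kd TS by auto
          then show ?thesis by simp
        qed
        have key: "Poly_Mapping.keys k \<subseteq> vars n" if "k \<in> S'" for k
        proof -
          from S'E[OF that] obtain k0 where "k0 \<in> T" "k + ?w = k0" by blast
          then have "Poly_Mapping.keys (k + ?w) \<subseteq> vars n" using kn TS by auto
          moreover have "Poly_Mapping.keys k \<subseteq> Poly_Mapping.keys (k + ?w)"
            by (auto simp: in_keys_iff lookup_add)
          ultimately show ?thesis by blast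
        qed
        have nz: "c' k \<noteq> 0" if "k \<in> S'" for k
          using S'E[OF that] kc TS by (auto simp: c'_def)
        have m': "m - ?w \<in> S'" using mT by (simp add: S'_def)
        have lead': "leads S' (m - ?w)"
          unfolding leads_def
        proof (intro conjI ballI impI m')
          fix k assume k: "k \<in> S'" "k \<noteq> m - ?w"
          from S'E[OF k(1)] obtain k0 where k0: "k0 \<in> T" "k = k0 - ?w" "k + ?w = k0" by blast
          then have "k0 \<noteq> m" using k(2) by auto
          then have "grevlex_less k0 m" using less.prems(4) k0 TS by (auto simp: leads_def)
          then have "grevlex_less (k + ?w) (m - ?w + ?w)"
            by (simp only: k0(3) restore[OF mT])
          then show "grevlex_less k (m - ?w)"
            by (simp only: grevlex_add_cancel)
        qed
        have van: "vanishes S' c' V"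
          unfolding vanishes_def
        proof
          fix p assume p: "p \<in> V"
          have "p w * (\<Sum>k\<in>S'. c' k * mono_eval p k) = (\<Sum>k\<in>T. p w * (c' (k - ?w) * mono_eval p (k - ?w)))"
            unfolding S'_def sum.reindex[OF inj] by (simp add: sum_distrib_left)
          also have "\<dots> = (\<Sum>k\<in>T. c k * mono_eval p k)"
          proof (rule sum.cong[OF refl])
            fix k assume k: "k \<in> T"
            have "mono_eval p k = mono_eval p (k - ?w + ?w)"
              by (simp only: restore[OF k])
            also have "\<dots> = mono_eval p (k - ?w) * p w"
              by (simp only: mono_eval_add mono_eval_single)
            finally show "p w * (c' (k - ?w) * mono_eval p (k - ?w)) = c k * mono_eval p k"
              unfolding c'_def restore[OF k] by (simp add: ac_simps)
          qed
          also have "\<dots> = (\<Sum>k\<in>S. c k * mono_eval p k)"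
          proof (rule sum.mono_neutral_left[OF less.prems(1) TS], intro ballI)
            fix k assume k: "k \<in> S - T"
            then obtain v where v: "v \<in> Poly_Mapping.keys k" "var_less v w"
              by (auto simp: T_def)
            then have "p v = 0"
              using small[OF p] kn k by blast
            then show "c k * mono_eval p k = 0"
              using mono_eval_eq_0[of v k p] v by simp
          qed
          also have "\<dots> = 0"
            using less.prems(3) p by (simp add: vanishes_def)
          finally show "(\<Sum>k\<in>S'. c' k * mono_eval p k) = 0"
            using unit[OF p] by simp
        qed
        have "\<not> G (Poly_Mapping.keys (m - ?w))"
        proof (rule less.IH[of "d - 1" S' c'])
          show "d - 1 < d" using deg[OF m'] by simp
          show "finite S'" using finT by (simp add: S'_def)
          show "\<forall>k\<in>S'. Poly_Mapping.keys k \<subseteq> vars n \<and> mono_deg k = d - 1 \<and> c' k \<noteq> 0"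
            using deg key nz by blast
        qed (use van lead' in auto)
        moreover have "Poly_Mapping.keys (m - ?w) \<subseteq> Poly_Mapping.keys m"
          by (auto simp: in_keys_iff lookup_minus)
        ultimately show False
          using Gmono[OF good] by blast
      qed
    qed
  qed
qed

section \<open>A stratification of the jet scheme\<close>

text \<open>Coordinates of a point column by column: \<open>a\<close>, \<open>b\<close> are the two rows of $x$-coordinates, \<open>c\<close>, \<open>d\<close>
those of $y$ and \<open>e\<close>, \<open>f\<close> those of $z$. These letters keep this meaning for all strata.\<close>
fun point :: "(nat \<Rightarrow> 'k::zero) \<Rightarrow> (nat \<Rightarrow> 'k) \<Rightarrow> (nat \<Rightarrow> 'k) \<Rightarrow> (nat \<Rightarrow> 'k) \<Rightarrow> (nat \<Rightarrow> 'k) \<Rightarrow> (nat \<Rightarrow> 'k) \<Rightarrow> var \<Rightarrow> 'k" where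
  "point a b c d e f (X i j) = (if i = 1 then a j else if i = 2 then b j else 0)"
| "point a b c d e f (Y i j) = (if i = 1 then c j else if i = 2 then d j else 0)"
| "point a b c d e f (Z i j) = (if i = 1 then e j else if i = 2 then f j else 0)"

lemma poly_fun_point:
  assumes "\<And>j. poly_fun (\<lambda>\<epsilon>. a \<epsilon> j)" "\<And>j. poly_fun (\<lambda>\<epsilon>. b \<epsilon> j)" "\<And>j. poly_fun (\<lambda>\<epsilon>. c \<epsilon> j)"
    "\<And>j. poly_fun (\<lambda>\<epsilon>. d \<epsilon> j)" "\<And>j. poly_fun (\<lambda>\<epsilon>. e \<epsilon> j)" "\<And>j. poly_fun (\<lambda>\<epsilon>. f \<epsilon> j)"
  shows "poly_fun (\<lambda>\<epsilon>. point (a \<epsilon>) (b \<epsilon>) (c \<epsilon>) (d \<epsilon>) (e \<epsilon>) (f \<epsilon>) v)"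
  using assms by (cases v) auto

lemma limit_pointI:
  fixes V :: "(var \<Rightarrow> 'k::field_char_0) set"
  assumes p: "p = point a' b' c' d' e' f'"
    and F: "finite F" "\<And>\<epsilon>. \<epsilon> \<notin> F \<Longrightarrow> point (a \<epsilon>) (b \<epsilon>) (c \<epsilon>) (d \<epsilon>) (e \<epsilon>) (f \<epsilon>) \<in> V"
    and "\<And>j. a 0 j = a' j" "\<And>j. b 0 j = b' j" "\<And>j. c 0 j = c' j"
    "\<And>j. d 0 j = d' j" "\<And>j. e 0 j = e' j" "\<And>j. f 0 j = f' j"
    and "\<And>j. poly_fun (\<lambda>\<epsilon>. a \<epsilon> j)" "\<And>j. poly_fun (\<lambda>\<epsilon>. b \<epsilon> j)" "\<And>j. poly_fun (\<lambda>\<epsilon>. c \<epsilon> j)"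
    "\<And>j. poly_fun (\<lambda>\<epsilon>. d \<epsilon> j)" "\<And>j. poly_fun (\<lambda>\<epsilon>. e \<epsilon> j)" "\<And>j. poly_fun (\<lambda>\<epsilon>. f \<epsilon> j)"
  shows "limit_point V p"
proof -
  let ?g = "\<lambda>\<epsilon>. point (a \<epsilon>) (b \<epsilon>) (c \<epsilon>) (d \<epsilon>) (e \<epsilon>) (f \<epsilon>)"
  have "- F \<subseteq> {\<epsilon>. ?g \<epsilon> \<in> V}"
    using F(2) by blast
  moreover have "infinite (- F)"
    using F(1) by (simp add: Compl_eq_Diff_UNIV infinite_UNIV_char_0)
  ultimately have "infinite {\<epsilon>. ?g \<epsilon> \<in> V}"
    using infinite_super by blast
  moreover have "poly_fun (\<lambda>\<epsilon>. ?g \<epsilon> v)" for v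
    by (intro poly_fun_point assms)
  moreover have "a 0 = a'" "b 0 = b'" "c 0 = c'" "d 0 = d'" "e 0 = e'" "f 0 = f'"
    using assms(4-9) by auto
  ultimately show ?thesis
    unfolding limit_point_def p by (intro exI[of _ ?g]) simp
qed

text \<open>Modulo $t^3$ the first row of the matrix is $\lambda(t)$ times the second one, where
$\lambda = l_0 + l_1 t + l_2 t^2$. For \<open>s = n\<close> and in the columns up to \<open>n\<close>, these are
all zeros of the jet ideal with $x_{2,n} \ne 0$; smaller \<open>s\<close> arise when $x_{2,n}$ tends to 0.\<close>
definition regular_stratum :: "nat \<Rightarrow> (var \<Rightarrow> 'k::field) set" where
  "regular_stratum s = {point a b c d e f |a b c d e f. \<exists>l0 l1 l2. b s \<noteq> 0 \<and> (\<forall>j>s. b j = 0) \<and>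
     (\<forall>j. a j = l0 * b j \<and> c j = l0 * d j + l1 * b j \<and> e j = l0 * f j + l1 * d j + l2 * b j)}"

text \<open>The limits where $\lambda$ acquires a pole but $x \ne 0$ persists: the second row is $\mu(t)$ times
the first one, with $\mu = m_1 t + m_2 t^2$.\<close>
definition pole_stratum :: "nat \<Rightarrow> (var \<Rightarrow> 'k::field) set" where
  "pole_stratum s = {point a b c d e f |a b c d e f. \<exists>m1 m2. a s \<noteq> 0 \<and> (\<forall>j>s. a j = 0) \<and>
     (\<forall>j. b j = 0 \<and> d j = m1 * a j \<and> f j = m1 * c j + m2 * a j)}"

text \<open>The limits where $x$ tends to 0, $l_0 = l$ and $l_1 = m$ stay finite and $l_2$ grows: the products of
$l_2$ with the vanishing entries $b_j$ survive, which makes $e_j$ arbitrary in the columns \<open>j \<le> s\<close>.\<close>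
definition twisted_stratum :: "nat \<Rightarrow> nat \<Rightarrow> (var \<Rightarrow> 'k::field) set" where
  "twisted_stratum s k = {point a b c d e f |a b c d e f. \<exists>l m. d k \<noteq> 0 \<and> (\<forall>j>k. d j = 0) \<and>
     (\<forall>j. a j = 0 \<and> b j = 0 \<and> c j = l * d j) \<and> (\<forall>j>s. e j = l * f j + m * d j)}"

text \<open>The limits where the slope $m$ of the twisted stratum or the coefficient $m_1$ of the pole stratum
becomes infinite. What remains are proportional rows of $y$, supported in the columns up to \<open>i\<close>, and
proportional rows of $z$ in the columns beyond \<open>k\<close>.\<close>
definition split_stratum :: "nat \<Rightarrow> nat \<Rightarrow> (var \<Rightarrow> 'k::field) set" where
  "split_stratum i k = {point a b c d e f |a b c d e f. \<exists>l. d i \<noteq> 0 \<and> (\<forall>j>i. d j = 0) \<and>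
     (\<forall>j. a j = 0 \<and> b j = 0 \<and> c j = l * d j) \<and> (\<forall>j>k. e j = l * f j)}"

text \<open>The limits where the second row of $y$ vanishes as well. Beyond column \<open>s\<close>, the first row of $y$ is
then proportional to the second row of $z$.\<close>
definition cross_stratum :: "nat \<Rightarrow> nat \<Rightarrow> (var \<Rightarrow> 'k::field) set" where
  "cross_stratum s k = {point a b c d e f |a b c d e f. \<exists>m. c k \<noteq> 0 \<and> (\<forall>j>k. c j = 0) \<and>
     (\<forall>j. a j = 0 \<and> b j = 0 \<and> d j = 0) \<and> (\<forall>j>s. f j = m * c j)}"

definition top_stratum :: "nat \<Rightarrow> nat \<Rightarrow> (var \<Rightarrow> 'k::field) set" where
  "top_stratum k h = {point a b c d e f |a b c d e f. \<exists>l. f h \<noteq> 0 \<and> (\<forall>j>h. f j = 0) \<and>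
     (\<forall>j. a j = 0 \<and> b j = 0 \<and> c j = 0 \<and> d j = 0) \<and> (\<forall>j>k. e j = l * f j)}"

text \<open>The bottom of the stratification; \<open>A\<close> lists the free coordinates.\<close>
definition coordinate_space :: "var set \<Rightarrow> (var \<Rightarrow> 'k::zero) set" where
  "coordinate_space A = {p. \<forall>v. v \<notin> A \<longrightarrow> p v = 0}"

lemma regular_stratumI:
  assumes "b s \<noteq> 0" "\<And>j. j > s \<Longrightarrow> b j = 0" "\<And>j. a j = l0 * b j"
    "\<And>j. c j = l0 * d j + l1 * b j" "\<And>j. e j = l0 * f j + l1 * d j + l2 * b j"
  shows "point a b c d e f \<in> regular_stratum s"
  using assms unfolding regular_stratum_def by blast

lemma pole_stratumI:
  assumes "a s \<noteq> 0" "\<And>j. j > s \<Longrightarrow> a j = 0" "\<And>j. b j = 0"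
    "\<And>j. d j = m1 * a j" "\<And>j. f j = m1 * c j + m2 * a j"
  shows "point a b c d e f \<in> pole_stratum s"
  using assms unfolding pole_stratum_def by blast

lemma twisted_stratumI:
  assumes "d k \<noteq> 0" "\<And>j. j > k \<Longrightarrow> d j = 0" "\<And>j. a j = 0" "\<And>j. b j = 0"
    "\<And>j. c j = l * d j" "\<And>j. j > s \<Longrightarrow> e j = l * f j + m * d j"
  shows "point a b c d e f \<in> twisted_stratum s k"
  using assms unfolding twisted_stratum_def by blast

lemma split_stratumI:
  assumes "d i \<noteq> 0" "\<And>j. j > i \<Longrightarrow> d j = 0" "\<And>j. a j = 0" "\<And>j. b j = 0"
    "\<And>j. c j = l * d j" "\<And>j. j > k \<Longrightarrow> e j = l * f j"
  shows "point a b c d e f \<in> split_stratum i k"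
  using assms unfolding split_stratum_def by blast

lemma cross_stratumI:
  assumes "c k \<noteq> 0" "\<And>j. j > k \<Longrightarrow> c j = 0" "\<And>j. a j = 0" "\<And>j. b j = 0"
    "\<And>j. d j = 0" "\<And>j. j > s \<Longrightarrow> f j = m * c j"
  shows "point a b c d e f \<in> cross_stratum s k"
  using assms unfolding cross_stratum_def by blast

lemma top_stratumI:
  assumes "f h \<noteq> 0" "\<And>j. j > h \<Longrightarrow> f j = 0" "\<And>j. a j = 0" "\<And>j. b j = 0"
    "\<And>j. c j = 0" "\<And>j. d j = 0" "\<And>j. j > k \<Longrightarrow> e j = l * f j"
  shows "point a b c d e f \<in> top_stratum k h"
  using assms unfolding top_stratum_def by blast

section \<open>Limits between strata\<close>

abbreviation bump :: "nat \<Rightarrow> 'k \<Rightarrow> nat \<Rightarrow> 'k::zero" where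
  "bump k \<epsilon> j \<equiv> (if j = k then \<epsilon> else 0)"

lemma coordinate_space_point:
  assumes "p \<in> coordinate_space A" "\<And>v. v \<in> A \<Longrightarrow> \<exists>i\<in>{1, 2}. \<exists>j. v = X i j \<or> v = Y i j \<or> v = Z i j"
  shows "p = point (\<lambda>j. p (X 1 j)) (\<lambda>j. p (X 2 j)) (\<lambda>j. p (Y 1 j)) (\<lambda>j. p (Y 2 j)) (\<lambda>j. p (Z 1 j)) (\<lambda>j. p (Z 2 j))"
proof
  have out: "p v = 0" if "v \<notin> A" for v
    using assms(1) that by (simp add: coordinate_space_def)
  fix v show "p v = point (\<lambda>j. p (X 1 j)) (\<lambda>j. p (X 2 j)) (\<lambda>j. p (Y 1 j)) (\<lambda>j. p (Y 2 j)) (\<lambda>j. p (Z 1 j)) (\<lambda>j. p (Z 2 j)) v"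
    using out[of v] assms(2)[of v] by (cases v) fastforce+
qed

lemma regular_limit_regular:
  "adherent (regular_stratum (Suc s)) (regular_stratum s :: (var \<Rightarrow> 'k::field_char_0) set)"
  unfolding adherent_def
proof
  fix p :: "var \<Rightarrow> 'k" assume "p \<in> regular_stratum s"
  then obtain a b c d e f l0 l1 l2 where p: "p = point a b c d e f" "b s \<noteq> 0" "\<And>j. j > s \<Longrightarrow> b j = 0"
    "\<And>j. a j = l0 * b j" "\<And>j. c j = l0 * d j + l1 * b j" "\<And>j. e j = l0 * f j + l1 * d j + l2 * b j"
    unfolding regular_stratum_def by blast
  let ?A = "\<lambda>\<epsilon> j. a j + l0 * bump (Suc s) \<epsilon> j"
  let ?B = "\<lambda>\<epsilon> j. b j + bump (Suc s) \<epsilon> j"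
  let ?C = "\<lambda>\<epsilon> j. c j + l1 * bump (Suc s) \<epsilon> j"
  let ?D = "\<lambda>\<epsilon> j. d j"
  let ?E = "\<lambda>\<epsilon> j. e j + l2 * bump (Suc s) \<epsilon> j"
  let ?F = "\<lambda>\<epsilon> j. f j"
  show "limit_point (regular_stratum (Suc s)) p"
  proof (rule limit_pointI[OF p(1), where F = "{0}" and a = ?A and b = ?B and c = ?C and d = ?D and e = ?E and f = ?F])
    fix \<epsilon> :: 'k assume "\<epsilon> \<notin> {0}"
    then have \<epsilon>: "\<epsilon> \<noteq> 0" by (auto simp: add_eq_0_iff)
    show "point (?A \<epsilon>) (?B \<epsilon>) (?C \<epsilon>) (?D \<epsilon>) (?E \<epsilon>) (?F \<epsilon>) \<in> regular_stratum (Suc s)"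
      by (rule regular_stratumI[of _ _ _ l0 _ _ l1 _ _ l2];
        use \<epsilon> in \<open>auto simp: p(2-)\<close>;
        use \<epsilon> in \<open>simp add: algebra_simps\<close>)
  qed (auto simp: p)
qed

text \<open>Along the curve $\mu = \epsilon + m_1 t + m_2 t^2$, and the instance for \<open>l0\<close>, \<open>l1\<close>, \<open>l2\<close> lists the
coefficients of $1/\mu$ modulo $t^3$.\<close>
lemma regular_limit_pole:
  "adherent (regular_stratum s) (pole_stratum s :: (var \<Rightarrow> 'k::field_char_0) set)"
  unfolding adherent_def
proof
  fix p :: "var \<Rightarrow> 'k" assume "p \<in> pole_stratum s"
  then obtain a b c d e f m1 m2 where p: "p = point a b c d e f" "a s \<noteq> 0" "\<And>j. j > s \<Longrightarrow> a j = 0" "\<And>j. b j = 0"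
    "\<And>j. d j = m1 * a j" "\<And>j. f j = m1 * c j + m2 * a j"
    unfolding pole_stratum_def by blast
  let ?A = "\<lambda>\<epsilon> j. a j"
  let ?B = "\<lambda>\<epsilon> j. \<epsilon> * a j"
  let ?C = "\<lambda>\<epsilon> j. c j"
  let ?D = "\<lambda>\<epsilon> j. \<epsilon> * c j + m1 * a j"
  let ?E = "\<lambda>\<epsilon> j. e j"
  let ?F = "\<lambda>\<epsilon> j. \<epsilon> * e j + m1 * c j + m2 * a j"
  show "limit_point (regular_stratum s) p"
  proof (rule limit_pointI[OF p(1), where F = "{0}" and a = ?A and b = ?B and c = ?C and d = ?D and e = ?E and f = ?F])
    fix \<epsilon> :: 'k assume "\<epsilon> \<notin> {0}"
    then have \<epsilon>: "\<epsilon> \<noteq> 0" by (auto simp: add_eq_0_iff)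
    show "point (?A \<epsilon>) (?B \<epsilon>) (?C \<epsilon>) (?D \<epsilon>) (?E \<epsilon>) (?F \<epsilon>) \<in> regular_stratum s"
      by (rule regular_stratumI[of _ _ _ "1 / \<epsilon>" _ _ "- m1 / \<epsilon>^2" _ _ "(m1^2 - \<epsilon> * m2) / \<epsilon>^3"];
        use \<epsilon> in \<open>auto simp: p(2-)\<close>;
        use \<epsilon> in \<open>simp add: field_simps power2_eq_square power3_eq_cube\<close>)
  qed (auto simp: p)
qed

text \<open>Here $l_2 = 1/\epsilon$ and $b_j = \epsilon r_j$, where $r_j$ is the difference between $e_j$ and the
value that the twisted stratum prescribes beyond column \<open>s\<close>. The additional bump of order $\epsilon^2$
in column \<open>s\<close> keeps $b_s$ nonzero even if $r_s = 0$; its price is the second excluded parameter. The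
same device recurs below.\<close>
lemma regular_limit_twisted:
  "adherent (regular_stratum s) (twisted_stratum s k :: (var \<Rightarrow> 'k::field_char_0) set)"
  unfolding adherent_def
proof
  fix p :: "var \<Rightarrow> 'k" assume "p \<in> twisted_stratum s k"
  then obtain a b c d e f l m where p: "p = point a b c d e f" "d k \<noteq> 0" "\<And>j. j > k \<Longrightarrow> d j = 0" "\<And>j. a j = 0" "\<And>j. b j = 0"
    "\<And>j. c j = l * d j" "\<And>j. j > s \<Longrightarrow> e j = l * f j + m * d j"
    unfolding twisted_stratum_def by blast
  let ?r = "\<lambda>j. if j > s then 0 else e j - l * f j - m * d j"
  let ?A = "\<lambda>\<epsilon> j. l * (\<epsilon> * (?r j + bump s \<epsilon> j))"
  let ?B = "\<lambda>\<epsilon> j. \<epsilon> * (?r j + bump s \<epsilon> j)"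
  let ?C = "\<lambda>\<epsilon> j. l * d j + m * (\<epsilon> * (?r j + bump s \<epsilon> j))"
  let ?D = "\<lambda>\<epsilon> j. d j"
  let ?E = "\<lambda>\<epsilon> j. l * f j + m * d j + (?r j + bump s \<epsilon> j)"
  let ?F = "\<lambda>\<epsilon> j. f j"
  show "limit_point (regular_stratum s) p"
  proof (rule limit_pointI[OF p(1), where F = "{0, - ?r s}" and a = ?A and b = ?B and c = ?C and d = ?D and e = ?E and f = ?F])
    fix \<epsilon> :: 'k assume "\<epsilon> \<notin> {0, - ?r s}"
    then have \<epsilon>: "\<epsilon> \<noteq> 0" "?r s + \<epsilon> \<noteq> 0" by (auto simp: add_eq_0_iff)
    show "point (?A \<epsilon>) (?B \<epsilon>) (?C \<epsilon>) (?D \<epsilon>) (?E \<epsilon>) (?F \<epsilon>) \<in> regular_stratum s"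
      by (rule regular_stratumI[of _ _ _ l _ _ m _ _ "1 / \<epsilon>"];
        use \<epsilon> in \<open>auto simp: p(2-)\<close>;
        use \<epsilon> in \<open>simp add: field_simps\<close>)
  qed (auto simp: p)
qed

lemma pole_limit_pole:
  "adherent (pole_stratum (Suc s)) (pole_stratum s :: (var \<Rightarrow> 'k::field_char_0) set)"
  unfolding adherent_def
proof
  fix p :: "var \<Rightarrow> 'k" assume "p \<in> pole_stratum s"
  then obtain a b c d e f m1 m2 where p: "p = point a b c d e f" "a s \<noteq> 0" "\<And>j. j > s \<Longrightarrow> a j = 0" "\<And>j. b j = 0"
    "\<And>j. d j = m1 * a j" "\<And>j. f j = m1 * c j + m2 * a j"
    unfolding pole_stratum_def by blast
  let ?A = "\<lambda>\<epsilon> j. a j + bump (Suc s) \<epsilon> j"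
  let ?B = "\<lambda>\<epsilon> j. b j"
  let ?C = "\<lambda>\<epsilon> j. c j"
  let ?D = "\<lambda>\<epsilon> j. d j + m1 * bump (Suc s) \<epsilon> j"
  let ?E = "\<lambda>\<epsilon> j. e j"
  let ?F = "\<lambda>\<epsilon> j. f j + m2 * bump (Suc s) \<epsilon> j"
  show "limit_point (pole_stratum (Suc s)) p"
  proof (rule limit_pointI[OF p(1), where F = "{0}" and a = ?A and b = ?B and c = ?C and d = ?D and e = ?E and f = ?F])
    fix \<epsilon> :: 'k assume "\<epsilon> \<notin> {0}"
    then have \<epsilon>: "\<epsilon> \<noteq> 0" by (auto simp: add_eq_0_iff)
    show "point (?A \<epsilon>) (?B \<epsilon>) (?C \<epsilon>) (?D \<epsilon>) (?E \<epsilon>) (?F \<epsilon>) \<in> pole_stratum (Suc s)"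
      by (rule pole_stratumI[of _ _ _ _ m1 _ _ m2];
        use \<epsilon> in \<open>auto simp: p(2-)\<close>;
        use \<epsilon> in \<open>simp add: algebra_simps\<close>)
  qed (auto simp: p)
qed

text \<open>Here $m_1 = 1/\epsilon$, and $m_2 = - l/\epsilon^2$ cancels the pole of $m_1 c$, which leaves \<open>f\<close>
arbitrary.\<close>
lemma pole_limit_split:
  "adherent (pole_stratum s) (split_stratum s k :: (var \<Rightarrow> 'k::field_char_0) set)"
  unfolding adherent_def
proof
  fix p :: "var \<Rightarrow> 'k" assume "p \<in> split_stratum s k"
  then obtain a b c d e f l where p: "p = point a b c d e f" "d s \<noteq> 0" "\<And>j. j > s \<Longrightarrow> d j = 0" "\<And>j. a j = 0" "\<And>j. b j = 0"
    "\<And>j. c j = l * d j" "\<And>j. j > k \<Longrightarrow> e j = l * f j"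
    unfolding split_stratum_def by blast
  let ?A = "\<lambda>\<epsilon> j. \<epsilon> * d j"
  let ?B = "\<lambda>\<epsilon> j. b j"
  let ?C = "\<lambda>\<epsilon> j. l * d j + \<epsilon> * f j"
  let ?D = "\<lambda>\<epsilon> j. d j"
  let ?E = "\<lambda>\<epsilon> j. e j"
  let ?F = "\<lambda>\<epsilon> j. f j"
  show "limit_point (pole_stratum s) p"
  proof (rule limit_pointI[OF p(1), where F = "{0}" and a = ?A and b = ?B and c = ?C and d = ?D and e = ?E and f = ?F])
    fix \<epsilon> :: 'k assume "\<epsilon> \<notin> {0}"
    then have \<epsilon>: "\<epsilon> \<noteq> 0" by (auto simp: add_eq_0_iff)
    show "point (?A \<epsilon>) (?B \<epsilon>) (?C \<epsilon>) (?D \<epsilon>) (?E \<epsilon>) (?F \<epsilon>) \<in> pole_stratum s"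
      by (rule pole_stratumI[of _ _ _ _ "1 / \<epsilon>" _ _ "- l / \<epsilon>^2"];
        use \<epsilon> in \<open>auto simp: p(2-)\<close>;
        use \<epsilon> in \<open>simp add: field_simps power2_eq_square\<close>)
  qed (auto simp: p)
qed

text \<open>Here $m_2 = 1/\epsilon$ while the first row of $x$ is of order $\epsilon$, which makes $f_j$ arbitrary
in the columns \<open>j \<le> s\<close>.\<close>
lemma pole_limit_cross:
  "adherent (pole_stratum s) (cross_stratum s k :: (var \<Rightarrow> 'k::field_char_0) set)"
  unfolding adherent_def
proof
  fix p :: "var \<Rightarrow> 'k" assume "p \<in> cross_stratum s k"
  then obtain a b c d e f m where p: "p = point a b c d e f" "c k \<noteq> 0" "\<And>j. j > k \<Longrightarrow> c j = 0" "\<And>j. a j = 0" "\<And>j. b j = 0"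
    "\<And>j. d j = 0" "\<And>j. j > s \<Longrightarrow> f j = m * c j"
    unfolding cross_stratum_def by blast
  let ?r = "\<lambda>j. if j > s then 0 else f j - m * c j"
  let ?A = "\<lambda>\<epsilon> j. \<epsilon> * (?r j + bump s \<epsilon> j)"
  let ?B = "\<lambda>\<epsilon> j. b j"
  let ?C = "\<lambda>\<epsilon> j. c j"
  let ?D = "\<lambda>\<epsilon> j. m * (\<epsilon> * (?r j + bump s \<epsilon> j))"
  let ?E = "\<lambda>\<epsilon> j. e j"
  let ?F = "\<lambda>\<epsilon> j. m * c j + (?r j + bump s \<epsilon> j)"
  show "limit_point (pole_stratum s) p"
  proof (rule limit_pointI[OF p(1), where F = "{0, - ?r s}" and a = ?A and b = ?B and c = ?C and d = ?D and e = ?E and f = ?F])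
    fix \<epsilon> :: 'k assume "\<epsilon> \<notin> {0, - ?r s}"
    then have \<epsilon>: "\<epsilon> \<noteq> 0" "?r s + \<epsilon> \<noteq> 0" by (auto simp: add_eq_0_iff)
    show "point (?A \<epsilon>) (?B \<epsilon>) (?C \<epsilon>) (?D \<epsilon>) (?E \<epsilon>) (?F \<epsilon>) \<in> pole_stratum s"
      by (rule pole_stratumI[of _ _ _ _ m _ _ "1 / \<epsilon>"];
        use \<epsilon> in \<open>auto simp: p(2-)\<close>;
        use \<epsilon> in \<open>simp add: field_simps\<close>)
  qed (auto simp: p)
qed

lemma twisted_limit_twisted:
  "adherent (twisted_stratum s (Suc k)) (twisted_stratum s k :: (var \<Rightarrow> 'k::field_char_0) set)"
  unfolding adherent_def
proof
  fix p :: "var \<Rightarrow> 'k" assume "p \<in> twisted_stratum s k"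
  then obtain a b c d e f l m where p: "p = point a b c d e f" "d k \<noteq> 0" "\<And>j. j > k \<Longrightarrow> d j = 0" "\<And>j. a j = 0" "\<And>j. b j = 0"
    "\<And>j. c j = l * d j" "\<And>j. j > s \<Longrightarrow> e j = l * f j + m * d j"
    unfolding twisted_stratum_def by blast
  let ?A = "\<lambda>\<epsilon> j. a j"
  let ?B = "\<lambda>\<epsilon> j. b j"
  let ?C = "\<lambda>\<epsilon> j. c j + l * bump (Suc k) \<epsilon> j"
  let ?D = "\<lambda>\<epsilon> j. d j + bump (Suc k) \<epsilon> j"
  let ?E = "\<lambda>\<epsilon> j. e j + m * bump (Suc k) \<epsilon> j"
  let ?F = "\<lambda>\<epsilon> j. f j"
  show "limit_point (twisted_stratum s (Suc k)) p"
  proof (rule limit_pointI[OF p(1), where F = "{0}" and a = ?A and b = ?B and c = ?C and d = ?D and e = ?E and f = ?F])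
    fix \<epsilon> :: 'k assume "\<epsilon> \<notin> {0}"
    then have \<epsilon>: "\<epsilon> \<noteq> 0" by (auto simp: add_eq_0_iff)
    show "point (?A \<epsilon>) (?B \<epsilon>) (?C \<epsilon>) (?D \<epsilon>) (?E \<epsilon>) (?F \<epsilon>) \<in> twisted_stratum s (Suc k)"
      by (rule twisted_stratumI[of _ _ _ _ _ l _ _ _ m];
        use \<epsilon> in \<open>auto simp: p(2-)\<close>;
        use \<epsilon> in \<open>simp add: algebra_simps\<close>)
  qed (auto simp: p)
qed

text \<open>Here $m = 1/\epsilon$ while $d_j$ is of order $\epsilon$ in the columns between \<open>s\<close> and \<open>k\<close>, which makes
$e_j$ arbitrary there.\<close>
lemma twisted_limit_split:
  assumes "s < k"
  shows "adherent (twisted_stratum s k) (split_stratum s k :: (var \<Rightarrow> 'k::field_char_0) set)"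
  unfolding adherent_def
proof
  fix p :: "var \<Rightarrow> 'k" assume "p \<in> split_stratum s k"
  then obtain a b c d e f l where p: "p = point a b c d e f" "d s \<noteq> 0" "\<And>j. j > s \<Longrightarrow> d j = 0" "\<And>j. a j = 0" "\<And>j. b j = 0"
    "\<And>j. c j = l * d j" "\<And>j. j > k \<Longrightarrow> e j = l * f j"
    unfolding split_stratum_def by blast
  let ?A = "\<lambda>\<epsilon> j. a j"
  let ?B = "\<lambda>\<epsilon> j. b j"
  let ?C = "\<lambda>\<epsilon> j. l * (d j + \<epsilon> * ((if s < j \<and> j \<le> k then e j - l * f j else 0) + bump k \<epsilon> j))"
  let ?D = "\<lambda>\<epsilon> j. d j + \<epsilon> * ((if s < j \<and> j \<le> k then e j - l * f j else 0) + bump k \<epsilon> j)"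
  let ?E = "\<lambda>\<epsilon> j. e j + bump k \<epsilon> j"
  let ?F = "\<lambda>\<epsilon> j. f j"
  show "limit_point (twisted_stratum s k) p"
  proof (rule limit_pointI[OF p(1), where F = "{0, l * f k - e k}" and a = ?A and b = ?B and c = ?C and d = ?D and e = ?E and f = ?F])
    fix \<epsilon> :: 'k assume "\<epsilon> \<notin> {0, l * f k - e k}"
    then have \<epsilon>: "\<epsilon> \<noteq> 0" "e k - l * f k + \<epsilon> \<noteq> 0" by (auto simp: add_eq_0_iff)
    show "point (?A \<epsilon>) (?B \<epsilon>) (?C \<epsilon>) (?D \<epsilon>) (?E \<epsilon>) (?F \<epsilon>) \<in> twisted_stratum s k"
      by (rule twisted_stratumI[of _ _ _ _ _ l _ _ _ "1 / \<epsilon>"];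
        use \<epsilon> assms in \<open>auto simp: p(2-)\<close>;
        use \<epsilon> assms in \<open>simp add: field_simps\<close>)
  qed (auto simp: p)
qed

text \<open>Here $l = 1/\epsilon$ with \<open>d = \<epsilon> c\<close>. The slope of the twisted stratum is $- m/\epsilon^2$, where $m$ is
the factor of the cross stratum, so that $f_j = m c_j + \epsilon e_j$ beyond column \<open>s\<close>.\<close>
lemma twisted_limit_cross:
  "adherent (twisted_stratum s k) (cross_stratum s k :: (var \<Rightarrow> 'k::field_char_0) set)"
  unfolding adherent_def
proof
  fix p :: "var \<Rightarrow> 'k" assume "p \<in> cross_stratum s k"
  then obtain a b c d e f m where p: "p = point a b c d e f" "c k \<noteq> 0" "\<And>j. j > k \<Longrightarrow> c j = 0" "\<And>j. a j = 0" "\<And>j. b j = 0"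
    "\<And>j. d j = 0" "\<And>j. j > s \<Longrightarrow> f j = m * c j"
    unfolding cross_stratum_def by blast
  let ?A = "\<lambda>\<epsilon> j. a j"
  let ?B = "\<lambda>\<epsilon> j. b j"
  let ?C = "\<lambda>\<epsilon> j. c j"
  let ?D = "\<lambda>\<epsilon> j. \<epsilon> * c j"
  let ?E = "\<lambda>\<epsilon> j. e j"
  let ?F = "\<lambda>\<epsilon> j. f j + (if j > s then \<epsilon> * e j else 0)"
  show "limit_point (twisted_stratum s k) p"
  proof (rule limit_pointI[OF p(1), where F = "{0}" and a = ?A and b = ?B and c = ?C and d = ?D and e = ?E and f = ?F])
    fix \<epsilon> :: 'k assume "\<epsilon> \<notin> {0}"
    then have \<epsilon>: "\<epsilon> \<noteq> 0" by (auto simp: add_eq_0_iff)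
    show "point (?A \<epsilon>) (?B \<epsilon>) (?C \<epsilon>) (?D \<epsilon>) (?E \<epsilon>) (?F \<epsilon>) \<in> twisted_stratum s k"
      by (rule twisted_stratumI[of _ _ _ _ _ "1 / \<epsilon>" _ _ _ "- m / \<epsilon>^2"];
        use \<epsilon> in \<open>auto simp: p(2-)\<close>;
        use \<epsilon> in \<open>simp add: field_simps power2_eq_square\<close>)
  qed (auto simp: p)
qed

lemma split_limit_split:
  "adherent (split_stratum (Suc i) k) (split_stratum i k :: (var \<Rightarrow> 'k::field_char_0) set)"
  unfolding adherent_def
proof
  fix p :: "var \<Rightarrow> 'k" assume "p \<in> split_stratum i k"
  then obtain a b c d e f l where p: "p = point a b c d e f" "d i \<noteq> 0" "\<And>j. j > i \<Longrightarrow> d j = 0" "\<And>j. a j = 0" "\<And>j. b j = 0"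
    "\<And>j. c j = l * d j" "\<And>j. j > k \<Longrightarrow> e j = l * f j"
    unfolding split_stratum_def by blast
  let ?A = "\<lambda>\<epsilon> j. a j"
  let ?B = "\<lambda>\<epsilon> j. b j"
  let ?C = "\<lambda>\<epsilon> j. c j + l * bump (Suc i) \<epsilon> j"
  let ?D = "\<lambda>\<epsilon> j. d j + bump (Suc i) \<epsilon> j"
  let ?E = "\<lambda>\<epsilon> j. e j"
  let ?F = "\<lambda>\<epsilon> j. f j"
  show "limit_point (split_stratum (Suc i) k) p"
  proof (rule limit_pointI[OF p(1), where F = "{0}" and a = ?A and b = ?B and c = ?C and d = ?D and e = ?E and f = ?F])
    fix \<epsilon> :: 'k assume "\<epsilon> \<notin> {0}"
    then have \<epsilon>: "\<epsilon> \<noteq> 0" by (auto simp: add_eq_0_iff)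
    show "point (?A \<epsilon>) (?B \<epsilon>) (?C \<epsilon>) (?D \<epsilon>) (?E \<epsilon>) (?F \<epsilon>) \<in> split_stratum (Suc i) k"
      by (rule split_stratumI[of _ _ _ _ _ l];
        use \<epsilon> in \<open>auto simp: p(2-)\<close>;
        use \<epsilon> in \<open>simp add: algebra_simps\<close>)
  qed (auto simp: p)
qed

lemma split_limit_top:
  "adherent (split_stratum i k) (top_stratum k h :: (var \<Rightarrow> 'k::field_char_0) set)"
  unfolding adherent_def
proof
  fix p :: "var \<Rightarrow> 'k" assume "p \<in> top_stratum k h"
  then obtain a b c d e f l where p: "p = point a b c d e f" "f h \<noteq> 0" "\<And>j. j > h \<Longrightarrow> f j = 0" "\<And>j. a j = 0" "\<And>j. b j = 0"
    "\<And>j. c j = 0" "\<And>j. d j = 0" "\<And>j. j > k \<Longrightarrow> e j = l * f j"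
    unfolding top_stratum_def by blast
  let ?A = "\<lambda>\<epsilon> j. a j"
  let ?B = "\<lambda>\<epsilon> j. b j"
  let ?C = "\<lambda>\<epsilon> j. l * bump i \<epsilon> j"
  let ?D = "\<lambda>\<epsilon> j. bump i \<epsilon> j"
  let ?E = "\<lambda>\<epsilon> j. e j"
  let ?F = "\<lambda>\<epsilon> j. f j"
  show "limit_point (split_stratum i k) p"
  proof (rule limit_pointI[OF p(1), where F = "{0}" and a = ?A and b = ?B and c = ?C and d = ?D and e = ?E and f = ?F])
    fix \<epsilon> :: 'k assume "\<epsilon> \<notin> {0}"
    then have \<epsilon>: "\<epsilon> \<noteq> 0" by (auto simp: add_eq_0_iff)
    show "point (?A \<epsilon>) (?B \<epsilon>) (?C \<epsilon>) (?D \<epsilon>) (?E \<epsilon>) (?F \<epsilon>) \<in> split_stratum i k"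
      by (rule split_stratumI[of _ _ _ _ _ l];
        use \<epsilon> in \<open>auto simp: p(2-)\<close>)
  qed (auto simp: p)
qed

text \<open>Here $l = 1/\epsilon$: both \<open>d\<close> and the entries of \<open>f\<close> beyond column \<open>k\<close> tend to 0, and this frees \<open>c\<close>
and \<open>e\<close>.\<close>
lemma split_limit_coordinate:
  "adherent (split_stratum i k) (coordinate_space ({Y 1 j |j. j \<le> i} \<union> range (Z 1) \<union> {Z 2 j |j. j \<le> k}) :: (var \<Rightarrow> 'k::field_char_0) set)"
  unfolding adherent_def
proof
  fix p :: "var \<Rightarrow> 'k" assume pA: "p \<in> coordinate_space ({Y 1 j |j. j \<le> i} \<union> range (Z 1) \<union> {Z 2 j |j. j \<le> k})"
  let ?W = "{Y 1 j |j. j \<le> i} \<union> range (Z 1) \<union> {Z 2 j |j. j \<le> k}"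
  have rows: "\<exists>i\<in>{1, 2}. \<exists>j. v = X i j \<or> v = Y i j \<or> v = Z i j" if "v \<in> ?W" for v
    using that by auto
  define a b c d e f where abc: "a = (\<lambda>j. p (X 1 j))" "b = (\<lambda>j. p (X 2 j))" "c = (\<lambda>j. p (Y 1 j))"
    "d = (\<lambda>j. p (Y 2 j))" "e = (\<lambda>j. p (Z 1 j))" "f = (\<lambda>j. p (Z 2 j))"
  have out: "p v = 0" if "v \<notin> ?W" for v
    using pA that by (simp add: coordinate_space_def)
  have zeros: "\<And>j. a j = 0" "\<And>j. b j = 0" "\<And>j. d j = 0" "\<And>j. j > i \<Longrightarrow> c j = 0" "\<And>j. j > k \<Longrightarrow> f j = 0"
    unfolding abc by (rule out; auto)+
  have "p = point a b c d e f"
    unfolding abc by (rule coordinate_space_point[OF pA rows])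
  note p = this zeros
  let ?A = "\<lambda>\<epsilon> j. a j"
  let ?B = "\<lambda>\<epsilon> j. b j"
  let ?C = "\<lambda>\<epsilon> j. c j + bump i \<epsilon> j"
  let ?D = "\<lambda>\<epsilon> j. \<epsilon> * (c j + bump i \<epsilon> j)"
  let ?E = "\<lambda>\<epsilon> j. e j"
  let ?F = "\<lambda>\<epsilon> j. f j + (if j > k then \<epsilon> * e j else 0)"
  show "limit_point (split_stratum i k) p"
  proof (rule limit_pointI[OF p(1), where F = "{0, - c i}" and a = ?A and b = ?B and c = ?C and d = ?D and e = ?E and f = ?F])
    fix \<epsilon> :: 'k assume "\<epsilon> \<notin> {0, - c i}"
    then have \<epsilon>: "\<epsilon> \<noteq> 0" "c i + \<epsilon> \<noteq> 0" by (auto simp: add_eq_0_iff)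
    show "point (?A \<epsilon>) (?B \<epsilon>) (?C \<epsilon>) (?D \<epsilon>) (?E \<epsilon>) (?F \<epsilon>) \<in> split_stratum i k"
      by (rule split_stratumI[of _ _ _ _ _ "1 / \<epsilon>"];
        use \<epsilon> in \<open>auto simp: p(2-)\<close>;
        use \<epsilon> in \<open>simp add: field_simps\<close>)
  qed (auto simp: p)
qed

lemma cross_limit_cross:
  "adherent (cross_stratum s (Suc k)) (cross_stratum s k :: (var \<Rightarrow> 'k::field_char_0) set)"
  unfolding adherent_def
proof
  fix p :: "var \<Rightarrow> 'k" assume "p \<in> cross_stratum s k"
  then obtain a b c d e f m where p: "p = point a b c d e f" "c k \<noteq> 0" "\<And>j. j > k \<Longrightarrow> c j = 0" "\<And>j. a j = 0" "\<And>j. b j = 0"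
    "\<And>j. d j = 0" "\<And>j. j > s \<Longrightarrow> f j = m * c j"
    unfolding cross_stratum_def by blast
  let ?A = "\<lambda>\<epsilon> j. a j"
  let ?B = "\<lambda>\<epsilon> j. b j"
  let ?C = "\<lambda>\<epsilon> j. c j + bump (Suc k) \<epsilon> j"
  let ?D = "\<lambda>\<epsilon> j. d j"
  let ?E = "\<lambda>\<epsilon> j. e j"
  let ?F = "\<lambda>\<epsilon> j. f j + m * bump (Suc k) \<epsilon> j"
  show "limit_point (cross_stratum s (Suc k)) p"
  proof (rule limit_pointI[OF p(1), where F = "{0}" and a = ?A and b = ?B and c = ?C and d = ?D and e = ?E and f = ?F])
    fix \<epsilon> :: 'k assume "\<epsilon> \<notin> {0}"
    then have \<epsilon>: "\<epsilon> \<noteq> 0" by (auto simp: add_eq_0_iff)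
    show "point (?A \<epsilon>) (?B \<epsilon>) (?C \<epsilon>) (?D \<epsilon>) (?E \<epsilon>) (?F \<epsilon>) \<in> cross_stratum s (Suc k)"
      by (rule cross_stratumI[of _ _ _ _ _ _ _ m];
        use \<epsilon> in \<open>auto simp: p(2-)\<close>;
        use \<epsilon> in \<open>simp add: algebra_simps\<close>)
  qed (auto simp: p)
qed

text \<open>Here $m = 1/\epsilon$, which frees \<open>f\<close> and lets the entries of \<open>c\<close> beyond column \<open>s\<close> tend to 0.\<close>
lemma cross_limit_coordinate:
  assumes "s < k"
  shows "adherent (cross_stratum s k) (coordinate_space ({Y 1 j |j. j \<le> s} \<union> range (Z 1) \<union> {Z 2 j |j. j \<le> k}) :: (var \<Rightarrow> 'k::field_char_0) set)"
  unfolding adherent_def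
proof
  fix p :: "var \<Rightarrow> 'k" assume pA: "p \<in> coordinate_space ({Y 1 j |j. j \<le> s} \<union> range (Z 1) \<union> {Z 2 j |j. j \<le> k})"
  let ?W = "{Y 1 j |j. j \<le> s} \<union> range (Z 1) \<union> {Z 2 j |j. j \<le> k}"
  have rows: "\<exists>i\<in>{1, 2}. \<exists>j. v = X i j \<or> v = Y i j \<or> v = Z i j" if "v \<in> ?W" for v
    using that by auto
  define a b c d e f where abc: "a = (\<lambda>j. p (X 1 j))" "b = (\<lambda>j. p (X 2 j))" "c = (\<lambda>j. p (Y 1 j))"
    "d = (\<lambda>j. p (Y 2 j))" "e = (\<lambda>j. p (Z 1 j))" "f = (\<lambda>j. p (Z 2 j))"
  have out: "p v = 0" if "v \<notin> ?W" for v
    using pA that by (simp add: coordinate_space_def)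
  have zeros: "\<And>j. a j = 0" "\<And>j. b j = 0" "\<And>j. d j = 0" "\<And>j. j > s \<Longrightarrow> c j = 0" "\<And>j. j > k \<Longrightarrow> f j = 0"
    unfolding abc by (rule out; auto)+
  have "p = point a b c d e f"
    unfolding abc by (rule coordinate_space_point[OF pA rows])
  note p = this zeros
  let ?A = "\<lambda>\<epsilon> j. a j"
  let ?B = "\<lambda>\<epsilon> j. b j"
  let ?C = "\<lambda>\<epsilon> j. c j + (if s < j then \<epsilon> * (f j + bump k \<epsilon> j) else 0)"
  let ?D = "\<lambda>\<epsilon> j. d j"
  let ?E = "\<lambda>\<epsilon> j. e j"
  let ?F = "\<lambda>\<epsilon> j. f j + bump k \<epsilon> j"
  show "limit_point (cross_stratum s k) p"
  proof (rule limit_pointI[OF p(1), where F = "{0, - f k}" and a = ?A and b = ?B and c = ?C and d = ?D and e = ?E and f = ?F])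
    fix \<epsilon> :: 'k assume "\<epsilon> \<notin> {0, - f k}"
    then have \<epsilon>: "\<epsilon> \<noteq> 0" "f k + \<epsilon> \<noteq> 0" by (auto simp: add_eq_0_iff)
    show "point (?A \<epsilon>) (?B \<epsilon>) (?C \<epsilon>) (?D \<epsilon>) (?E \<epsilon>) (?F \<epsilon>) \<in> cross_stratum s k"
      by (rule cross_stratumI[of _ _ _ _ _ _ _ "1 / \<epsilon>"];
        use \<epsilon> assms in \<open>auto simp: p(2-)\<close>;
        use \<epsilon> assms in \<open>simp add: field_simps\<close>)
  qed (auto simp: p)
qed

lemma top_limit_top:
  "adherent (top_stratum k (Suc h)) (top_stratum k h :: (var \<Rightarrow> 'k::field_char_0) set)"
  unfolding adherent_def
proof
  fix p :: "var \<Rightarrow> 'k" assume "p \<in> top_stratum k h"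
  then obtain a b c d e f l where p: "p = point a b c d e f" "f h \<noteq> 0" "\<And>j. j > h \<Longrightarrow> f j = 0" "\<And>j. a j = 0" "\<And>j. b j = 0"
    "\<And>j. c j = 0" "\<And>j. d j = 0" "\<And>j. j > k \<Longrightarrow> e j = l * f j"
    unfolding top_stratum_def by blast
  let ?A = "\<lambda>\<epsilon> j. a j"
  let ?B = "\<lambda>\<epsilon> j. b j"
  let ?C = "\<lambda>\<epsilon> j. c j"
  let ?D = "\<lambda>\<epsilon> j. d j"
  let ?E = "\<lambda>\<epsilon> j. e j + l * bump (Suc h) \<epsilon> j"
  let ?F = "\<lambda>\<epsilon> j. f j + bump (Suc h) \<epsilon> j"
  show "limit_point (top_stratum k (Suc h)) p"
  proof (rule limit_pointI[OF p(1), where F = "{0}" and a = ?A and b = ?B and c = ?C and d = ?D and e = ?E and f = ?F])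
    fix \<epsilon> :: 'k assume "\<epsilon> \<notin> {0}"
    then have \<epsilon>: "\<epsilon> \<noteq> 0" by (auto simp: add_eq_0_iff)
    show "point (?A \<epsilon>) (?B \<epsilon>) (?C \<epsilon>) (?D \<epsilon>) (?E \<epsilon>) (?F \<epsilon>) \<in> top_stratum k (Suc h)"
      by (rule top_stratumI[of _ _ _ _ _ _ _ _ l];
        use \<epsilon> in \<open>auto simp: p(2-)\<close>;
        use \<epsilon> in \<open>simp add: algebra_simps\<close>)
  qed (auto simp: p)
qed

text \<open>Here $l = 1/\epsilon$, which frees \<open>e\<close> and lets the entries of \<open>f\<close> beyond column \<open>k\<close> tend to 0.\<close>
lemma top_limit_coordinate:
  assumes "k < h"
  shows "adherent (top_stratum k h) (coordinate_space ({Z 1 j |j. j \<le> h} \<union> {Z 2 j |j. j \<le> k}) :: (var \<Rightarrow> 'k::field_char_0) set)"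
  unfolding adherent_def
proof
  fix p :: "var \<Rightarrow> 'k" assume pA: "p \<in> coordinate_space ({Z 1 j |j. j \<le> h} \<union> {Z 2 j |j. j \<le> k})"
  let ?W = "{Z 1 j |j. j \<le> h} \<union> {Z 2 j |j. j \<le> k}"
  have rows: "\<exists>i\<in>{1, 2}. \<exists>j. v = X i j \<or> v = Y i j \<or> v = Z i j" if "v \<in> ?W" for v
    using that by auto
  define a b c d e f where abc: "a = (\<lambda>j. p (X 1 j))" "b = (\<lambda>j. p (X 2 j))" "c = (\<lambda>j. p (Y 1 j))"
    "d = (\<lambda>j. p (Y 2 j))" "e = (\<lambda>j. p (Z 1 j))" "f = (\<lambda>j. p (Z 2 j))"
  have out: "p v = 0" if "v \<notin> ?W" for v
    using pA that by (simp add: coordinate_space_def)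
  have zeros: "\<And>j. a j = 0" "\<And>j. b j = 0" "\<And>j. c j = 0" "\<And>j. d j = 0" "\<And>j. j > h \<Longrightarrow> e j = 0" "\<And>j. j > k \<Longrightarrow> f j = 0"
    unfolding abc by (rule out; auto)+
  have "p = point a b c d e f"
    unfolding abc by (rule coordinate_space_point[OF pA rows])
  note p = this zeros
  let ?A = "\<lambda>\<epsilon> j. a j"
  let ?B = "\<lambda>\<epsilon> j. b j"
  let ?C = "\<lambda>\<epsilon> j. c j"
  let ?D = "\<lambda>\<epsilon> j. d j"
  let ?E = "\<lambda>\<epsilon> j. e j + bump h \<epsilon> j"
  let ?F = "\<lambda>\<epsilon> j. f j + (if k < j then \<epsilon> * (e j + bump h \<epsilon> j) else 0)"
  show "limit_point (top_stratum k h) p"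
  proof (rule limit_pointI[OF p(1), where F = "{0, - e h}" and a = ?A and b = ?B and c = ?C and d = ?D and e = ?E and f = ?F])
    fix \<epsilon> :: 'k assume "\<epsilon> \<notin> {0, - e h}"
    then have \<epsilon>: "\<epsilon> \<noteq> 0" "e h + \<epsilon> \<noteq> 0" by (auto simp: add_eq_0_iff)
    show "point (?A \<epsilon>) (?B \<epsilon>) (?C \<epsilon>) (?D \<epsilon>) (?E \<epsilon>) (?F \<epsilon>) \<in> top_stratum k h"
      by (rule top_stratumI[of _ _ _ _ _ _ _ _ "1 / \<epsilon>"];
        use \<epsilon> assms in \<open>auto simp: p(2-)\<close>;
        use \<epsilon> assms in \<open>simp add: field_simps\<close>)
  qed (auto simp: p)
qed

section \<open>Coordinate subspaces\<close>

lemma excludes_superset: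
  assumes "excludes n V G" "V \<subseteq> V'"
  shows "excludes n V' G"
  unfolding excludes_def
proof (intro allI impI)
  fix S :: "mono set" and c :: "mono \<Rightarrow> 'a" and d m
  assume S: "finite S" "\<forall>k\<in>S. Poly_Mapping.keys k \<subseteq> vars n \<and> mono_deg k = d \<and> c k \<noteq> 0"
    "vanishes S c V'" "leads S m"
  have van: "vanishes S c V"
    using S(3) assms(2) by (auto simp: vanishes_def)
  show "\<not> G (Poly_Mapping.keys m)"
    by (rule excludesD[OF assms(1) S(1) _ _ _ van S(4)]) (use S(2) in auto)
qed

lemma mono_deg_0: "mono_deg k = 0 \<longleftrightarrow> k = 0"
proof
  assume "mono_deg k = 0"
  then have "\<forall>v\<in>Poly_Mapping.keys k. Poly_Mapping.lookup k v = 0"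
    by (simp add: mono_deg_def)
  then show "k = 0"
    by (intro poly_mapping_eqI) (auto simp: in_keys_iff)
qed (simp add: mono_deg_def)

lemma limit_point_update:
  fixes p :: "var \<Rightarrow> 'k::field_char_0"
  assumes "\<And>\<epsilon>. \<epsilon> \<noteq> 0 \<Longrightarrow> p(w := \<epsilon>) \<in> V" "p w = 0"
  shows "limit_point V p"
proof -
  have "- {0} \<subseteq> {\<epsilon>. p(w := \<epsilon>) \<in> V}"
    using assms(1) by auto
  moreover have "infinite (- {0 :: 'k})"
    by (simp add: Compl_eq_Diff_UNIV infinite_UNIV_char_0)
  ultimately have "infinite {\<epsilon>. p(w := \<epsilon>) \<in> V}"
    using infinite_super by blast
  moreover have "poly_fun (\<lambda>\<epsilon>. (p(w := \<epsilon>)) v)" for v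
    by (cases "v = w") auto
  moreover have "p(w := 0) = p"
    using assms(2) by auto
  ultimately show ?thesis
    unfolding limit_point_def by (intro exI[of _ "\<lambda>\<epsilon>. p(w := \<epsilon>)"]) simp
qed

text \<open>A polynomial that vanishes on a coordinate subspace has a variable outside of it in each monomial.
For the leading monomial this again follows from the induction step: make the smallest
variable of the subspace invertible first, then set it to 0.\<close>
lemma excludes_coordinate:
  "excludes n (coordinate_space A :: (var \<Rightarrow> 'k::field_char_0) set) (\<lambda>U. U \<subseteq> A)"
proof (induction "card (vars n \<inter> A)" arbitrary: A rule: less_induct)
  case less
  show ?case
  proof (cases "vars n \<inter> A = {}")
    case True
    show ?thesis
      unfolding excludes_def
    proof (intro allI impI notI)
      fix S :: "mono set" and c :: "mono \<Rightarrow> 'k" and d m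
      assume S: "finite S" "\<forall>k\<in>S. Poly_Mapping.keys k \<subseteq> vars n \<and> mono_deg k = d \<and> c k \<noteq> 0"
        "vanishes S c (coordinate_space A)" "leads S m" and m: "Poly_Mapping.keys m \<subseteq> A"
      have mS: "m \<in> S" using S(4) by (simp add: leads_def)
      then have "Poly_Mapping.keys m = {}"
        using S(2) m True by blast
      then have m0: "m = 0" by simp
      then have "d = 0" using S(2) mS by (auto simp: mono_deg_0)
      then have "S = {0}"
        using S(2) mS m0 by (auto simp: mono_deg_0)
      moreover have "(\<lambda>_. 0) \<in> (coordinate_space A :: (var \<Rightarrow> 'k) set)"
        by (simp add: coordinate_space_def)
      ultimately have "c 0 = 0"
        using S(3) by (fastforce simp: vanishes_def)
      then show False using S(2) \<open>S = {0}\<close> by simp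
    qed
  next
    case False
    then obtain w where w: "w \<in> vars n" "w \<in> A" "\<And>v. var_less v w \<Longrightarrow> v \<notin> vars n \<inter> A"
      using smallest_var[of "vars n \<inter> A"] finite_vars by blast
    let ?V = "{p \<in> coordinate_space A. p w \<noteq> (0 :: 'k)}"
    have "excludes n ?V (\<lambda>U. U \<subseteq> A)"
    proof (rule excludes_step[where w = w])
      fix U assume U: "U \<subseteq> vars n" "w \<notin> U" "U \<subseteq> A"
      have "vars n \<inter> (A - {w}) \<subset> vars n \<inter> A"
        using w by blast
      then have "card (vars n \<inter> (A - {w})) < card (vars n \<inter> A)"
        using finite_vars by (intro psubset_card_mono) auto
      then have "excludes n (coordinate_space (A - {w}) :: (var \<Rightarrow> 'k) set) (\<lambda>U. U \<subseteq> A - {w})"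
        by (rule less)
      moreover have "adherent ?V (coordinate_space (A - {w}))"
        unfolding adherent_def
      proof
        fix p :: "var \<Rightarrow> 'k" assume p: "p \<in> coordinate_space (A - {w})"
        show "limit_point ?V p"
          by (rule limit_point_update[of _ w]) (use p w in \<open>auto simp: coordinate_space_def\<close>)
      qed
      moreover have "U \<subseteq> A - {w}" using U by auto
      ultimately show "\<exists>V' G'. excludes n V' G' \<and> adherent ?V V' \<and> G' U" by blast
    qed (use w in \<open>auto simp: coordinate_space_def\<close>)
    then show ?thesis
      by (rule excludes_superset) auto
  qed
qed

section \<open>Standard supports\<close>

lemma vars_cases [consumes 1, case_names X1 X2 Y1 Y2 Z1 Z2]:
  assumes "v \<in> vars n"
  obtains j where "v = X 1 j" "1 \<le> j" "j \<le> n" | j where "v = X 2 j" "1 \<le> j" "j \<le> n"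
  | j where "v = Y 1 j" "1 \<le> j" "j \<le> n" | j where "v = Y 2 j" "1 \<le> j" "j \<le> n"
  | j where "v = Z 1 j" "1 \<le> j" "j \<le> n" | j where "v = Z 2 j" "1 \<le> j" "j \<le> n"
  using assms unfolding vars_def by auto

lemma subset_varsD:
  assumes "U \<subseteq> vars n" "X i j \<in> U \<or> Y i j \<in> U \<or> Z i j \<in> U"
  shows "1 \<le> j" "j \<le> n" "i = 1 \<or> i = 2"
  using assms by auto

text \<open>Supports of the monomials that are not divisible by any of the leading monomials of $\Gamma$. The
seven conditions belong to $a$, $b$, $c$, $d$, $e$, $f$, $g$ in this order.\<close>
definition standard :: "var set \<Rightarrow> bool" where
  "standard U \<longleftrightarrow>
     (\<forall>p q. X 2 p \<in> U \<longrightarrow> X 1 q \<in> U \<longrightarrow> q \<le> p) \<and>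
     (\<forall>p q. X 1 p \<in> U \<longrightarrow> Y 2 q \<in> U \<longrightarrow> q \<le> p) \<and>
     (\<forall>p q. Y 2 p \<in> U \<longrightarrow> Y 1 q \<in> U \<longrightarrow> q \<le> p) \<and>
     (\<forall>p q r. X 2 p \<in> U \<longrightarrow> Y 1 q \<in> U \<longrightarrow> Z 2 r \<in> U \<longrightarrow> p < q \<longrightarrow> r \<le> q) \<and>
     (\<forall>p q r. X 1 p \<in> U \<longrightarrow> Y 1 q \<in> U \<longrightarrow> Z 2 r \<in> U \<longrightarrow> p < q \<longrightarrow> r \<le> q) \<and>
     (\<forall>l p q r. Y 1 l \<in> U \<longrightarrow> X 2 p \<in> U \<longrightarrow> Y 2 q \<in> U \<longrightarrow> Z 2 r \<in> U \<longrightarrow> l \<le> p \<longrightarrow> p < q \<longrightarrow> r \<le> q) \<and>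
     (\<forall>l p q r. X 2 l \<in> U \<longrightarrow> Y 2 p \<in> U \<longrightarrow> Z 2 q \<in> U \<longrightarrow> Z 1 r \<in> U \<longrightarrow> l < p \<longrightarrow> p < q \<longrightarrow> r \<le> q)"

lemma standardD:
  assumes "standard U"
  shows "X 2 p \<in> U \<Longrightarrow> X 1 q \<in> U \<Longrightarrow> q \<le> p"
    and "X 1 p \<in> U \<Longrightarrow> Y 2 q \<in> U \<Longrightarrow> q \<le> p"
    and "Y 2 p \<in> U \<Longrightarrow> Y 1 q \<in> U \<Longrightarrow> q \<le> p"
    and "X 2 p \<in> U \<Longrightarrow> Y 1 q \<in> U \<Longrightarrow> Z 2 r \<in> U \<Longrightarrow> p < q \<Longrightarrow> r \<le> q"
    and "X 1 p \<in> U \<Longrightarrow> Y 1 q \<in> U \<Longrightarrow> Z 2 r \<in> U \<Longrightarrow> p < q \<Longrightarrow> r \<le> q"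
    and "Y 1 l \<in> U \<Longrightarrow> X 2 p \<in> U \<Longrightarrow> Y 2 q \<in> U \<Longrightarrow> Z 2 r \<in> U \<Longrightarrow> l \<le> p \<Longrightarrow> p < q \<Longrightarrow> r \<le> q"
    and "X 2 l \<in> U \<Longrightarrow> Y 2 p \<in> U \<Longrightarrow> Z 2 q \<in> U \<Longrightarrow> Z 1 r \<in> U \<Longrightarrow> l < p \<Longrightarrow> p < q \<Longrightarrow> r \<le> q"
proof -
  note c = assms[unfolded standard_def]
  show "q \<le> p"
    if "X 2 p \<in> U" "X 1 q \<in> U"
    by (rule c[THEN conjunct1, rule_format]) (fact that)+
  show "q \<le> p"
    if "X 1 p \<in> U" "Y 2 q \<in> U"
    by (rule c[THEN conjunct2, THEN conjunct1, rule_format]) (fact that)+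
  show "q \<le> p"
    if "Y 2 p \<in> U" "Y 1 q \<in> U"
    by (rule c[THEN conjunct2, THEN conjunct2, THEN conjunct1, rule_format]) (fact that)+
  show "r \<le> q"
    if "X 2 p \<in> U" "Y 1 q \<in> U" "Z 2 r \<in> U" "p < q"
    by (rule c[THEN conjunct2, THEN conjunct2, THEN conjunct2, THEN conjunct1, rule_format]) (fact that)+
  show "r \<le> q"
    if "X 1 p \<in> U" "Y 1 q \<in> U" "Z 2 r \<in> U" "p < q"
    by (rule c[THEN conjunct2, THEN conjunct2, THEN conjunct2, THEN conjunct2, THEN conjunct1, rule_format]) (fact that)+
  show "r \<le> q"
    if "Y 1 l \<in> U" "X 2 p \<in> U" "Y 2 q \<in> U" "Z 2 r \<in> U" "l \<le> p" "p < q"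
    by (rule c[THEN conjunct2, THEN conjunct2, THEN conjunct2, THEN conjunct2, THEN conjunct2, THEN conjunct1, rule_format]) (fact that)+
  show "r \<le> q"
    if "X 2 l \<in> U" "Y 2 p \<in> U" "Z 2 q \<in> U" "Z 1 r \<in> U" "l < p" "p < q"
    by (rule c[THEN conjunct2, THEN conjunct2, THEN conjunct2, THEN conjunct2, THEN conjunct2, THEN conjunct2, rule_format]) (fact that)+
qed

lemma standard_mono:
  assumes "standard U" "U' \<subseteq> U"
  shows "standard U'"
  using assms(1) unfolding standard_def
  by (elim conj_forward all_forward imp_forward) (use assms(2) in \<open>auto\<close>)

text \<open>The good supports of a stratum are those of the monomials that should form a basis of its coordinate
ring. In \<open>top_good\<close>, \<open>cross_good\<close> and \<open>split_good\<close> each condition is the leading monomial of an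
obvious equation: a vanishing coordinate or a minor of two proportional rows. The bounds
on the columns also account for the factor that is invertible on the stratum.\<close>
definition top_good :: "nat \<Rightarrow> nat \<Rightarrow> var set \<Rightarrow> bool" where
  "top_good k h U \<longleftrightarrow> (\<forall>i j. X i j \<notin> U \<and> Y i j \<notin> U) \<and> (\<forall>j. Z 1 j \<in> U \<or> Z 2 j \<in> U \<longrightarrow> j \<le> h) \<and>
     (\<forall>q r. Z 2 q \<in> U \<longrightarrow> Z 1 r \<in> U \<longrightarrow> k < q \<longrightarrow> r \<le> q)"

definition cross_good :: "nat \<Rightarrow> nat \<Rightarrow> var set \<Rightarrow> bool" where
  "cross_good s k U \<longleftrightarrow> (\<forall>i j. X i j \<notin> U \<and> Y 2 j \<notin> U) \<and> (\<forall>j. Y 1 j \<in> U \<or> Z 2 j \<in> U \<longrightarrow> j \<le> k) \<and>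
     (\<forall>q r. Y 1 q \<in> U \<longrightarrow> Z 2 r \<in> U \<longrightarrow> s < q \<longrightarrow> r \<le> q)"

definition split_good :: "nat \<Rightarrow> nat \<Rightarrow> var set \<Rightarrow> bool" where
  "split_good i k U \<longleftrightarrow> (\<forall>i j. X i j \<notin> U) \<and> (\<forall>j. Y 1 j \<in> U \<or> Y 2 j \<in> U \<longrightarrow> j \<le> i) \<and>
     (\<forall>p q. Y 2 p \<in> U \<longrightarrow> Y 1 q \<in> U \<longrightarrow> q \<le> p) \<and> (\<forall>l r. Y 1 l \<in> U \<longrightarrow> Z 2 r \<in> U \<longrightarrow> r \<le> k) \<and>
     (\<forall>q r. Z 2 q \<in> U \<longrightarrow> Z 1 r \<in> U \<longrightarrow> k < q \<longrightarrow> r \<le> q)"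

text \<open>Variables that are invertible on the stratum may be multiplied to a monomial at will, so they are
adjoined to the support before it is tested. This produces the equations of the stratum from those
of the jet ideal: for example, \<open>X 2 s\<close> turns the leading monomial of $d_{s,q,r}$ into that of a
quadric. On the twisted stratum \<open>X 2 s\<close> has become 0, but the equations obtained by cancelling it
remain valid in the limit.\<close>
definition twisted_good :: "nat \<Rightarrow> nat \<Rightarrow> var set \<Rightarrow> bool" where
  "twisted_good s k U \<longleftrightarrow> (\<forall>i j. X i j \<notin> U) \<and> (\<forall>j. Y 2 j \<in> U \<longrightarrow> j \<le> k) \<and>
     standard (insert (X 2 s) (insert (Y 2 k) U))"

definition pole_good :: "nat \<Rightarrow> var set \<Rightarrow> bool" where
  "pole_good s U \<longleftrightarrow> (\<forall>j. X 2 j \<notin> U) \<and> (\<forall>j. X 1 j \<in> U \<longrightarrow> j \<le> s) \<and> standard (insert (X 1 s) U)"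

definition regular_good :: "nat \<Rightarrow> var set \<Rightarrow> bool" where
  "regular_good s U \<longleftrightarrow> (\<forall>j. X 2 j \<in> U \<longrightarrow> j \<le> s) \<and> standard (insert (X 2 s) U)"

lemma top_goodD:
  assumes "top_good k h U"
  shows "X i j \<notin> U" "Y i j \<notin> U" "Z 1 j \<in> U \<Longrightarrow> j \<le> h" "Z 2 j \<in> U \<Longrightarrow> j \<le> h"
    "Z 2 q \<in> U \<Longrightarrow> Z 1 r \<in> U \<Longrightarrow> k < q \<Longrightarrow> r \<le> q"
  using assms unfolding top_good_def by blast+

lemma cross_goodD:
  assumes "cross_good s k U"
  shows "X i j \<notin> U" "Y 2 j \<notin> U" "Y 1 j \<in> U \<Longrightarrow> j \<le> k" "Z 2 j \<in> U \<Longrightarrow> j \<le> k"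
    "Y 1 q \<in> U \<Longrightarrow> Z 2 r \<in> U \<Longrightarrow> s < q \<Longrightarrow> r \<le> q"
  using assms unfolding cross_good_def by blast+

lemma split_goodD:
  assumes "split_good i k U"
  shows "X i' j \<notin> U" "Y 1 j \<in> U \<Longrightarrow> j \<le> i" "Y 2 j \<in> U \<Longrightarrow> j \<le> i"
    "Y 2 p \<in> U \<Longrightarrow> Y 1 q \<in> U \<Longrightarrow> q \<le> p" "Y 1 l \<in> U \<Longrightarrow> Z 2 r \<in> U \<Longrightarrow> r \<le> k"
    "Z 2 q \<in> U \<Longrightarrow> Z 1 r \<in> U \<Longrightarrow> k < q \<Longrightarrow> r \<le> q"
  using assms unfolding split_good_def by blast+

section \<open>Leading monomials on the strata\<close>

lemma boundaryI:
  "excludes n V' G' \<Longrightarrow> adherent V V' \<Longrightarrow> G' U \<Longrightarrow> \<exists>V' G'. excludes n V' G' \<and> adherent V V' \<and> G' U"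
  by (intro exI conjI)

lemma le_pred: "j \<le> Suc h \<Longrightarrow> j \<noteq> Suc h \<Longrightarrow> j \<le> h"
  by simp

text \<open>If the second row of $z$ still occurs beyond column \<open>k\<close>, so that the top stratum of one column less
is needed, then proportionality already keeps the last entry of the first row out of
a good support.\<close>
lemma excludes_top:
  assumes "k < h"
  shows "excludes n (top_stratum k h :: (var \<Rightarrow> 'k::field_char_0) set) (top_good k h)"
  using assms
proof (induction h)
  case 0
  then show ?case by simp
next
  case (Suc h)
  show ?case
  proof (rule excludes_step[where w = "Z 2 (Suc h)"])
    fix U assume U: "U \<subseteq> vars n" "Z 2 (Suc h) \<notin> U" and good: "top_good k (Suc h) U"
    note D = top_goodD[OF good]
    show "\<exists>V' G'. excludes n V' G' \<and> adherent (top_stratum k (Suc h) :: (var \<Rightarrow> 'k) set) V' \<and> G' U"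
    proof (cases "\<exists>p>k. Z 2 p \<in> U")
      case True
      then obtain p where p: "p > k" "Z 2 p \<in> U" by blast
      then have ph: "p \<le> h"
        using D(4) U(2) by (metis le_pred)
      have "j \<le> h" if "Z 2 j \<in> U" for j
        using that D(4) U(2) by (metis le_pred)
      moreover have "j \<le> h" if "Z 1 j \<in> U" for j
        using D(5)[OF p(2) that p(1)] ph by simp
      ultimately have "top_good k h U"
        using D unfolding top_good_def by blast
      moreover have "k < h" using p ph by simp
      ultimately show ?thesis
        by (intro boundaryI[OF Suc.IH top_limit_top])
    next
      case False
      have "v \<in> {Z 1 j |j. j \<le> Suc h} \<union> {Z 2 j |j. j \<le> k}" if "v \<in> U" for v
      proof -
        have "v \<in> vars n" using that U(1) by blast
        then show ?thesis
          using that D(1-3) False by (cases rule: vars_cases) (auto intro: leI)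
      qed
      then show ?thesis
        by (intro boundaryI[OF excludes_coordinate top_limit_coordinate[OF Suc.prems]]) blast
    qed
  next
    fix U U' assume "top_good k (Suc h) U" and "U' \<subseteq> U"
    then show "top_good k (Suc h) U'"
      unfolding top_good_def by blast
  next
    fix U v assume good: "top_good k (Suc h) U" and v: "v \<in> U" "v \<in> vars n"
    from v(2) show "\<not> var_less v (Z 2 (Suc h))"
      using v(1) top_goodD[OF good] by (cases rule: vars_cases) force+
  next
    fix p :: "var \<Rightarrow> 'k" and v
    assume p: "p \<in> top_stratum k (Suc h)" "v \<in> vars n" "var_less v (Z 2 (Suc h))"
    from p(2) show "p v = 0"
      using p(1,3) by (cases rule: vars_cases) (auto simp: top_stratum_def)
  qed (auto simp: top_stratum_def)
qed

lemma excludes_cross: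
  assumes "s < k"
  shows "excludes n (cross_stratum s k :: (var \<Rightarrow> 'k::field_char_0) set) (cross_good s k)"
  using assms
proof (induction k)
  case 0
  then show ?case by simp
next
  case (Suc k)
  show ?case
  proof (rule excludes_step[where w = "Y 1 (Suc k)"])
    fix U assume U: "U \<subseteq> vars n" "Y 1 (Suc k) \<notin> U" and good: "cross_good s (Suc k) U"
    note D = cross_goodD[OF good]
    show "\<exists>V' G'. excludes n V' G' \<and> adherent (cross_stratum s (Suc k) :: (var \<Rightarrow> 'k) set) V' \<and> G' U"
    proof (cases "\<exists>p>s. Y 1 p \<in> U")
      case True
      then obtain p where p: "p > s" "Y 1 p \<in> U" by blast
      then have pk: "p \<le> k"
        using D(3) U(2) by (metis le_pred)
      have "j \<le> k" if "Y 1 j \<in> U" for j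
        using that D(3) U(2) by (metis le_pred)
      moreover have "j \<le> k" if "Z 2 j \<in> U" for j
        using D(5)[OF p(2) that p(1)] pk by simp
      ultimately have "cross_good s k U"
        using D unfolding cross_good_def by blast
      moreover have "s < k" using p pk by simp
      ultimately show ?thesis
        by (intro boundaryI[OF Suc.IH cross_limit_cross])
    next
      case False
      have "v \<in> {Y 1 j |j. j \<le> s} \<union> range (Z 1) \<union> {Z 2 j |j. j \<le> Suc k}" if "v \<in> U" for v
      proof -
        have "v \<in> vars n" using that U(1) by blast
        then show ?thesis
          using that D(1,2,4) False by (cases rule: vars_cases) (auto intro: leI)
      qed
      then show ?thesis
        by (intro boundaryI[OF excludes_coordinate cross_limit_coordinate[OF Suc.prems]]) blast
    qed
  next
    fix U U' assume "cross_good s (Suc k) U" and "U' \<subseteq> U"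
    then show "cross_good s (Suc k) U'"
      unfolding cross_good_def by blast
  next
    fix U v assume good: "cross_good s (Suc k) U" and v: "v \<in> U" "v \<in> vars n"
    from v(2) show "\<not> var_less v (Y 1 (Suc k))"
      using v(1) cross_goodD[OF good] by (cases rule: vars_cases) force+
  next
    fix p :: "var \<Rightarrow> 'k" and v
    assume p: "p \<in> cross_stratum s (Suc k)" "v \<in> vars n" "var_less v (Y 1 (Suc k))"
    from p(2) show "p v = 0"
      using p(1,3) by (cases rule: vars_cases) (auto simp: cross_stratum_def)
  qed (auto simp: cross_stratum_def)
qed

lemma excludes_split:
  assumes "1 \<le> i"
  shows "excludes n (split_stratum i k :: (var \<Rightarrow> 'k::field_char_0) set) (split_good i k)"
  using assms
proof (induction i)
  case 0
  then show ?case by simp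
next
  case (Suc i)
  show ?case
  proof (rule excludes_step[where w = "Y 2 (Suc i)"])
    fix U assume U: "U \<subseteq> vars n" "Y 2 (Suc i) \<notin> U" and good: "split_good (Suc i) k U"
    note D = split_goodD[OF good]
    consider p where "Y 2 p \<in> U" | "\<And>p. Y 2 p \<notin> U" "(\<exists>l. Y 1 l \<in> U) \<or> n \<le> k"
      | "\<And>p. Y 2 p \<notin> U" "\<And>l. Y 1 l \<notin> U" "k < n"
      by (metis not_le)
    then show "\<exists>V' G'. excludes n V' G' \<and> adherent (split_stratum (Suc i) k :: (var \<Rightarrow> 'k) set) V' \<and> G' U"
    proof cases
      case (1 p)
      have Y2: "j \<le> i" if "Y 2 j \<in> U" for j
        using that D(3) U(2) by (metis le_pred)
      have Y1: "j \<le> i" if "Y 1 j \<in> U" for j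
        using D(4)[OF 1 that] Y2[OF 1] by simp
      have "split_good i k U"
        unfolding split_good_def
        using D(1) Y1 Y2 D(4-6) by auto
      moreover have "1 \<le> i"
        using subset_varsD(1)[OF U(1), of 2 p] 1 Y2[OF 1] by simp
      ultimately show ?thesis
        by (intro boundaryI[OF Suc.IH split_limit_split])
    next
      case 2
      have "v \<in> {Y 1 j |j. j \<le> Suc i} \<union> range (Z 1) \<union> {Z 2 j |j. j \<le> k}" if "v \<in> U" for v
      proof -
        have "v \<in> vars n" using that U(1) by blast
        then show ?thesis
        proof (cases rule: vars_cases)
          case (Z2 j)
          then have "j \<le> k" using 2(2) D(5) that by auto
          then show ?thesis using Z2 by auto
        qed (use that D(1,2) 2(1) in auto)
      qed
      then show ?thesis
        by (intro boundaryI[OF excludes_coordinate split_limit_coordinate]) blast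
    next
      case 3
      have "Y i' j \<notin> U" for i' j
        using 3(1,2) subset_varsD(3)[OF U(1), of i' j] by auto
      moreover have "j \<le> n" if "Z 1 j \<in> U \<or> Z 2 j \<in> U" for j
        using subset_varsD(2)[OF U(1)] that by blast
      ultimately have "top_good k n U"
        unfolding top_good_def using D(1,6) by auto
      then show ?thesis
        by (intro boundaryI[OF excludes_top[OF 3(3)] split_limit_top])
    qed
  next
    fix U U' assume "split_good (Suc i) k U" and "U' \<subseteq> U"
    then show "split_good (Suc i) k U'"
      unfolding split_good_def by (elim conj_forward all_forward imp_forward) auto
  next
    fix U v assume good: "split_good (Suc i) k U" and v: "v \<in> U" "v \<in> vars n"
    from v(2) show "\<not> var_less v (Y 2 (Suc i))"
      using v(1) split_goodD[OF good] by (cases rule: vars_cases) force+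
  next
    fix p :: "var \<Rightarrow> 'k" and v
    assume p: "p \<in> split_stratum (Suc i) k" "v \<in> vars n" "var_less v (Y 2 (Suc i))"
    from p(2) show "p v = 0"
      using p(1,3) by (cases rule: vars_cases) (auto simp: split_stratum_def)
  qed (auto simp: split_stratum_def)
qed

lemma standardI:
  assumes "\<And>p q. X 2 p \<in> U \<Longrightarrow> X 1 q \<in> U \<Longrightarrow> q \<le> p"
    and "\<And>p q. X 1 p \<in> U \<Longrightarrow> Y 2 q \<in> U \<Longrightarrow> q \<le> p"
    and "\<And>p q. Y 2 p \<in> U \<Longrightarrow> Y 1 q \<in> U \<Longrightarrow> q \<le> p"
    and "\<And>p q r. X 2 p \<in> U \<Longrightarrow> Y 1 q \<in> U \<Longrightarrow> Z 2 r \<in> U \<Longrightarrow> p < q \<Longrightarrow> r \<le> q"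
    and "\<And>p q r. X 1 p \<in> U \<Longrightarrow> Y 1 q \<in> U \<Longrightarrow> Z 2 r \<in> U \<Longrightarrow> p < q \<Longrightarrow> r \<le> q"
    and "\<And>l p q r. Y 1 l \<in> U \<Longrightarrow> X 2 p \<in> U \<Longrightarrow> Y 2 q \<in> U \<Longrightarrow> Z 2 r \<in> U \<Longrightarrow> l \<le> p \<Longrightarrow> p < q \<Longrightarrow> r \<le> q"
    and "\<And>l p q r. X 2 l \<in> U \<Longrightarrow> Y 2 p \<in> U \<Longrightarrow> Z 2 q \<in> U \<Longrightarrow> Z 1 r \<in> U \<Longrightarrow> l < p \<Longrightarrow> p < q \<Longrightarrow> r \<le> q"
  shows "standard U"
  unfolding standard_def
  by (intro conjI allI impI, erule (1) assms(1), erule (1) assms(2), erule (1) assms(3),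
      erule (3) assms(4), erule (3) assms(5), erule (5) assms(6), erule (5) assms(7))

lemma standard_insert_Y2:
  assumes st: "standard (insert (X 2 s) U)" and X: "\<And>i j. X i j \<notin> U" and p: "Y 2 p \<in> U" "s < p" "p \<le> k"
  shows "standard (insert (X 2 s) (insert (Y 2 k) U))"
proof (rule standardI, goal_cases)
  case (3 p' q)
  then show ?case
    using standardD(3)[OF st, of p q] standardD(3)[OF st, of p' q] p by auto
next
  case (4 p' q r)
  then show ?case
    using standardD(4)[OF st, of p' q r] by auto
next
  case (6 l p' q r)
  then show ?case
    using standardD(6)[OF st, of l p' q r] standardD(6)[OF st, of l p' p r] p X by auto
next
  case (7 l p' q r)
  then show ?case
    using standardD(7)[OF st, of l p' q r] standardD(7)[OF st, of l p q r] p X by auto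
qed (use X in auto)

text \<open>Three boundary pieces are needed, according to the columns that occur in a good support: \<open>d\<close> beyond
column \<open>s\<close> leads to the next twisted stratum, otherwise \<open>c\<close> beyond column \<open>s\<close> to the cross stratum and
its absence to the split stratum.\<close>
lemma excludes_twisted:
  assumes "1 \<le> s" "s < k"
  shows "excludes n (twisted_stratum s k :: (var \<Rightarrow> 'k::field_char_0) set) (twisted_good s k)"
  using assms(2)
proof (induction k)
  case 0
  then show ?case by simp
next
  case (Suc k)
  show ?case
  proof (rule excludes_step[where w = "Y 2 (Suc k)"])
    fix U assume U: "U \<subseteq> vars n" "Y 2 (Suc k) \<notin> U" and good: "twisted_good s (Suc k) U"
    have X: "X i j \<notin> U" for i j
      using good by (simp add: twisted_good_def)
    have Y2: "j \<le> k" if "Y 2 j \<in> U" for j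
      using good U(2) that unfolding twisted_good_def by (metis le_pred)
    have st: "standard (insert (X 2 s) (insert (Y 2 (Suc k)) U))"
      using good by (simp add: twisted_good_def)
    note D = standardD[OF st]
    consider p where "Y 2 p \<in> U" "s < p"
      | "\<And>p. Y 2 p \<in> U \<Longrightarrow> p \<le> s" "\<And>q. Y 1 q \<in> U \<Longrightarrow> q \<le> s"
      | q where "\<And>p. Y 2 p \<in> U \<Longrightarrow> p \<le> s" "Y 1 q \<in> U" "s < q"
      by (metis not_le)
    then show "\<exists>V' G'. excludes n V' G' \<and> adherent (twisted_stratum s (Suc k) :: (var \<Rightarrow> 'k) set) V' \<and> G' U"
    proof cases
      case (1 p)
      have "standard (insert (X 2 s) U)"
        by (rule standard_mono[OF st]) blast
      then have "standard (insert (X 2 s) (insert (Y 2 k) U))"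
        using standard_insert_Y2[of s U p k] X 1 Y2 by auto
      then have "twisted_good s k U"
        using X Y2 by (simp add: twisted_good_def)
      moreover have "s < k" using 1 Y2[of p] by simp
      ultimately show ?thesis
        by (intro boundaryI[OF Suc.IH twisted_limit_twisted])
    next
      case 2
      have "q \<le> p" if "Y 2 p \<in> U" "Y 1 q \<in> U" for p q
        using D(3)[of p q] that by simp
      moreover have "r \<le> Suc k" if "Y 1 l \<in> U" "Z 2 r \<in> U" for l r
        using D(6)[of l s "Suc k" r] 2(2)[OF that(1)] that Suc.prems by simp
      moreover have "r \<le> q" if "Z 2 q \<in> U" "Z 1 r \<in> U" "Suc k < q" for q r
        using D(7)[of s "Suc k" q r] that Suc.prems by simp
      ultimately have "split_good s (Suc k) U"
        unfolding split_good_def using X 2 by auto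
      then show ?thesis
        by (intro boundaryI[OF excludes_split[OF assms(1)] twisted_limit_split[OF Suc.prems]])
    next
      case (3 q)
      have noY2: "Y 2 p \<notin> U" for p
        using D(3)[of p q] 3 by fastforce
      have Y1: "j \<le> Suc k" if "Y 1 j \<in> U" for j
        using D(3)[of "Suc k" j] that by simp
      have CF: "r \<le> j" if "Y 1 j \<in> U" "Z 2 r \<in> U" "s < j" for j r
        using D(4)[of s j r] that by simp
      have "j \<le> Suc k" if "Z 2 j \<in> U" for j
        using CF[OF 3(2) that 3(3)] Y1[OF 3(2)] by simp
      then have "cross_good s (Suc k) U"
        unfolding cross_good_def using X noY2 Y1 CF by auto
      then show ?thesis
        by (intro boundaryI[OF excludes_cross[OF Suc.prems] twisted_limit_cross])
    qed
  next
    fix U U' assume good: "twisted_good s (Suc k) U" and sub: "U' \<subseteq> U"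
    have ins: "insert (X 2 s) (insert (Y 2 (Suc k)) U') \<subseteq> insert (X 2 s) (insert (Y 2 (Suc k)) U)"
      using sub by blast
    show "twisted_good s (Suc k) U'"
      using good sub standard_mono[OF _ ins] unfolding twisted_good_def by auto
  next
    fix U v assume good: "twisted_good s (Suc k) U" and v: "v \<in> U" "v \<in> vars n"
    from v(2) show "\<not> var_less v (Y 2 (Suc k))"
      using v(1) good by (cases rule: vars_cases) (auto simp: twisted_good_def dest: leD)
  next
    fix p :: "var \<Rightarrow> 'k" and v
    assume p: "p \<in> twisted_stratum s (Suc k)" "v \<in> vars n" "var_less v (Y 2 (Suc k))"
    from p(2) show "p v = 0"
      using p(1,3) by (cases rule: vars_cases) (auto simp: twisted_stratum_def)
  qed (auto simp: twisted_stratum_def)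
qed

text \<open>A good support that meets the first row of $x$ goes to the next pole stratum. One that does not
goes to the split stratum if it meets the second row of $y$ or if \<open>s\<close> is the last column, and to the
cross stratum otherwise.\<close>
lemma excludes_pole:
  assumes "1 \<le> s"
  shows "excludes n (pole_stratum s :: (var \<Rightarrow> 'k::field_char_0) set) (pole_good s)"
  using assms
proof (induction s)
  case 0
  then show ?case by simp
next
  case (Suc s)
  show ?case
  proof (rule excludes_step[where w = "X 1 (Suc s)"])
    fix U assume U: "U \<subseteq> vars n" "X 1 (Suc s) \<notin> U" and good: "pole_good (Suc s) U"
    have X2: "X 2 j \<notin> U" for j
      using good by (simp add: pole_good_def)
    have X1: "j \<le> s" if "X 1 j \<in> U" for j
      using good U(2) that unfolding pole_good_def by (metis le_pred)
    have st: "standard (insert (X 1 (Suc s)) U)"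
      using good by (simp add: pole_good_def)
    note D = standardD[OF st]
    have Zn: "j \<le> n" if "Y 1 j \<in> U \<or> Z 1 j \<in> U \<or> Z 2 j \<in> U" for j
      using subset_varsD(2)[OF U(1)] that by blast
    consider p where "X 1 p \<in> U"
      | "\<And>j. X 1 j \<notin> U" "(\<exists>p. Y 2 p \<in> U) \<or> n \<le> Suc s"
      | "\<And>j. X 1 j \<notin> U" "\<And>p. Y 2 p \<notin> U" "Suc s < n"
      by (metis not_le)
    then show "\<exists>V' G'. excludes n V' G' \<and> adherent (pole_stratum (Suc s) :: (var \<Rightarrow> 'k) set) V' \<and> G' U"
    proof cases
      case (1 p)
      have "standard (insert (X 1 s) U)"
      proof (rule standardI, goal_cases)
        case (2 p' q)
        then show ?case
          using D(2)[of p' q] D(2)[of p q] 1 X1[OF 1] by auto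
      next
        case (3 p' q)
        then show ?case using D(3)[of p' q] by auto
      next
        case (5 p' q r)
        then show ?case
          using D(5)[of p' q r] D(5)[of p q r] 1 X1[OF 1] by auto
      qed (use X2 in auto)
      then have "pole_good s U"
        using X1 X2 by (simp add: pole_good_def)
      moreover have "1 \<le> s"
        using subset_varsD(1)[OF U(1), of 1 p] 1 X1[OF 1] by simp
      ultimately show ?thesis
        by (intro boundaryI[OF Suc.IH pole_limit_pole])
    next
      case 2
      have X: "X i j \<notin> U" for i j
        using X2 2(1) subset_varsD(3)[OF U(1), of i j] by auto
      have Y2: "j \<le> Suc s" if "Y 2 j \<in> U" for j
        using D(2)[of "Suc s" j] that by simp
      have CD: "q \<le> p" if "Y 2 p \<in> U" "Y 1 q \<in> U" for p q
        using D(3)[of p q] that by simp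
      have "j \<le> Suc s" if "Y 1 j \<in> U" for j
        using 2(2) CD[OF _ that] Y2 Zn[of j] that by (meson order_trans)
      moreover have "r \<le> q" if "Z 2 q \<in> U" "Z 1 r \<in> U" "n < q" for q r
        using Zn[of q] that by simp
      ultimately have "split_good (Suc s) n U"
        unfolding split_good_def using X Y2 CD Zn by blast
      then show ?thesis
        by (intro boundaryI[OF excludes_split[OF Suc.prems] pole_limit_split])
    next
      case 3
      have X: "X i j \<notin> U" for i j
        using X2 3(1) subset_varsD(3)[OF U(1), of i j] by auto
      have "r \<le> j" if "Y 1 j \<in> U" "Z 2 r \<in> U" "Suc s < j" for j r
        using D(5)[of "Suc s" j r] that by simp
      then have "cross_good (Suc s) n U"
        unfolding cross_good_def using X 3(2) Zn by blast
      then show ?thesis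
        by (intro boundaryI[OF excludes_cross[OF 3(3)] pole_limit_cross])
    qed
  next
    fix U U' assume good: "pole_good (Suc s) U" and sub: "U' \<subseteq> U"
    have ins: "insert (X 1 (Suc s)) U' \<subseteq> insert (X 1 (Suc s)) U"
      using sub by blast
    show "pole_good (Suc s) U'"
      using good sub standard_mono[OF _ ins] unfolding pole_good_def by auto
  next
    fix U v assume good: "pole_good (Suc s) U" and v: "v \<in> U" "v \<in> vars n"
    from v(2) show "\<not> var_less v (X 1 (Suc s))"
      using v(1) good by (cases rule: vars_cases) (auto simp: pole_good_def dest: leD)
  next
    fix p :: "var \<Rightarrow> 'k" and v
    assume p: "p \<in> pole_stratum (Suc s)" "v \<in> vars n" "var_less v (X 1 (Suc s))"
    from p(2) show "p v = 0"
      using p(1,3) by (cases rule: vars_cases) (auto simp: pole_stratum_def)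
  qed (auto simp: pole_stratum_def)
qed

text \<open>A good support that meets the second row of $x$ goes to the next regular stratum. Among the others,
the second row of $y$ beyond column \<open>s\<close> excludes the first row of $x$ and forces the twisted stratum;
the pole stratum takes care of the rest.\<close>
lemma excludes_regular:
  assumes "1 \<le> s"
  shows "excludes n (regular_stratum s :: (var \<Rightarrow> 'k::field_char_0) set) (regular_good s)"
  using assms
proof (induction s)
  case 0
  then show ?case by simp
next
  case (Suc s)
  show ?case
  proof (rule excludes_step[where w = "X 2 (Suc s)"])
    fix U assume U: "U \<subseteq> vars n" "X 2 (Suc s) \<notin> U" and good: "regular_good (Suc s) U"
    have X2: "j \<le> s" if "X 2 j \<in> U" for j
      using good U(2) that unfolding regular_good_def by (metis le_pred)
    have st: "standard (insert (X 2 (Suc s)) U)"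
      using good by (simp add: regular_good_def)
    note D = standardD[OF st]
    have X1: "j \<le> Suc s" if "X 1 j \<in> U" for j
      using D(1)[of "Suc s" j] that by simp
    consider p where "X 2 p \<in> U"
      | "\<And>j. X 2 j \<notin> U" "(\<exists>p. X 1 p \<in> U) \<or> (\<forall>q. Y 2 q \<in> U \<longrightarrow> q \<le> Suc s)"
      | q where "\<And>j. X 2 j \<notin> U" "\<And>p. X 1 p \<notin> U" "Y 2 q \<in> U" "Suc s < q"
      by (metis not_le)
    then show "\<exists>V' G'. excludes n V' G' \<and> adherent (regular_stratum (Suc s) :: (var \<Rightarrow> 'k) set) V' \<and> G' U"
    proof cases
      case (1 p)
      have ps: "p \<le> s" by (rule X2[OF 1])
      have "standard (insert (X 2 s) U)"
      proof (rule standardI, goal_cases)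
        case (1 p' q)
        then show ?case
          using D(1)[of p' q] D(1)[of p q] \<open>X 2 p \<in> U\<close> ps by auto
      next
        case (2 p' q)
        then show ?case using D(2)[of p' q] by auto
      next
        case (3 p' q)
        then show ?case using D(3)[of p' q] by auto
      next
        case (4 p' q r)
        then show ?case
          using D(4)[of p' q r] D(4)[of p q r] \<open>X 2 p \<in> U\<close> ps by auto
      next
        case (5 p' q r)
        then show ?case using D(5)[of p' q r] by auto
      next
        case (6 l p' q r)
        then show ?case
          using D(6)[of l p' q r] D(6)[of l p q r] D(4)[of p l r] \<open>X 2 p \<in> U\<close> ps
          by (cases "l \<le> p") auto
      next
        case (7 l p' q r)
        then show ?case
          using D(7)[of l p' q r] D(7)[of p p' q r] \<open>X 2 p \<in> U\<close> ps by auto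
      qed
      then have "regular_good s U"
        using X2 by (simp add: regular_good_def)
      moreover have "1 \<le> s"
        using subset_varsD(1)[OF U(1), of 2 p] 1 ps by simp
      ultimately show ?thesis
        by (intro boundaryI[OF Suc.IH regular_limit_regular])
    next
      case 2
      have "standard (insert (X 1 (Suc s)) U)"
      proof (rule standardI, goal_cases)
        case (2 p q)
        then show ?case
          using D(2)[of p q] D(2)[of _ q] \<open>(\<exists>p. X 1 p \<in> U) \<or> (\<forall>q. Y 2 q \<in> U \<longrightarrow> q \<le> Suc s)\<close> X1 by fastforce
      next
        case (3 p q)
        then show ?case using D(3)[of p q] by auto
      next
        case (5 p q r)
        then show ?case
          using D(5)[of p q r] D(4)[of "Suc s" q r] by auto
      qed (use 2(1) in auto)
      then have "pole_good (Suc s) U"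
        using 2(1) X1 by (simp add: pole_good_def)
      then show ?thesis
        by (intro boundaryI[OF excludes_pole[OF Suc.prems] regular_limit_pole])
    next
      case (3 q)
      have X: "X i j \<notin> U" for i j
        using 3(1,2) subset_varsD(3)[OF U(1), of i j] by auto
      have qn: "q \<le> n"
        using subset_varsD(2)[OF U(1), of 2 q] 3(3) by simp
      have "twisted_good (Suc s) n U"
        unfolding twisted_good_def
        using X standard_insert_Y2[OF st X 3(3,4) qn] subset_varsD(2)[OF U(1)] by blast
      moreover have "Suc s < n" using 3(4) qn by simp
      ultimately show ?thesis
        by (intro boundaryI[OF excludes_twisted[OF Suc.prems] regular_limit_twisted])
    qed
  next
    fix U U' assume good: "regular_good (Suc s) U" and sub: "U' \<subseteq> U"
    have ins: "insert (X 2 (Suc s)) U' \<subseteq> insert (X 2 (Suc s)) U"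
      using sub by blast
    show "regular_good (Suc s) U'"
      using good sub standard_mono[OF _ ins] unfolding regular_good_def by auto
  next
    fix U v assume good: "regular_good (Suc s) U" and v: "v \<in> U" "v \<in> vars n"
    from v(2) show "\<not> var_less v (X 2 (Suc s))"
      using v(1) good by (cases rule: vars_cases) (auto simp: regular_good_def dest: leD)
  next
    fix p :: "var \<Rightarrow> 'k" and v
    assume p: "p \<in> regular_stratum (Suc s)" "v \<in> vars n" "var_less v (X 2 (Suc s))"
    from p(2) show "p v = 0"
      using p(1,3) by (cases rule: vars_cases) (auto simp: regular_stratum_def)
  qed (auto simp: regular_stratum_def)
qed

section \<open>The polynomials of $\Gamma$\<close>

lemma mat_delete_top_row:
  assumes "A \<in> carrier_mat (n + 1) (n + 1)"
  shows "mat_delete A 0 j \<in> carrier_mat n n"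
    and "i < n \<Longrightarrow> k < n \<Longrightarrow> mat_delete A 0 j $$ (i, k) = A $$ (i + 1, if k < j then k else k + 1)"
  using assms by (auto simp: mat_delete_def)

lemma det_carrier_2:
  fixes A :: "'a::comm_ring_1 mat"
  assumes A: "A \<in> carrier_mat 2 2"
  shows "det A = A $$ (0, 0) * A $$ (1, 1) - A $$ (0, 1) * A $$ (1, 0)"
proof -
  have A1: "A \<in> carrier_mat (1 + 1) (1 + 1)"
    using A by (simp only: one_add_one)
  have minor: "det (mat_delete A 0 j) = A $$ (1, if 0 < j then 0 else 1)" for j
    using det_single[OF mat_delete_top_row(1)[OF A1]] mat_delete_top_row(2)[OF A1, of 0 0 j] by simp
  have sum2: "(\<Sum>j<2. h j) = h 0 + h (1::nat)" for h :: "nat \<Rightarrow> 'a"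
    by (simp add: numeral_2_eq_2)
  show ?thesis
    unfolding laplace_expansion_row[OF A, of 0, simplified] sum2 cofactor_def minor by simp
qed

lemma det_carrier_3:
  fixes A :: "'a::comm_ring_1 mat"
  assumes A: "A \<in> carrier_mat 3 3"
  shows "det A = A $$ (0, 0) * (A $$ (1, 1) * A $$ (2, 2) - A $$ (1, 2) * A $$ (2, 1))
    - A $$ (0, 1) * (A $$ (1, 0) * A $$ (2, 2) - A $$ (1, 2) * A $$ (2, 0))
    + A $$ (0, 2) * (A $$ (1, 0) * A $$ (2, 1) - A $$ (1, 1) * A $$ (2, 0))"
proof -
  have A1: "A \<in> carrier_mat (2 + 1) (2 + 1)"
    using A by simp
  note minor = det_carrier_2[OF mat_delete_top_row(1)[OF A1]]
  have sum3: "(\<Sum>j<3. h j) = h 0 + h 1 + h (2::nat)" for h :: "nat \<Rightarrow> 'a"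
    by (simp add: numeral_3_eq_3 numeral_2_eq_2)
  show ?thesis
    unfolding laplace_expansion_row[OF A, of 0, simplified] sum3 cofactor_def minor
    by (simp add: mat_delete_top_row(2)[OF A1])
      (simp add: numeral_2_eq_2 numeral_3_eq_3 algebra_simps)
qed

lemma det_carrier_4:
  fixes A :: "'a::comm_ring_1 mat"
  assumes A: "A \<in> carrier_mat 4 4"
  defines "m \<equiv> \<lambda>i j k. A $$ (1, i) * (A $$ (2, j) * A $$ (3, k) - A $$ (2, k) * A $$ (3, j))
    - A $$ (1, j) * (A $$ (2, i) * A $$ (3, k) - A $$ (2, k) * A $$ (3, i))
    + A $$ (1, k) * (A $$ (2, i) * A $$ (3, j) - A $$ (2, j) * A $$ (3, i))"
  shows "det A = A $$ (0, 0) * m 1 2 3 - A $$ (0, 1) * m 0 2 3 + A $$ (0, 2) * m 0 1 3 - A $$ (0, 3) * m 0 1 2"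
proof -
  have A1: "A \<in> carrier_mat (3 + 1) (3 + 1)"
    using A by simp
  note minor = det_carrier_3[OF mat_delete_top_row(1)[OF A1]]
  have sum4: "(\<Sum>j<4. h j) = h 0 + h 1 + h 2 + h (3::nat)" for h :: "nat \<Rightarrow> 'a"
    by (simp add: eval_nat_numeral)
  show ?thesis
    unfolding laplace_expansion_row[OF A, of 0, simplified] sum4 cofactor_def minor m_def
    by (simp add: mat_delete_top_row(2)[OF A1])
      (simp add: numeral_2_eq_2 numeral_3_eq_3 algebra_simps)
qed

lemma mat_of_rows_list_index:
  "length rs = n \<Longrightarrow> mat_of_rows_list n rs \<in> carrier_mat n n"
  "length rs = n \<Longrightarrow> i < n \<Longrightarrow> j < n \<Longrightarrow> mat_of_rows_list n rs $$ (i, j) = rs ! i ! j"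
  by (auto simp: mat_of_rows_list_def)

text \<open>The minors of two or three rows are wedge products: with rows as 1-forms in the columns, \<open>alt2 u v\<close>
is $u \wedge v$ and \<open>alt3 u v w\<close> is $u \wedge v \wedge w$. Rows are always listed from the smaller to
the larger variables, which makes the diagonal term the leading one.\<close>
definition alt2 :: "(nat \<Rightarrow> 'a) \<Rightarrow> (nat \<Rightarrow> 'a) \<Rightarrow> nat \<Rightarrow> nat \<Rightarrow> 'a::comm_ring_1" where
  "alt2 u v p q = u p * v q - u q * v p"

definition alt3 :: "(nat \<Rightarrow> 'a) \<Rightarrow> (nat \<Rightarrow> 'a) \<Rightarrow> (nat \<Rightarrow> 'a) \<Rightarrow> nat \<Rightarrow> nat \<Rightarrow> nat \<Rightarrow> 'a::comm_ring_1" where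
  "alt3 u v w p q r = u p * alt2 v w q r - u q * alt2 v w p r + u r * alt2 v w p q"

lemma a_poly_eq: "a_poly p q = - alt2 (xv 2) (xv 1) p q"
  unfolding a_poly_def by (subst det_carrier_2) (simp_all add: mat_of_rows_list_index alt2_def algebra_simps)

lemma b_poly_eq: "b_poly p q = alt2 (xv 1) (yv 2) p q - alt2 (xv 2) (yv 1) p q"
  unfolding b_poly_def by (subst (1 2) det_carrier_2) (simp_all add: mat_of_rows_list_index alt2_def algebra_simps)

lemma c_poly_eq:
  "c_poly p q = alt2 (xv 1) (zv 2) p q - alt2 (xv 2) (zv 1) p q - alt2 (yv 2) (yv 1) p q"
  unfolding c_poly_def by (subst (1 2 3) det_carrier_2) (simp_all add: mat_of_rows_list_index alt2_def algebra_simps)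

lemma d_poly_eq: "d_poly p q r = alt3 (xv 2) (yv 1) (zv 2) p q r - alt3 (xv 2) (yv 2) (zv 1) p q r"
  unfolding d_poly_def
  by (subst (1 2) det_carrier_3) (simp_all add: mat_of_rows_list_index alt2_def alt3_def algebra_simps)

lemma e_poly_eq: "e_poly p q r = alt3 (xv 1) (yv 1) (zv 2) p q r - alt3 (xv 2) (yv 1) (zv 1) p q r"
  unfolding e_poly_def
  by (subst (1 2) det_carrier_3) (simp_all add: mat_of_rows_list_index alt2_def alt3_def algebra_simps)

lemma f_poly_eq:
  "f_poly l p q r = yv 1 l * alt3 (xv 2) (yv 2) (zv 2) p q r + xv 2 l * alt3 (xv 2) (zv 2) (zv 1) p q r
     - yv 2 l * alt3 (xv 2) (yv 2) (zv 1) p q r"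
  unfolding f_poly_def
  by (subst det_carrier_4) (simp_all add: mat_of_rows_list_index alt2_def alt3_def eval_nat_numeral algebra_simps)

lemma g_poly_eq:
  "g_poly l p q r = xv 2 l * alt3 (yv 2) (zv 2) (zv 1) p q r - xv 2 p * alt3 (yv 2) (zv 2) (zv 1) l q r
     + xv 2 q * alt3 (yv 2) (zv 2) (zv 1) l p r - xv 2 r * alt3 (yv 2) (zv 2) (zv 1) l p q"
  unfolding g_poly_def
  by (subst det_carrier_4) (simp_all add: mat_of_rows_list_index alt2_def alt3_def eval_nat_numeral algebra_simps)

text \<open>Write $A, \dots, F$ for the rows $x_1, x_2, y_1, y_2, z_1, z_2$. Then
$a = A \wedge B$, $b = A \wedge D + C \wedge B$, $c = A \wedge F + E \wedge B + C \wedge D$ and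
$d = B \wedge C \wedge F + B \wedge E \wedge D$, whence $d = - (c \wedge D + b \wedge F)$. In the same way
$e = - c \wedge C$ and $g = d \wedge F$. For $f$ one expands along the first column and replaces
$C_l D - D_l C$ by means of $c_{l,\cdot}$.\<close>
lemma d_poly_combination:
  "d_poly p q r = - (c_poly p q * yv 2 r - c_poly p r * yv 2 q + c_poly q r * yv 2 p
     + b_poly p q * zv 2 r - b_poly p r * zv 2 q + b_poly q r * zv 2 p)"
  unfolding d_poly_eq b_poly_eq c_poly_eq alt3_def alt2_def by (simp add: algebra_simps)

lemma e_poly_combination:
  "e_poly p q r = - (c_poly p q * yv 1 r - c_poly p r * yv 1 q + c_poly q r * yv 1 p)"
  unfolding e_poly_eq c_poly_eq alt3_def alt2_def by (simp add: algebra_simps)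

lemma f_poly_combination:
  "f_poly l p q r = d_poly p q r * yv 2 l
     - c_poly l p * alt2 (xv 2) (zv 2) q r + c_poly l q * alt2 (xv 2) (zv 2) p r
     - c_poly l r * alt2 (xv 2) (zv 2) p q
     - (a_poly p q * zv 2 r - a_poly p r * zv 2 q + a_poly q r * zv 2 p) * zv 2 l"
  unfolding f_poly_eq d_poly_eq c_poly_eq a_poly_eq alt3_def alt2_def by (simp add: algebra_simps)

lemma g_poly_combination:
  "g_poly l p q r = d_poly l p q * zv 2 r - d_poly l p r * zv 2 q + d_poly l q r * zv 2 p - d_poly p q r * zv 2 l"
  unfolding g_poly_eq d_poly_eq alt3_def alt2_def by (simp add: algebra_simps)

section \<open>Leading monomials of $\Gamma$\<close>

definition indet :: "var \<Rightarrow> 'k::comm_ring_1 mpoly" where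
  "indet v = Poly_Mapping.single (Poly_Mapping.single v 1) 1"

lemma indet_rows: "xv i = (\<lambda>j. indet (X i j))" "yv i = (\<lambda>j. indet (Y i j))" "zv i = (\<lambda>j. indet (Z i j))"
  by (simp_all add: fun_eq_iff xv_def yv_def zv_def indet_def)

lemma mpoly_expand: "p = (\<Sum>k\<in>Poly_Mapping.keys p. Poly_Mapping.single k (Poly_Mapping.lookup p k))"
proof (rule poly_mapping_eqI)
  fix m
  have "(\<Sum>k\<in>Poly_Mapping.keys p. Poly_Mapping.lookup (Poly_Mapping.single k (Poly_Mapping.lookup p k)) m)
      = (\<Sum>k\<in>Poly_Mapping.keys p. if k = m then Poly_Mapping.lookup p k else 0)"
    by (intro sum.cong) (auto simp: lookup_single when_def)
  also have "\<dots> = Poly_Mapping.lookup p m"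
    by (auto simp: in_keys_iff)
  finally show "Poly_Mapping.lookup p m =
      Poly_Mapping.lookup (\<Sum>k\<in>Poly_Mapping.keys p. Poly_Mapping.single k (Poly_Mapping.lookup p k)) m"
    by (simp add: lookup_sum)
qed

lemma lookup_single_mult:
  fixes p :: "'k::comm_ring_1 mpoly"
  shows "Poly_Mapping.lookup (Poly_Mapping.single a 1 * p) (a + m) = Poly_Mapping.lookup p m"
proof -
  have "Poly_Mapping.single a 1 * p =
      (\<Sum>k\<in>Poly_Mapping.keys p. Poly_Mapping.single (a + k) (Poly_Mapping.lookup p k))"
    by (subst mpoly_expand[of p]) (simp add: sum_distrib_left mult_single)
  then have "Poly_Mapping.lookup (Poly_Mapping.single a 1 * p) (a + m) =
      (\<Sum>k\<in>Poly_Mapping.keys p. if k = m then Poly_Mapping.lookup p k else 0)"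
    by (auto simp: lookup_sum lookup_single when_def intro!: sum.cong)
  then show ?thesis
    by (auto simp: in_keys_iff)
qed

lemma leads_indet: "leads (Poly_Mapping.keys (indet v :: 'k::comm_ring_1 mpoly)) (Poly_Mapping.single v 1)"
  by (simp add: leads_def indet_def)

lemma leads_uminus:
  fixes p :: "'k::comm_ring_1 mpoly"
  shows "leads (Poly_Mapping.keys p) m \<Longrightarrow> leads (Poly_Mapping.keys (- p)) m"
  by simp

lemma leads_add:
  fixes p q :: "'k::comm_ring_1 mpoly"
  assumes p: "leads (Poly_Mapping.keys p) m" and q: "leads (Poly_Mapping.keys q) m'" and less: "grevlex_less m' m"
  shows "leads (Poly_Mapping.keys (p + q)) m"
proof -
  have below: "grevlex_less k m" if "k \<in> Poly_Mapping.keys q" for k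
    using q less that grevlex_trans[of k m' m] by (cases "k = m'") (auto simp: leads_def)
  then have "m \<notin> Poly_Mapping.keys q" using grevlex_irrefl[of m] by blast
  moreover have "m \<in> Poly_Mapping.keys p" using p by (simp add: leads_def)
  ultimately have "m \<in> Poly_Mapping.keys (p + q)"
    by (simp add: in_keys_iff lookup_add)
  moreover have "grevlex_less k m" if "k \<in> Poly_Mapping.keys (p + q)" "k \<noteq> m" for k
    using subsetD[OF Poly_Mapping.keys_add that(1)] that(2) below p by (auto simp: leads_def)
  ultimately show ?thesis by (simp add: leads_def)
qed

lemma leads_diff:
  fixes p q :: "'k::comm_ring_1 mpoly"
  assumes "leads (Poly_Mapping.keys p) m" "leads (Poly_Mapping.keys q) m'" "grevlex_less m' m"
  shows "leads (Poly_Mapping.keys (p - q)) m"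
  using leads_add[OF assms(1) leads_uminus[OF assms(2)] assms(3)] by simp

lemma leads_indet_mult:
  fixes p :: "'k::comm_ring_1 mpoly"
  assumes "leads (Poly_Mapping.keys p) m"
  shows "leads (Poly_Mapping.keys (indet v * p)) (Poly_Mapping.single v 1 + m)"
  unfolding leads_def
proof (intro conjI ballI impI)
  show "Poly_Mapping.single v 1 + m \<in> Poly_Mapping.keys (indet v * p)"
    using assms by (simp add: in_keys_iff indet_def lookup_single_mult leads_def)
next
  fix k assume k: "k \<in> Poly_Mapping.keys (indet v * p)" "k \<noteq> Poly_Mapping.single v 1 + m"
  then obtain k' where k': "k' \<in> Poly_Mapping.keys p" "k = Poly_Mapping.single v 1 + k'"
    using keys_mult[of "indet v :: 'k mpoly" p] by (auto simp: indet_def)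
  then have "grevlex_less k' m"
    using assms k(2) by (auto simp: leads_def)
  then show "grevlex_less k (Poly_Mapping.single v 1 + m)"
    unfolding k'(2) add.commute[of "Poly_Mapping.single v 1"] grevlex_add_cancel .
qed

text \<open>Whatever contains the smallest variable involved is the smaller monomial. After common factors are
cancelled, this decides every comparison between terms of $\Gamma$.\<close>
lemma grevlex_smallest:
  assumes "mono_deg s = mono_deg t" "v \<in> Poly_Mapping.keys s" "\<And>x. x \<in> Poly_Mapping.keys t \<Longrightarrow> var_less v x"
    "\<And>x. x \<in> Poly_Mapping.keys s \<Longrightarrow> \<not> var_less x v"
  shows "grevlex_less s t"
proof -
  have "v \<notin> Poly_Mapping.keys t"
    using assms(3)[of v] by auto
  then have "Poly_Mapping.lookup s v > Poly_Mapping.lookup t v"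
    using assms(2) by (simp add: in_keys_iff)
  moreover have "Poly_Mapping.lookup s w = Poly_Mapping.lookup t w" if "var_less w v" for w
  proof -
    have "w \<notin> Poly_Mapping.keys s" using assms(4) that by blast
    moreover have "w \<notin> Poly_Mapping.keys t"
      using assms(3)[of w] var_less_trans[OF that] by force
    ultimately show ?thesis by (simp add: in_keys_iff)
  qed
  ultimately show ?thesis
    using assms(1) by (auto simp: grevlex_less_def)
qed

abbreviation monovar :: "var \<Rightarrow> mono" where
  "monovar v \<equiv> Poly_Mapping.single v 1"

lemma keys_add_mono: "Poly_Mapping.keys (s + t) = Poly_Mapping.keys s \<union> Poly_Mapping.keys (t :: mono)"
  by (auto simp: in_keys_iff lookup_add)

lemma grevlex_add_cancel_left: "grevlex_less (u + s) (u + t) \<longleftrightarrow> grevlex_less s t"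
  by (simp add: add.commute[of u])

definition rows_less :: "(nat \<Rightarrow> var) \<Rightarrow> (nat \<Rightarrow> var) \<Rightarrow> bool" where
  "rows_less u v \<longleftrightarrow> (\<forall>i j. var_less (u i) (v j) \<and> \<not> var_less (v j) (u i)) \<and> (\<forall>i j. var_less (u i) (u j) \<longleftrightarrow> j < i)"

lemma leads_alt2:
  assumes "rows_less u v" "p < q"
  shows "leads (Poly_Mapping.keys (alt2 (\<lambda>j. indet (u j)) (\<lambda>j. indet (v j)) p q :: 'k::comm_ring_1 mpoly))
    (monovar (u p) + monovar (v q))"
  unfolding alt2_def
proof (rule leads_diff)
  show "grevlex_less (monovar (u q) + monovar (v p)) (monovar (u p) + monovar (v q))"
    using assms by (intro grevlex_smallest[where v = "u q"]) (auto simp: keys_add_mono rows_less_def)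
qed (intro leads_indet_mult leads_indet)+

text \<open>A term off the diagonal moves the smallest row that it touches to a later column, hence to a smaller
variable.\<close>
lemma leads_alt3:
  assumes "rows_less u v" "rows_less v w" "rows_less u w" "p < q" "q < r"
  shows "leads (Poly_Mapping.keys (alt3 (\<lambda>j. indet (u j)) (\<lambda>j. indet (v j)) (\<lambda>j. indet (w j)) p q r :: 'k::comm_ring_1 mpoly))
    (monovar (u p) + (monovar (v q) + monovar (w r)))"
  unfolding alt3_def
proof (rule leads_add[OF leads_diff])
  show "grevlex_less (monovar (u q) + (monovar (v p) + monovar (w r))) (monovar (u p) + (monovar (v q) + monovar (w r)))"
    using assms by (intro grevlex_smallest[where v = "u q"]) (auto simp: keys_add_mono rows_less_def)
  show "grevlex_less (monovar (u r) + (monovar (v p) + monovar (w q))) (monovar (u p) + (monovar (v q) + monovar (w r)))"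
    using assms by (intro grevlex_smallest[where v = "u r"]) (auto simp: keys_add_mono rows_less_def)
qed (use assms in \<open>intro leads_indet_mult leads_alt2; simp\<close>)+

lemma rows_less_simps [simp]:
  "k < i \<Longrightarrow> rows_less (X i) (X k)" "k < i \<Longrightarrow> rows_less (Y i) (Y k)" "k < i \<Longrightarrow> rows_less (Z i) (Z k)"
  "rows_less (X i) (Y k)" "rows_less (X i) (Z k)" "rows_less (Y i) (Z k)"
  by (auto simp: rows_less_def)

lemma leads_a:
  assumes "p < q"
  shows "leads (Poly_Mapping.keys (a_poly p q :: 'k::comm_ring_1 mpoly)) (monovar (X 2 p) + monovar (X 1 q))"
  unfolding a_poly_eq indet_rows by (intro leads_uminus leads_alt2) (use assms in simp_all)

lemma leads_b:
  assumes "p < q"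
  shows "leads (Poly_Mapping.keys (b_poly p q :: 'k::comm_ring_1 mpoly)) (monovar (X 1 p) + monovar (Y 2 q))"
  unfolding b_poly_eq indet_rows
proof (rule leads_diff[OF leads_alt2 leads_alt2])
  show "grevlex_less (monovar (X 2 p) + monovar (Y 1 q)) (monovar (X 1 p) + monovar (Y 2 q))"
    by (intro grevlex_smallest[where v = "X 2 p"]) (auto simp: keys_add_mono)
qed (use assms in simp_all)

lemma leads_c:
  assumes "p < q"
  shows "leads (Poly_Mapping.keys (c_poly p q :: 'k::comm_ring_1 mpoly)) (monovar (Y 2 p) + monovar (Y 1 q))"
proof -
  have c: "c_poly p q = (- alt2 (yv 2) (yv 1) p q + alt2 (xv 1) (zv 2) p q - alt2 (xv 2) (zv 1) p q :: 'k mpoly)"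
    by (simp add: c_poly_eq)
  show ?thesis
    unfolding c indet_rows
  proof (rule leads_diff[OF leads_add[OF leads_uminus[OF leads_alt2] leads_alt2] leads_alt2])
    show "grevlex_less (monovar (X 1 p) + monovar (Z 2 q)) (monovar (Y 2 p) + monovar (Y 1 q))"
      by (intro grevlex_smallest[where v = "X 1 p"]) (auto simp: keys_add_mono)
    show "grevlex_less (monovar (X 2 p) + monovar (Z 1 q)) (monovar (Y 2 p) + monovar (Y 1 q))"
      by (intro grevlex_smallest[where v = "X 2 p"]) (auto simp: keys_add_mono)
  qed (use assms in simp_all)
qed

lemma leads_d:
  assumes "p < q" "q < r"
  shows "leads (Poly_Mapping.keys (d_poly p q r :: 'k::comm_ring_1 mpoly))
    (monovar (X 2 p) + (monovar (Y 1 q) + monovar (Z 2 r)))"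
  unfolding d_poly_eq indet_rows
proof (rule leads_diff[OF leads_alt3 leads_alt3])
  show "grevlex_less (monovar (X 2 p) + (monovar (Y 2 q) + monovar (Z 1 r))) (monovar (X 2 p) + (monovar (Y 1 q) + monovar (Z 2 r)))"
    unfolding grevlex_add_cancel_left by (intro grevlex_smallest[where v = "Y 2 q"]) (auto simp: keys_add_mono)
qed (use assms in simp_all)

lemma leads_e:
  assumes "p < q" "q < r"
  shows "leads (Poly_Mapping.keys (e_poly p q r :: 'k::comm_ring_1 mpoly))
    (monovar (X 1 p) + (monovar (Y 1 q) + monovar (Z 2 r)))"
  unfolding e_poly_eq indet_rows
proof (rule leads_diff[OF leads_alt3 leads_alt3])
  show "grevlex_less (monovar (X 2 p) + (monovar (Y 1 q) + monovar (Z 1 r))) (monovar (X 1 p) + (monovar (Y 1 q) + monovar (Z 2 r)))"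
    by (intro grevlex_smallest[where v = "X 2 p"]) (auto simp: keys_add_mono)
qed (use assms in simp_all)

lemma leads_f:
  assumes "p < q" "q < r"
  shows "leads (Poly_Mapping.keys (f_poly l p q r :: 'k::comm_ring_1 mpoly))
    (monovar (Y 1 l) + (monovar (X 2 p) + (monovar (Y 2 q) + monovar (Z 2 r))))"
  unfolding f_poly_eq indet_rows
proof (rule leads_diff[OF leads_add[OF leads_indet_mult leads_indet_mult] leads_indet_mult, OF leads_alt3 leads_alt3 _ leads_alt3])
  have "grevlex_less (monovar (X 2 p) + (monovar (X 2 l) + (monovar (Z 2 q) + monovar (Z 1 r))))
      (monovar (X 2 p) + (monovar (Y 1 l) + (monovar (Y 2 q) + monovar (Z 2 r))))"
    unfolding grevlex_add_cancel_left by (intro grevlex_smallest[where v = "X 2 l"]) (auto simp: keys_add_mono)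
  then show "grevlex_less (monovar (X 2 l) + (monovar (X 2 p) + (monovar (Z 2 q) + monovar (Z 1 r))))
      (monovar (Y 1 l) + (monovar (X 2 p) + (monovar (Y 2 q) + monovar (Z 2 r))))"
    by (simp only: ac_simps)
  have "grevlex_less (monovar (X 2 p) + (monovar (Y 2 q) + (monovar (Y 2 l) + monovar (Z 1 r))))
      (monovar (X 2 p) + (monovar (Y 2 q) + (monovar (Y 1 l) + monovar (Z 2 r))))"
    unfolding grevlex_add_cancel_left by (intro grevlex_smallest[where v = "Y 2 l"]) (auto simp: keys_add_mono)
  then show "grevlex_less (monovar (Y 2 l) + (monovar (X 2 p) + (monovar (Y 2 q) + monovar (Z 1 r))))
      (monovar (Y 1 l) + (monovar (X 2 p) + (monovar (Y 2 q) + monovar (Z 2 r))))"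
    by (simp only: ac_simps)
qed (use assms in simp_all)

lemma leads_g:
  assumes "l < p" "p < q" "q < r"
  shows "leads (Poly_Mapping.keys (g_poly l p q r :: 'k::comm_ring_1 mpoly))
    (monovar (X 2 l) + (monovar (Y 2 p) + (monovar (Z 2 q) + monovar (Z 1 r))))"
  unfolding g_poly_eq indet_rows
proof (rule leads_diff[OF leads_add[OF leads_diff[OF leads_indet_mult leads_indet_mult] leads_indet_mult] leads_indet_mult,
      OF leads_alt3 leads_alt3 _ leads_alt3 _ leads_alt3])
  show "grevlex_less (monovar (X 2 p) + (monovar (Y 2 l) + (monovar (Z 2 q) + monovar (Z 1 r))))
      (monovar (X 2 l) + (monovar (Y 2 p) + (monovar (Z 2 q) + monovar (Z 1 r))))"
    using assms by (intro grevlex_smallest[where v = "X 2 p"]) (auto simp: keys_add_mono)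
  show "grevlex_less (monovar (X 2 q) + (monovar (Y 2 l) + (monovar (Z 2 p) + monovar (Z 1 r))))
      (monovar (X 2 l) + (monovar (Y 2 p) + (monovar (Z 2 q) + monovar (Z 1 r))))"
    using assms by (intro grevlex_smallest[where v = "X 2 q"]) (auto simp: keys_add_mono)
  show "grevlex_less (monovar (X 2 r) + (monovar (Y 2 l) + (monovar (Z 2 p) + monovar (Z 1 q))))
      (monovar (X 2 l) + (monovar (Y 2 p) + (monovar (Z 2 q) + monovar (Z 1 r))))"
    using assms by (intro grevlex_smallest[where v = "X 2 r"]) (auto simp: keys_add_mono)
qed (use assms in simp_all)

section \<open>The jet ideal\<close>

definition eval_poly :: "(var \<Rightarrow> 'k::comm_ring_1) \<Rightarrow> 'k mpoly \<Rightarrow> 'k" where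
  "eval_poly p f = (\<Sum>k\<in>Poly_Mapping.keys f. Poly_Mapping.lookup f k * mono_eval p k)"

lemma eval_poly_superset:
  assumes "finite W" "Poly_Mapping.keys f \<subseteq> W"
  shows "eval_poly p f = (\<Sum>k\<in>W. Poly_Mapping.lookup f k * mono_eval p k)"
  unfolding eval_poly_def using assms
  by (intro sum.mono_neutral_left) (auto simp: in_keys_iff)

lemma eval_poly_add: "eval_poly p (f + g) = eval_poly p f + eval_poly p g"
proof -
  let ?W = "Poly_Mapping.keys f \<union> Poly_Mapping.keys g"
  have "eval_poly p (f + g) = (\<Sum>k\<in>?W. Poly_Mapping.lookup (f + g) k * mono_eval p k)"
    by (rule eval_poly_superset) (auto simp: Poly_Mapping.keys_add)
  then show ?thesis
    by (simp add: eval_poly_superset[of ?W] lookup_add distrib_right sum.distrib)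
qed

lemma eval_poly_zero [simp]: "eval_poly p 0 = 0"
  by (simp add: eval_poly_def)

lemma eval_poly_sum: "eval_poly p (\<Sum>i\<in>I. h i) = (\<Sum>i\<in>I. eval_poly p (h i))"
  by (induction I rule: infinite_finite_induct) (simp_all add: eval_poly_add)

lemma eval_poly_single: "eval_poly p (Poly_Mapping.single m c) = c * mono_eval p m"
  by (simp add: eval_poly_def)

lemma eval_poly_mult: "eval_poly p (f * g) = eval_poly p f * eval_poly p (g :: 'k::comm_ring_1 mpoly)"
proof -
  have "f * g = (\<Sum>k\<in>Poly_Mapping.keys f. \<Sum>m\<in>Poly_Mapping.keys g.
      Poly_Mapping.single (k + m) (Poly_Mapping.lookup f k * Poly_Mapping.lookup g m))"
    by (subst mpoly_expand[of f], subst mpoly_expand[of g]) (simp add: sum_product mult_single)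
  then have "eval_poly p (f * g) = (\<Sum>k\<in>Poly_Mapping.keys f. \<Sum>m\<in>Poly_Mapping.keys g.
      (Poly_Mapping.lookup f k * Poly_Mapping.lookup g m) * (mono_eval p k * mono_eval p m))"
    by (simp add: eval_poly_sum eval_poly_single mono_eval_add)
  then show ?thesis
    by (simp add: eval_poly_def sum_product ac_simps)
qed

lemma eval_poly_uminus: "eval_poly p (- f) = - eval_poly p f"
  by (simp add: eval_poly_def sum_negf)

lemma eval_poly_diff: "eval_poly p (f - g) = eval_poly p f - eval_poly p g"
  using eval_poly_add[of p f "- g"] by (simp add: eval_poly_uminus)

lemma eval_poly_indet [simp]: "eval_poly p (indet v) = p v"
  unfolding indet_def eval_poly_single mono_eval_single by simp

definition jet_minors :: "nat \<Rightarrow> 'k::comm_ring_1 mpoly set" where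
  "jet_minors n = {h p q |h p q. h \<in> {a_poly, b_poly, c_poly} \<and> 1 \<le> p \<and> p < q \<and> q \<le> n}"

lemma pick_pair:
  assumes "p < (q :: nat)"
  shows "pick {p, q} 0 = p" "pick {p, q} 1 = q"
proof -
  show p: "pick {p, q} 0 = p"
    using assms by (auto intro!: Least_equality)
  have "(LEAST a. a \<in> {p, q} \<and> p < a) = q"
    using assms by (intro Least_equality) auto
  then show "pick {p, q} 1 = q"
    using p by simp
qed

lemma coeff_quadratic_mult:
  fixes a0 :: "'a::comm_ring_1"
  shows "poly.coeff ([:a0, a1, a2:] * [:b0, b1, b2:]) 0 = a0 * b0"
    "poly.coeff ([:a0, a1, a2:] * [:b0, b1, b2:]) 1 = a0 * b1 + a1 * b0"
    "poly.coeff ([:a0, a1, a2:] * [:b0, b1, b2:]) 2 = a0 * b2 + a1 * b1 + a2 * b0"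
  by (simp_all add: numeral_2_eq_2)

lemma det_submatrix_Xt:
  assumes "p < q" "q < n"
  shows "det (submatrix (Xt n) {0, 1} {p, q}) =
    [:xv 1 (p + 1), yv 1 (p + 1), zv 1 (p + 1):] * [:xv 2 (q + 1), yv 2 (q + 1), zv 2 (q + 1):]
    - [:xv 1 (q + 1), yv 1 (q + 1), zv 1 (q + 1):] * [:xv 2 (p + 1), yv 2 (p + 1), zv 2 (p + 1 :: nat) :: 'k::comm_ring_1 mpoly:]"
proof -
  have rows: "{i. i < dim_row (Xt n) \<and> i \<in> {0, 1}} = {0, 1}"
    by (auto simp: Xt_def)
  have cols: "{j. j < dim_col (Xt n) \<and> j \<in> {p, q}} = {p, q}"
    using assms by (auto simp: Xt_def)
  have two: "card {0, 1 :: nat} = 2" "card {p, q} = 2"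
    using assms by auto
  have dim: "submatrix (Xt n) {0, 1} {p, q} \<in> carrier_mat 2 2"
    by (rule carrier_matI) (simp_all only: dim_submatrix rows cols two)
  have index: "submatrix (Xt n) {0, 1} {p, q} $$ (i, j) = Xt n $$ (pick {0, 1} i, pick {p, q} j)"
    if "i < 2" "j < 2" for i j
    using that by (intro submatrix_index) (simp_all only: rows cols two)
  have entry: "Xt n $$ (i, j) = [:xv (i + 1) (j + 1), yv (i + 1) (j + 1), zv (i + 1) (j + 1):]"
    if "i < 2" "j < n" for i j
    using that by (simp add: Xt_def)
  have pick01: "pick {0, 1} 0 = 0" "pick {0, 1} 1 = 1"
    by (rule pick_pair; simp)+
  have one_less_two: "(1 :: nat) < 2" by simp
  have "det (submatrix (Xt n) {0, 1} {p, q}) = Xt n $$ (0, p) * Xt n $$ (1, q) - Xt n $$ (0, q) * Xt n $$ (1, p)"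
    unfolding det_carrier_2[OF dim] index[OF pos2 pos2] index[OF pos2 one_less_two]
      index[OF one_less_two pos2]
      index[OF one_less_two one_less_two]
      pick_pair[OF assms(1)] pick01 ..
  then show ?thesis
    using assms by (simp add: entry numeral_2_eq_2 del: mult_pCons_left mult_pCons_right)
qed

lemma coeff_det_Xt:
  assumes "p < q" "q < n"
  shows "poly.coeff (det (submatrix (Xt n) {0, 1} {p, q})) 0 = (a_poly (p + 1) (q + 1) :: 'k::comm_ring_1 mpoly)"
    "poly.coeff (det (submatrix (Xt n) {0, 1} {p, q})) 1 = (b_poly (p + 1) (q + 1) :: 'k::comm_ring_1 mpoly)"
    "poly.coeff (det (submatrix (Xt n) {0, 1} {p, q})) 2 = (c_poly (p + 1) (q + 1) :: 'k::comm_ring_1 mpoly)"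
  unfolding det_submatrix_Xt[OF assms] coeff_diff coeff_quadratic_mult a_poly_eq b_poly_eq c_poly_eq alt2_def
  by (simp_all add: algebra_simps)

lemma minors_Xt:
  "minors 2 (Xt n :: 'k::comm_ring_1 mpoly poly mat) = {det (submatrix (Xt n) {0, 1} {p, q}) |p q. p < q \<and> q < n}"
proof (intro equalityI subsetI)
  fix F :: "'k mpoly poly" assume "F \<in> minors 2 (Xt n)"
  then obtain I J where F: "F = det (submatrix (Xt n) I J)" and I: "I \<subseteq> {..<2}" "card I = 2"
    and J: "J \<subseteq> {..<n}" "card J = 2"
    unfolding minors_def by (auto simp: Xt_def)
  have "I = {..<2}"
    using I by (intro card_subset_eq) auto
  then have "I = {0, 1}" by auto
  moreover obtain p q where pq: "J = {p, q}" "p \<noteq> q"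
    using J(2) by (auto simp: card_2_iff)
  then have "J = {min p q, max p q}" "min p q < max p q" "max p q < n"
    using J(1) by (auto simp: min_def max_def)
  ultimately have "F = det (submatrix (Xt n) {0, 1} {min p q, max p q})"
    using F by simp
  then show "F \<in> {det (submatrix (Xt n) {0, 1} {p, q}) |p q. p < q \<and> q < n}"
    using \<open>min p q < max p q\<close> \<open>max p q < n\<close> by blast
next
  fix F :: "'k mpoly poly" assume "F \<in> {det (submatrix (Xt n) {0, 1} {p, q}) |p q. p < q \<and> q < n}"
  then obtain p q where "F = det (submatrix (Xt n) {0, 1} {p, q})" "p < q" "q < n" by blast
  then show "F \<in> minors 2 (Xt n)"
    unfolding minors_def by (intro CollectI exI[of _ "{0, 1}"] exI[of _ "{p, q}"]) (auto simp: Xt_def)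
qed

lemma jet_ideal_minors: "jet_ideal n = Idl\<^bsub>poly_ring n\<^esub> (jet_minors n :: 'k::comm_ring_1 mpoly set)"
proof -
  have "{poly.coeff F l |F l. F \<in> minors 2 (Xt n) \<and> l \<in> {0, 1, 2}} = (jet_minors n :: 'k mpoly set)"
  proof (intro equalityI subsetI)
    fix x :: "'k mpoly" assume "x \<in> {poly.coeff F l |F l. F \<in> minors 2 (Xt n) \<and> l \<in> {0, 1, 2}}"
    then obtain l p q where x: "x = poly.coeff (det (submatrix (Xt n) {0, 1} {p, q})) l" and pq: "p < q" "q < n"
      and l: "l = 0 \<or> l = 1 \<or> l = 2"
      unfolding minors_Xt by blast
    have "x \<in> {a_poly (p + 1) (q + 1), b_poly (p + 1) (q + 1), c_poly (p + 1) (q + 1)}"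
      using l unfolding x by (elim disjE) (simp_all only: coeff_det_Xt[OF pq] insert_iff simp_thms)
    moreover have "1 \<le> p + 1" "p + 1 < q + 1" "q + 1 \<le> n" using pq by auto
    ultimately show "x \<in> jet_minors n"
      unfolding jet_minors_def by blast
  next
    fix x :: "'k mpoly" assume "x \<in> jet_minors n"
    then obtain h p q where h: "x = h p q" "h \<in> {a_poly, b_poly, c_poly}" and pq: "1 \<le> p" "p < q" "q \<le> n"
      unfolding jet_minors_def by blast
    define p' q' where "p' = p - 1" and "q' = q - 1"
    have pq': "p = p' + 1" "q = q' + 1" "p' < q'" "q' < n"
      using pq by (auto simp: p'_def q'_def)
    let ?F = "det (submatrix (Xt n) {0, 1} {p', q'}) :: 'k mpoly poly"
    have "?F \<in> minors 2 (Xt n)"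
      unfolding minors_Xt using pq' by blast
    moreover have "x = poly.coeff ?F 0 \<or> x = poly.coeff ?F 1 \<or> x = poly.coeff ?F 2"
      using h unfolding coeff_det_Xt[OF pq'(3,4)] pq'(1,2) by blast
    ultimately show "x \<in> {poly.coeff F l |F l. F \<in> minors 2 (Xt n) \<and> l \<in> {0, 1, 2}}"
      by blast
  qed
  then show ?thesis
    by (simp add: jet_ideal_def)
qed

lemma indet_carrier: "v \<in> vars n \<Longrightarrow> indet v \<in> carrier (poly_ring n)"
  by (simp add: carrier_poly_ring indet_def)

lemma diff_closed_poly_ring:
  assumes "p \<in> carrier (poly_ring n)" "q \<in> carrier (poly_ring n)"
  shows "p - q \<in> carrier (poly_ring n)"
  using plus_closed_poly_ring[OF assms(1), of "- q"] assms(2) by (simp add: carrier_poly_ring)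

lemmas carrier_intros = plus_closed_poly_ring times_closed_poly_ring diff_closed_poly_ring indet_carrier

lemma uminus_carrier: "p \<in> carrier (poly_ring n) \<Longrightarrow> - p \<in> carrier (poly_ring n)"
  by (simp add: carrier_poly_ring)

lemma jet_minors_carrier: "jet_minors n \<subseteq> carrier (poly_ring n :: 'k::comm_ring_1 mpoly ring)"
proof
  fix x :: "'k mpoly" assume "x \<in> jet_minors n"
  then obtain h p q where "x = h p q" "h \<in> {a_poly, b_poly, c_poly}" "1 \<le> p" "p < q" "q \<le> n"
    unfolding jet_minors_def by blast
  then show "x \<in> carrier (poly_ring n)"
    by (auto simp: a_poly_eq b_poly_eq c_poly_eq alt2_def indet_rows intro!: carrier_intros uminus_carrier)
qed

lemma ideal_jet_ideal: "ideal (jet_ideal n) (poly_ring n :: 'k::comm_ring_1 mpoly ring)"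
proof -
  interpret cring "poly_ring n :: 'k mpoly ring" by (rule cring_poly_ring)
  show ?thesis
    unfolding jet_ideal_minors by (rule genideal_ideal[OF jet_minors_carrier])
qed

lemma ideal_poly_ringD:
  assumes "ideal I (poly_ring n :: 'k::comm_ring_1 mpoly ring)"
  shows "x \<in> I \<Longrightarrow> y \<in> I \<Longrightarrow> x + y \<in> I"
    and "x \<in> I \<Longrightarrow> r \<in> carrier (poly_ring n) \<Longrightarrow> r * x \<in> I"
    and "x \<in> I \<Longrightarrow> r \<in> carrier (poly_ring n) \<Longrightarrow> x * r \<in> I"
    and "x \<in> I \<Longrightarrow> - x \<in> I"
    and "x \<in> I \<Longrightarrow> y \<in> I \<Longrightarrow> x - y \<in> I"
    and "0 \<in> I"
proof -
  interpret ideal I "poly_ring n :: 'k mpoly ring" by (rule assms)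
  show add: "x + y \<in> I" if "x \<in> I" "y \<in> I" for x y
    using additive_subgroup.a_closed[OF is_additive_subgroup that] by (simp add: poly_ring_simps)
  show l: "r * x \<in> I" if "x \<in> I" "r \<in> carrier (poly_ring n)" for x r
    using I_l_closed[OF that] by (simp add: poly_ring_simps)
  show "x * r \<in> I" if "x \<in> I" "r \<in> carrier (poly_ring n)"
    using l[OF that] by (simp add: mult.commute)
  have "(- 1 :: 'k mpoly) \<in> carrier (poly_ring n)"
    by (simp add: carrier_poly_ring)
  from l[OF _ this] show neg: "- x \<in> I" if "x \<in> I" for x
    using that by fastforce
  show "x - y \<in> I" if "x \<in> I" "y \<in> I"
    using add[OF that(1) neg[OF that(2)]] by simp
  show "0 \<in> I"
    using additive_subgroup.zero_closed[OF is_additive_subgroup] by (simp add: poly_ring_simps)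
qed

text \<open>In $f_{l,p,q,r}$ the index \<open>l\<close> may coincide with \<open>p\<close>, so $c_{l,p}$ is needed for arbitrary pairs of
columns; it is alternating.\<close>
lemma Gamma_subset_jet_ideal: "Gamma_set n \<subseteq> (jet_ideal n :: 'k::comm_ring_1 mpoly set)"
proof -
  let ?I = "jet_ideal n :: 'k mpoly set"
  interpret cring "poly_ring n :: 'k mpoly ring" by (rule cring_poly_ring)
  note I = ideal_poly_ringD[OF ideal_jet_ideal]
  have gen: "jet_minors n \<subseteq> ?I"
    unfolding jet_ideal_minors by (rule genideal_self[OF jet_minors_carrier])
  have a: "a_poly p q \<in> ?I" and b: "b_poly p q \<in> ?I" and c0: "c_poly p q \<in> ?I"
    if "1 \<le> p" "p < q" "q \<le> n" for p q
    using gen that unfolding jet_minors_def by blast+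
  have c: "c_poly p q \<in> ?I" if "1 \<le> p" "p \<le> n" "1 \<le> q" "q \<le> n" for p q
  proof (cases p q rule: linorder_cases)
    case less
    then show ?thesis using c0 that by simp
  next
    case equal
    then show ?thesis using I(6) by (simp add: c_poly_eq alt2_def)
  next
    case greater
    have "c_poly p q = (- c_poly q p :: 'k mpoly)"
      by (simp add: c_poly_eq alt2_def)
    then show ?thesis using I(4) c0[of q p] greater that by simp
  qed
  have d: "d_poly p q r \<in> ?I" if "1 \<le> p" "p < q" "q < r" "r \<le> n" for p q r
    unfolding d_poly_combination indet_rows using that
    by (intro I(1,3,4,5) b c carrier_intros) auto
  have e: "e_poly p q r \<in> ?I" if "1 \<le> p" "p < q" "q < r" "r \<le> n" for p q r
    unfolding e_poly_combination indet_rows using that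
    by (intro I(1,3,4,5) b c carrier_intros) auto
  have f: "f_poly l p q r \<in> ?I" if "1 \<le> l" "l \<le> p" "p < q" "q < r" "r \<le> n" for l p q r
    unfolding f_poly_combination indet_rows alt2_def using that
    by (intro I(1,3,4,5) a c d carrier_intros) auto
  have g: "g_poly l p q r \<in> ?I" if "1 \<le> l" "l < p" "p < q" "q < r" "r \<le> n" for l p q r
    unfolding g_poly_combination indet_rows using that
    by (intro I(1,3,4,5) d carrier_intros) auto
  show ?thesis
    unfolding Gamma_set_def using a b c0 d e f g by auto
qed

lemma eval_poly_alt2 [simp]:
  "eval_poly x (alt2 (\<lambda>j. indet (u j)) (\<lambda>j. indet (v j)) p q) = x (u p) * x (v q) - x (u q) * x (v p)"
  by (simp add: alt2_def eval_poly_diff eval_poly_mult)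

lemma jet_minors_vanish:
  fixes f :: "'k::field mpoly"
  assumes "f \<in> jet_minors n" "x \<in> regular_stratum s"
  shows "eval_poly x f = 0"
proof -
  obtain a b c d e f' l0 l1 l2 where x: "x = point a b c d e f'" "\<And>j. a j = l0 * b j"
    "\<And>j. c j = l0 * d j + l1 * b j" "\<And>j. e j = l0 * f' j + l1 * d j + l2 * b j"
    using assms(2) unfolding regular_stratum_def by blast
  obtain p q where "f = a_poly p q \<or> f = b_poly p q \<or> f = c_poly p q"
    using assms(1) unfolding jet_minors_def by blast
  then show ?thesis
    unfolding a_poly_eq b_poly_eq c_poly_eq indet_rows
    by (elim disjE) (simp_all only: eval_poly_diff eval_poly_uminus eval_poly_alt2 x point.simps, simp_all add: algebra_simps)
qed

lemma ideal_vanishing: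
  "ideal {f \<in> carrier (poly_ring n). \<forall>x\<in>V. eval_poly x f = 0} (poly_ring n :: 'k::comm_ring_1 mpoly ring)"
proof -
  interpret cring "poly_ring n :: 'k mpoly ring" by (rule cring_poly_ring)
  let ?K = "{f \<in> carrier (poly_ring n). \<forall>x\<in>V. eval_poly x f = 0} :: 'k mpoly set"
  have neg: "\<ominus>\<^bsub>poly_ring n\<^esub> f = - f" if "f \<in> carrier (poly_ring n)" for f :: "'k mpoly"
    using that uminus_carrier[OF that] by (intro minus_equality) (simp_all add: poly_ring_simps)
  show ?thesis
  proof (rule idealI[OF ring_axioms])
    show "subgroup ?K (add_monoid (poly_ring n))"
    proof (rule subgroup.intro)
      show "?K \<subseteq> carrier (add_monoid (poly_ring n))" by auto
      show "f \<otimes>\<^bsub>add_monoid (poly_ring n)\<^esub> g \<in> ?K" if "f \<in> ?K" "g \<in> ?K" for f g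
        using that by (auto simp: poly_ring_simps eval_poly_add plus_closed_poly_ring)
      show "\<one>\<^bsub>add_monoid (poly_ring n)\<^esub> \<in> ?K"
        by (simp add: poly_ring_simps carrier_poly_ring)
      show "inv\<^bsub>add_monoid (poly_ring n)\<^esub> f \<in> ?K" if "f \<in> ?K" for f
        using that neg[of f] uminus_carrier[of f n] by (simp add: a_inv_def eval_poly_uminus)
    qed
    show "g \<otimes>\<^bsub>poly_ring n\<^esub> f \<in> ?K" "f \<otimes>\<^bsub>poly_ring n\<^esub> g \<in> ?K"
      if "f \<in> ?K" "g \<in> carrier (poly_ring n)" for f g
      using that by (auto simp: poly_ring_simps eval_poly_mult times_closed_poly_ring)
  qed
qed

lemma jet_ideal_vanishes:
  fixes f :: "'k::field mpoly"
  assumes "f \<in> jet_ideal n"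
  shows "f \<in> carrier (poly_ring n)" and "x \<in> regular_stratum s \<Longrightarrow> eval_poly x f = 0"
proof -
  interpret cring "poly_ring n :: 'k mpoly ring" by (rule cring_poly_ring)
  have "jet_ideal n \<subseteq> {f \<in> carrier (poly_ring n). \<forall>x\<in>regular_stratum s. eval_poly x (f :: 'k mpoly) = 0}"
    unfolding jet_ideal_minors using jet_minors_carrier jet_minors_vanish
    by (intro genideal_minimal ideal_vanishing) blast
  then show "f \<in> carrier (poly_ring n)" and "x \<in> regular_stratum s \<Longrightarrow> eval_poly x f = 0"
    using assms by blast+
qed

section \<open>The initial ideal\<close>

lemma regular_stratum_scale:
  assumes "x \<in> regular_stratum s" "t \<noteq> 0"
  shows "(\<lambda>v. t * x v) \<in> regular_stratum s"
proof -
  obtain a b c d e f l0 l1 l2 where x: "x = point a b c d e f" "b s \<noteq> 0" "\<And>j. j > s \<Longrightarrow> b j = 0"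
    "\<And>j. a j = l0 * b j" "\<And>j. c j = l0 * d j + l1 * b j" "\<And>j. e j = l0 * f j + l1 * d j + l2 * b j"
    using assms(1) unfolding regular_stratum_def by blast
  have "(\<lambda>v. t * x v) = point (\<lambda>j. t * a j) (\<lambda>j. t * b j) (\<lambda>j. t * c j) (\<lambda>j. t * d j) (\<lambda>j. t * e j) (\<lambda>j. t * f j)"
  proof
    show "t * x v = point (\<lambda>j. t * a j) (\<lambda>j. t * b j) (\<lambda>j. t * c j) (\<lambda>j. t * d j) (\<lambda>j. t * e j) (\<lambda>j. t * f j) v" for v
      by (cases v) (auto simp: x(1))
  qed
  also have "\<dots> \<in> regular_stratum s"
    by (rule regular_stratumI[of _ _ _ l0 _ _ l1 _ _ l2]) (use assms(2) x(2-) in \<open>auto simp: algebra_simps\<close>)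
  finally show ?thesis .
qed

text \<open>On the line through a point of the cone, \<open>f\<close> is a polynomial in the scaling factor, and the part of
degree \<open>d\<close> is its coefficient of degree \<open>d\<close>.\<close>
lemma homogeneous_part_vanishes:
  fixes f :: "'k::field_char_0 mpoly"
  assumes scale: "\<And>x t. x \<in> V \<Longrightarrow> t \<noteq> 0 \<Longrightarrow> (\<lambda>v. t * x v) \<in> V" and f: "\<And>x. x \<in> V \<Longrightarrow> eval_poly x f = 0"
  shows "vanishes {k \<in> Poly_Mapping.keys f. mono_deg k = d} (Poly_Mapping.lookup f) V"
  unfolding vanishes_def
proof
  fix x assume x: "x \<in> V"
  let ?c = "\<lambda>k. Poly_Mapping.lookup f k * mono_eval x k"
  define q where "q = (\<Sum>k\<in>Poly_Mapping.keys f. monom (?c k) (mono_deg k))"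
  have "poly q t = 0" if "t \<noteq> 0" for t
    using f[OF scale[OF x that]]
    by (simp add: q_def poly_sum poly_monom eval_poly_def mono_eval_scale ac_simps)
  then have "- {0} \<subseteq> {t. poly q t = 0}" by auto
  moreover have "infinite (- {0 :: 'k})"
    by (simp add: Compl_eq_Diff_UNIV infinite_UNIV_char_0)
  ultimately have "q = 0"
    using poly_roots_finite[of q] infinite_super by blast
  then have "0 = poly.coeff q d" by simp
  also have "\<dots> = (\<Sum>k\<in>Poly_Mapping.keys f. if mono_deg k = d then ?c k else 0)"
    by (simp add: q_def coeff_sum)
  also have "\<dots> = (\<Sum>k\<in>{k \<in> Poly_Mapping.keys f. mono_deg k = d}. ?c k)"
    by (simp add: sum.inter_filter)
  finally show "(\<Sum>k\<in>{k \<in> Poly_Mapping.keys f. mono_deg k = d}. ?c k) = 0" by simp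
qed

text \<open>No leading monomial of $\Gamma$ contains the smallest variable \<open>X 2 n\<close>, which is why adjoining it
does no harm.\<close>
lemma regular_good_standard:
  assumes "standard U" "U \<subseteq> vars n"
  shows "regular_good n U"
proof -
  note D = standardD[OF assms(1)]
  have le: "j \<le> n" if "X i j \<in> U \<or> Y i j \<in> U \<or> Z i j \<in> U" for i j
    using subset_varsD(2)[OF assms(2) that] .
  have "standard (insert (X 2 n) U)"
  proof (rule standardI, goal_cases)
    case (1 p q)
    then show ?case using D(1)[of p q] le[of 1 q] by auto
  next
    case (2 p q)
    then show ?case using D(2)[of p q] by auto
  next
    case (3 p q)
    then show ?case using D(3)[of p q] by auto
  next
    case (4 p q r)
    then show ?case using D(4)[of p q r] le[of 1 q] by auto
  next
    case (5 p q r)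
    then show ?case using D(5)[of p q r] by auto
  next
    case (6 l p q r)
    then show ?case using D(6)[of l p q r] le[of 2 q] by auto
  next
    case (7 l p q r)
    then show ?case using D(7)[of l p q r] le[of 2 p] by auto
  qed
  then show ?thesis
    using le by (auto simp: regular_good_def)
qed

lemma lead_not_standard:
  fixes f :: "'k::field_char_0 mpoly"
  assumes "1 \<le> n" "f \<in> jet_ideal n" "f \<noteq> 0"
  shows "\<not> standard (Poly_Mapping.keys (lead_mono f))" and "Poly_Mapping.keys (lead_mono f) \<subseteq> vars n"
proof -
  define m where "m = lead_mono f"
  have lead: "leads (Poly_Mapping.keys f) m"
    unfolding m_def by (rule leads_lead_mono[OF assms(3)])
  have vars: "Poly_Mapping.keys k \<subseteq> vars n" if "k \<in> Poly_Mapping.keys f" for k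
    using jet_ideal_vanishes(1)[OF assms(2)] that by (simp add: carrier_poly_ring)
  let ?S = "{k \<in> Poly_Mapping.keys f. mono_deg k = mono_deg m}"
  have "leads ?S m"
    using lead by (auto simp: leads_def)
  moreover have "vanishes ?S (Poly_Mapping.lookup f) (regular_stratum n)"
    by (rule homogeneous_part_vanishes) (auto intro: regular_stratum_scale jet_ideal_vanishes(2)[OF assms(2)])
  ultimately have "\<not> regular_good n (Poly_Mapping.keys m)"
    using vars by (intro excludesD[OF excludes_regular[OF assms(1)], of ?S n]) (auto simp: in_keys_iff)
  moreover have "Poly_Mapping.keys m \<subseteq> vars n"
    using lead vars by (simp add: leads_def)
  ultimately show "\<not> standard (Poly_Mapping.keys (lead_mono f))" "Poly_Mapping.keys (lead_mono f) \<subseteq> vars n"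
    using regular_good_standard unfolding m_def by blast+
qed

lemma monovar_add_divides:
  assumes "v \<in> Poly_Mapping.keys m" "v \<notin> Poly_Mapping.keys l" "\<exists>t. m = l + t"
  shows "\<exists>t. m = monovar v + l + (t :: mono)"
proof -
  obtain t where t: "m = l + t" using assms(3) by blast
  then have "v \<in> Poly_Mapping.keys t"
    using assms(1,2) by (simp add: keys_add_mono)
  from minus_single_add[OF this] have "m = monovar v + l + (t - monovar v)"
    unfolding t by (metis add.assoc add.commute)
  then show ?thesis by blast
qed

lemma squarefree_divides:
  "v \<in> Poly_Mapping.keys m \<Longrightarrow> \<exists>t. m = monovar v + (t :: mono)"
  using monovar_add_divides[of v m 0] by simp

lemma lead_monos_carrier:
  assumes "G \<subseteq> carrier (poly_ring n :: 'k::comm_ring_1 mpoly ring)"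
  shows "lead_monos G \<subseteq> carrier (poly_ring n)"
proof
  fix x assume "x \<in> lead_monos G"
  then obtain h where h: "x = Poly_Mapping.single (lead_mono h) 1" "h \<in> G" "h \<noteq> 0"
    unfolding lead_monos_def by blast
  have "lead_mono h \<in> Poly_Mapping.keys h"
    using leads_lead_mono[OF h(3)] by (simp add: leads_def)
  moreover have "h \<in> carrier (poly_ring n)"
    using assms h(2) by blast
  ultimately have "Poly_Mapping.keys (lead_mono h) \<subseteq> vars n"
    unfolding carrier_poly_ring by blast
  then show "x \<in> carrier (poly_ring n)"
    by (simp add: carrier_poly_ring h(1))
qed

lemma multiple_in_Idl:
  fixes g :: "'k::comm_ring_1 mpoly"
  assumes "G \<subseteq> carrier (poly_ring n)" "g \<in> G" "leads (Poly_Mapping.keys g) l"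
    "Poly_Mapping.keys m \<subseteq> vars n" "\<exists>t. m = l + t"
  shows "Poly_Mapping.single m 1 \<in> Idl\<^bsub>poly_ring n\<^esub> (lead_monos G)"
proof -
  interpret cring "poly_ring n :: 'k mpoly ring" by (rule cring_poly_ring)
  obtain t where t: "m = l + t" using assms(5) by blast
  have "g \<noteq> 0"
    using assms(3) by (auto simp: leads_def)
  then have "Poly_Mapping.single l 1 \<in> lead_monos G"
    using assms(2) lead_mono_eqI[OF assms(3)] unfolding lead_monos_def by blast
  moreover have "lead_monos G \<subseteq> carrier (poly_ring n)"
    by (rule lead_monos_carrier[OF assms(1)])
  ultimately have "Poly_Mapping.single l 1 \<in> Idl\<^bsub>poly_ring n\<^esub> (lead_monos G)" "ideal (Idl\<^bsub>poly_ring n\<^esub> (lead_monos G)) (poly_ring n)"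
    using genideal_self genideal_ideal by blast+
  moreover have "Poly_Mapping.single t (1 :: 'k) \<in> carrier (poly_ring n)"
    using assms(4) by (simp add: carrier_poly_ring t keys_add_mono)
  ultimately have "Poly_Mapping.single l 1 * Poly_Mapping.single t 1 \<in> Idl\<^bsub>poly_ring n\<^esub> (lead_monos G)"
    by (intro ideal_poly_ringD(3))
  then show ?thesis
    by (simp add: mult_single t)
qed

lemma finite_family_2:
  "(\<And>p q. Q p q \<Longrightarrow> p \<le> n \<and> q \<le> (n :: nat)) \<Longrightarrow> finite {h p q |p q. Q p q}"
  by (rule finite_subset[of _ "(\<lambda>(p, q). h p q) ` ({..n} \<times> {..n})"]) (force, simp)

lemma finite_family_3:
  "(\<And>p q r. Q p q r \<Longrightarrow> p \<le> n \<and> q \<le> n \<and> r \<le> (n :: nat)) \<Longrightarrow> finite {h p q r |p q r. Q p q r}"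
  by (rule finite_subset[of _ "(\<lambda>(p, q, r). h p q r) ` ({..n} \<times> {..n} \<times> {..n})"]) (force, simp)

lemma finite_family_4:
  "(\<And>l p q r. Q l p q r \<Longrightarrow> l \<le> n \<and> p \<le> n \<and> q \<le> n \<and> r \<le> (n :: nat)) \<Longrightarrow> finite {h l p q r |l p q r. Q l p q r}"
  by (rule finite_subset[of _ "(\<lambda>(l, p, q, r). h l p q r) ` ({..n} \<times> {..n} \<times> {..n} \<times> {..n})"]) (force, simp)

lemma finite_Gamma: "finite (Gamma_set n)"
  unfolding Gamma_set_def
  by (intro finite_UnI finite_family_2[where n = n] finite_family_3[where n = n] finite_family_4[where n = n]) auto

lemma Gamma_setI:
  "1 \<le> p \<Longrightarrow> p < q \<Longrightarrow> q \<le> n \<Longrightarrow> a_poly p q \<in> Gamma_set n"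
  "1 \<le> p \<Longrightarrow> p < q \<Longrightarrow> q \<le> n \<Longrightarrow> b_poly p q \<in> Gamma_set n"
  "1 \<le> p \<Longrightarrow> p < q \<Longrightarrow> q \<le> n \<Longrightarrow> c_poly p q \<in> Gamma_set n"
  "1 \<le> p \<Longrightarrow> p < q \<Longrightarrow> q < r \<Longrightarrow> r \<le> n \<Longrightarrow> d_poly p q r \<in> Gamma_set n"
  "1 \<le> p \<Longrightarrow> p < q \<Longrightarrow> q < r \<Longrightarrow> r \<le> n \<Longrightarrow> e_poly p q r \<in> Gamma_set n"
  "1 \<le> l \<Longrightarrow> l \<le> p \<Longrightarrow> p < q \<Longrightarrow> q < r \<Longrightarrow> r \<le> n \<Longrightarrow> f_poly l p q r \<in> Gamma_set n"
  "1 \<le> l \<Longrightarrow> l < p \<Longrightarrow> p < q \<Longrightarrow> q < r \<Longrightarrow> r \<le> n \<Longrightarrow> g_poly l p q r \<in> Gamma_set n"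
  unfolding Gamma_set_def by blast+

lemma nonstandard_in_Idl:
  assumes "\<not> standard (Poly_Mapping.keys m)" "Poly_Mapping.keys m \<subseteq> vars n"
  shows "Poly_Mapping.single m 1 \<in> Idl\<^bsub>poly_ring n\<^esub> (lead_monos (Gamma_set n :: 'k::field mpoly set))"
proof (rule ccontr)
  assume notin: "Poly_Mapping.single m 1 \<notin> Idl\<^bsub>poly_ring n\<^esub> (lead_monos (Gamma_set n :: 'k mpoly set))"
  have "Gamma_set n \<subseteq> carrier (poly_ring n :: 'k mpoly ring)"
    using Gamma_subset_jet_ideal jet_ideal_vanishes(1) by blast
  from multiple_in_Idl[OF this _ _ assms(2)] notin
  have no: "\<nexists>t. m = l + t" if "g \<in> Gamma_set n" "leads (Poly_Mapping.keys (g :: 'k mpoly)) l" for g l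
    using that by blast
  note dvd = monovar_add_divides squarefree_divides
  have lo: "1 \<le> j" and hi: "j \<le> n"
    if "X i j \<in> Poly_Mapping.keys m \<or> Y i j \<in> Poly_Mapping.keys m \<or> Z i j \<in> Poly_Mapping.keys m" for i j
    using subset_varsD(1,2)[OF assms(2) that] .
  have "standard (Poly_Mapping.keys m)"
  proof (rule standardI; rule ccontr)
    fix p q assume v: "X 2 p \<in> Poly_Mapping.keys m" "X 1 q \<in> Poly_Mapping.keys m" and "\<not> q \<le> p"
    then have o: "p < q" by auto
    have "a_poly p q \<in> (Gamma_set n :: 'k mpoly set)"
      using o lo[of 2 p] hi[of 1 q] v by (intro Gamma_setI) auto
    then have "\<nexists>t. m = monovar (X 2 p) + (monovar (X 1 q)) + t"
      by (rule no[OF _ leads_a]) (use o in auto)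
    moreover have "\<exists>t. m = monovar (X 2 p) + (monovar (X 1 q)) + t"
      by (intro dvd v) (use o in \<open>auto simp: keys_add_mono\<close>)
    ultimately show False by simp
  next
    fix p q assume v: "X 1 p \<in> Poly_Mapping.keys m" "Y 2 q \<in> Poly_Mapping.keys m" and "\<not> q \<le> p"
    then have o: "p < q" by auto
    have "b_poly p q \<in> (Gamma_set n :: 'k mpoly set)"
      using o lo[of 1 p] hi[of 2 q] v by (intro Gamma_setI) auto
    then have "\<nexists>t. m = monovar (X 1 p) + (monovar (Y 2 q)) + t"
      by (rule no[OF _ leads_b]) (use o in auto)
    moreover have "\<exists>t. m = monovar (X 1 p) + (monovar (Y 2 q)) + t"
      by (intro dvd v) (use o in \<open>auto simp: keys_add_mono\<close>)
    ultimately show False by simp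
  next
    fix p q assume v: "Y 2 p \<in> Poly_Mapping.keys m" "Y 1 q \<in> Poly_Mapping.keys m" and "\<not> q \<le> p"
    then have o: "p < q" by auto
    have "c_poly p q \<in> (Gamma_set n :: 'k mpoly set)"
      using o lo[of 2 p] hi[of 1 q] v by (intro Gamma_setI) auto
    then have "\<nexists>t. m = monovar (Y 2 p) + (monovar (Y 1 q)) + t"
      by (rule no[OF _ leads_c]) (use o in auto)
    moreover have "\<exists>t. m = monovar (Y 2 p) + (monovar (Y 1 q)) + t"
      by (intro dvd v) (use o in \<open>auto simp: keys_add_mono\<close>)
    ultimately show False by simp
  next
    fix p q r assume v: "X 2 p \<in> Poly_Mapping.keys m" "Y 1 q \<in> Poly_Mapping.keys m" "Z 2 r \<in> Poly_Mapping.keys m" and "p < q" and "\<not> r \<le> q"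
    then have o: "p < q" "q < r" by auto
    have "d_poly p q r \<in> (Gamma_set n :: 'k mpoly set)"
      using o lo[of 2 p] hi[of 2 r] v by (intro Gamma_setI) auto
    then have "\<nexists>t. m = monovar (X 2 p) + (monovar (Y 1 q) + (monovar (Z 2 r))) + t"
      by (rule no[OF _ leads_d]) (use o in auto)
    moreover have "\<exists>t. m = monovar (X 2 p) + (monovar (Y 1 q) + (monovar (Z 2 r))) + t"
      by (intro dvd v) (use o in \<open>auto simp: keys_add_mono\<close>)
    ultimately show False by simp
  next
    fix p q r assume v: "X 1 p \<in> Poly_Mapping.keys m" "Y 1 q \<in> Poly_Mapping.keys m" "Z 2 r \<in> Poly_Mapping.keys m" and "p < q" and "\<not> r \<le> q"
    then have o: "p < q" "q < r" by auto
    have "e_poly p q r \<in> (Gamma_set n :: 'k mpoly set)"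
      using o lo[of 1 p] hi[of 2 r] v by (intro Gamma_setI) auto
    then have "\<nexists>t. m = monovar (X 1 p) + (monovar (Y 1 q) + (monovar (Z 2 r))) + t"
      by (rule no[OF _ leads_e]) (use o in auto)
    moreover have "\<exists>t. m = monovar (X 1 p) + (monovar (Y 1 q) + (monovar (Z 2 r))) + t"
      by (intro dvd v) (use o in \<open>auto simp: keys_add_mono\<close>)
    ultimately show False by simp
  next
    fix l p q r assume v: "Y 1 l \<in> Poly_Mapping.keys m" "X 2 p \<in> Poly_Mapping.keys m" "Y 2 q \<in> Poly_Mapping.keys m" "Z 2 r \<in> Poly_Mapping.keys m" and "l \<le> p" "p < q" and "\<not> r \<le> q"
    then have o: "l \<le> p" "p < q" "q < r" by auto
    have "f_poly l p q r \<in> (Gamma_set n :: 'k mpoly set)"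
      using o lo[of 1 l] hi[of 2 r] v by (intro Gamma_setI) auto
    then have "\<nexists>t. m = monovar (Y 1 l) + (monovar (X 2 p) + (monovar (Y 2 q) + (monovar (Z 2 r)))) + t"
      by (rule no[OF _ leads_f]) (use o in auto)
    moreover have "\<exists>t. m = monovar (Y 1 l) + (monovar (X 2 p) + (monovar (Y 2 q) + (monovar (Z 2 r)))) + t"
      by (intro dvd v) (use o in \<open>auto simp: keys_add_mono\<close>)
    ultimately show False by simp
  next
    fix l p q r assume v: "X 2 l \<in> Poly_Mapping.keys m" "Y 2 p \<in> Poly_Mapping.keys m" "Z 2 q \<in> Poly_Mapping.keys m" "Z 1 r \<in> Poly_Mapping.keys m" and "l < p" "p < q" and "\<not> r \<le> q"
    then have o: "l < p" "p < q" "q < r" by auto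
    have "g_poly l p q r \<in> (Gamma_set n :: 'k mpoly set)"
      using o lo[of 2 l] hi[of 1 r] v by (intro Gamma_setI) auto
    then have "\<nexists>t. m = monovar (X 2 l) + (monovar (Y 2 p) + (monovar (Z 2 q) + (monovar (Z 1 r)))) + t"
      by (rule no[OF _ leads_g]) (use o in auto)
    moreover have "\<exists>t. m = monovar (X 2 l) + (monovar (Y 2 p) + (monovar (Z 2 q) + (monovar (Z 1 r)))) + t"
      by (intro dvd v) (use o in \<open>auto simp: keys_add_mono\<close>)
    ultimately show False by simp
  qed
  then show False using assms(1) by simp
qed

theorem mainTheorem2:
  fixes n :: nat
  assumes "n \<ge> 2"
  shows "is_groebner_basis n
           (Gamma_set n :: 'k::{alg_closed_field, field_char_0} mpoly set) (jet_ideal n)"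
proof -
  let ?I = "jet_ideal n :: 'k mpoly set" and ?G = "Gamma_set n :: 'k mpoly set"
  interpret cring "poly_ring n :: 'k mpoly ring" by (rule cring_poly_ring)
  have I: "?I \<subseteq> carrier (poly_ring n)"
    using jet_ideal_vanishes(1) by blast
  have G: "?G \<subseteq> ?I"
    by (rule Gamma_subset_jet_ideal)
  have "lead_monos ?G \<subseteq> lead_monos ?I"
    using G unfolding lead_monos_def by blast
  then have "Idl\<^bsub>poly_ring n\<^esub> (lead_monos ?G) \<subseteq> Idl\<^bsub>poly_ring n\<^esub> (lead_monos ?I)"
    by (rule subset_Idl_subset[OF lead_monos_carrier[OF I]])
  moreover have "Idl\<^bsub>poly_ring n\<^esub> (lead_monos ?I) \<subseteq> Idl\<^bsub>poly_ring n\<^esub> (lead_monos ?G)"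
  proof (rule genideal_minimal)
    show "ideal (Idl\<^bsub>poly_ring n\<^esub> (lead_monos ?G)) (poly_ring n)"
      using G I by (intro genideal_ideal lead_monos_carrier) blast
    show "lead_monos ?I \<subseteq> Idl\<^bsub>poly_ring n\<^esub> (lead_monos ?G)"
    proof
      fix x assume "x \<in> lead_monos ?I"
      then obtain f where f: "x = Poly_Mapping.single (lead_mono f) 1" "f \<in> ?I" "f \<noteq> 0"
        unfolding lead_monos_def by blast
      have "1 \<le> n" using assms by simp
      from lead_not_standard[OF this f(2,3)] show "x \<in> Idl\<^bsub>poly_ring n\<^esub> (lead_monos ?G)"
        unfolding f(1) by (rule nonstandard_in_Idl)
    qed
  qed
  ultimately show ?thesis
    unfolding is_groebner_basis_def using ideal_jet_ideal finite_Gamma G by blast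
qed

end
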